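(* Let $D$ be a $C^*$-algebra and let $X$ and $Y$ be coarse spaces. A coarse map $\phi\colon X\to Y$ induces a $*$-homomorphism $\phi^*\colon\mathfrak{c}(Y,D)\to\mathfrak{c}(X,D)$. Close maps induce the same $*$-homomorphism $\mathfrak{c}(Y,D)\to\mathfrak{c}(X,D)$. Thus the assignment $X\mapsto\mathfrak{c}(X,D)$ is a contravariant functor from the coarse category of coarse spaces to the category of $C^*$-algebras (with $*$-homomorphisms as morphisms).
   Context: A coarse structure on a set $X$ is a collection of subsets of $X\times X$ (entourages) closed under taking subsets, finite unions, transposes and compositions $E_1\circ E_2=\{(x,z):\exists y,\ (x,y)\in E_1,(y,z)\in E_2\}$, containing the diagonal and all finite subsets of $X\times X$. A set $B$ is bounded if $B\times B$ is an entourage. A coarse space is a locally compact space with a coarse structure such that some neighbourhood of the diagonal is an entourage and bounded subsets are relatively compact. A coarse map is a Borel (not necessarily continuous) map sending entourages to entourages such that preimages of bounded sets are bounded; two coarse maps $\phi,\psi\colon X\to Y$ are close if $\{(\phi(x),\psi(x)):x\in X\}$ is an entourage. The coarse category of coarse spaces has coarse spaces as objects and closeness classes of coarse maps as morphisms. $\mathbb{K}$ is the algebra of compact operators on a separable Hilbert space. A map $f$ from $X$ to a metric space has vanishing variation if for every entourage $E$ the function $\mathrm{Var}_E f(x)=\sup\{d(f(x),f(y)):(x,y)\in E\}$ vanishes at infinity (for each $\epsilon>0$, $\{x:\mathrm{Var}_E f(x)\ge\epsilon\}$ is bounded). $\bar{\mathfrak{c}}(X,D)$ is the $C^*$-algebra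 of bounded continuous functions $X\to D\otimes\mathbb{K}$ of vanishing variation and $\mathfrak{c}(X,D)=\bar{\mathfrak{c}}(X,D)/C_0(X,D\otimes\mathbb{K})$. For continuous coarse maps, $\phi^*$ is induced by $f\mapsto f\circ\phi$. *)

theory Defs
  imports "HOL-Analysis.Analysis"
begin

section \<open>C*-algebras\<close>

text \<open>
  Algebras are complex, not necessarily unital, and carried by a subset of a type, so that
  algebras with different carriers (such as the coronas of different spaces) can be compared.
\<close>

record 'a star_algebra =
  elems :: "'a set"
  azero :: "'a"  ("\<zero>\<index>")
  aadd :: "'a \<Rightarrow> 'a \<Rightarrow> 'a"  (infixl "\<oplus>\<index>" 65)
  ascale :: "complex \<Rightarrow> 'a \<Rightarrow> 'a"  (infixr "\<odot>\<index>" 75)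
  amult :: "'a \<Rightarrow> 'a \<Rightarrow> 'a"  (infixl "\<otimes>\<index>" 70)
  astar :: "'a \<Rightarrow> 'a"

record 'a normed_star_algebra = "'a star_algebra" +
  anorm :: "'a \<Rightarrow> real"

definition adiff :: "('a, 'm) star_algebra_scheme \<Rightarrow> 'a \<Rightarrow> 'a \<Rightarrow> 'a"
  where "adiff A a b = a \<oplus>\<^bsub>A\<^esub> (-1) \<odot>\<^bsub>A\<^esub> b"

text \<open>
  The locale \<^locale>\<open>Metric_space\<close> asks for symmetry and nonnegativity of the distance on the whole
  type; hence the value \<open>0\<close> off the carrier.
\<close>

definition adist :: "('a, 'm) normed_star_algebra_scheme \<Rightarrow> 'a \<Rightarrow> 'a \<Rightarrow> real"
  where "adist A a b = (if a \<in> elems A \<and> b \<in> elems A then anorm A (adiff A a b) else 0)"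

locale star_algebra =
  fixes A :: "('a, 'm) star_algebra_scheme" (structure)
  assumes zero_closed: "\<zero> \<in> elems A"
    and add_closed: "\<lbrakk>a \<in> elems A; b \<in> elems A\<rbrakk> \<Longrightarrow> a \<oplus> b \<in> elems A"
    and scale_closed: "a \<in> elems A \<Longrightarrow> c \<odot> a \<in> elems A"
    and mult_closed: "\<lbrakk>a \<in> elems A; b \<in> elems A\<rbrakk> \<Longrightarrow> a \<otimes> b \<in> elems A"
    and star_closed: "a \<in> elems A \<Longrightarrow> astar A a \<in> elems A"
    and add_assoc: "\<lbrakk>a \<in> elems A; b \<in> elems A; d \<in> elems A\<rbrakk> \<Longrightarrow> (a \<oplus> b) \<oplus> d = a \<oplus> (b \<oplus> d)"
    and add_commute: "\<lbrakk>a \<in> elems A; b \<in> elems A\<rbrakk> \<Longrightarrow> a \<oplus> b = b \<oplus> a"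
    and zero_add: "a \<in> elems A \<Longrightarrow> \<zero> \<oplus> a = a"
    and add_uminus: "a \<in> elems A \<Longrightarrow> a \<oplus> (-1) \<odot> a = \<zero>"
    and scale_one: "a \<in> elems A \<Longrightarrow> 1 \<odot> a = a"
    and scale_scale: "a \<in> elems A \<Longrightarrow> c \<odot> (c' \<odot> a) = (c * c') \<odot> a"
    and scale_add_left: "a \<in> elems A \<Longrightarrow> (c + c') \<odot> a = c \<odot> a \<oplus> c' \<odot> a"
    and scale_add_right:
      "\<lbrakk>a \<in> elems A; b \<in> elems A\<rbrakk> \<Longrightarrow> c \<odot> (a \<oplus> b) = c \<odot> a \<oplus> c \<odot> b"
    and mult_assoc: "\<lbrakk>a \<in> elems A; b \<in> elems A; d \<in> elems A\<rbrakk> \<Longrightarrow> (a \<otimes> b) \<otimes> d = a \<otimes> (b \<otimes> d)"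
    and mult_add_left:
      "\<lbrakk>a \<in> elems A; b \<in> elems A; d \<in> elems A\<rbrakk> \<Longrightarrow> (a \<oplus> b) \<otimes> d = a \<otimes> d \<oplus> b \<otimes> d"
    and mult_add_right:
      "\<lbrakk>a \<in> elems A; b \<in> elems A; d \<in> elems A\<rbrakk> \<Longrightarrow> d \<otimes> (a \<oplus> b) = d \<otimes> a \<oplus> d \<otimes> b"
    and mult_scale_left:
      "\<lbrakk>a \<in> elems A; b \<in> elems A\<rbrakk> \<Longrightarrow> (c \<odot> a) \<otimes> b = c \<odot> (a \<otimes> b)"
    and mult_scale_right:
      "\<lbrakk>a \<in> elems A; b \<in> elems A\<rbrakk> \<Longrightarrow> a \<otimes> (c \<odot> b) = c \<odot> (a \<otimes> b)"
    and star_star: "a \<in> elems A \<Longrightarrow> astar A (astar A a) = a"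
    and star_add:
      "\<lbrakk>a \<in> elems A; b \<in> elems A\<rbrakk> \<Longrightarrow> astar A (a \<oplus> b) = astar A a \<oplus> astar A b"
    and star_scale: "a \<in> elems A \<Longrightarrow> astar A (c \<odot> a) = cnj c \<odot> astar A a"
    and star_mult:
      "\<lbrakk>a \<in> elems A; b \<in> elems A\<rbrakk> \<Longrightarrow> astar A (a \<otimes> b) = astar A b \<otimes> astar A a"

locale cstar_algebra = star_algebra A
  for A :: "'a normed_star_algebra" (structure) +
  assumes norm_nonneg: "a \<in> elems A \<Longrightarrow> 0 \<le> anorm A a"
    and norm_eq_zero: "a \<in> elems A \<Longrightarrow> anorm A a = 0 \<longleftrightarrow> a = \<zero>"
    and norm_triangle:
      "\<lbrakk>a \<in> elems A; b \<in> elems A\<rbrakk> \<Longrightarrow> anorm A (a \<oplus> b) \<le> anorm A a + anorm A b"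
    and norm_scale: "a \<in> elems A \<Longrightarrow> anorm A (c \<odot> a) = cmod c * anorm A a"
    and norm_mult:
      "\<lbrakk>a \<in> elems A; b \<in> elems A\<rbrakk> \<Longrightarrow> anorm A (a \<otimes> b) \<le> anorm A a * anorm A b"
    and cstar_identity: "a \<in> elems A \<Longrightarrow> anorm A (astar A a \<otimes> a) = (anorm A a)\<^sup>2"
    and complete: "Metric_space.mcomplete (elems A) (adist A)"

text \<open>The homomorphisms are extensional, so that equality of morphisms is equality of functions.\<close>

definition star_homs ::
    "('a, 'm) star_algebra_scheme \<Rightarrow> ('b, 'n) star_algebra_scheme \<Rightarrow> ('a \<Rightarrow> 'b) set"
  where "star_homs A B = {h \<in> elems A \<rightarrow>\<^sub>E elems B.
    (\<forall>a \<in> elems A. \<forall>b \<in> elems A. h (a \<oplus>\<^bsub>A\<^esub> b) = h a \<oplus>\<^bsub>B\<^esub> h b) \<and>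
    (\<forall>c. \<forall>a \<in> elems A. h (c \<odot>\<^bsub>A\<^esub> a) = c \<odot>\<^bsub>B\<^esub> h a) \<and>
    (\<forall>a \<in> elems A. \<forall>b \<in> elems A. h (a \<otimes>\<^bsub>A\<^esub> b) = h a \<otimes>\<^bsub>B\<^esub> h b) \<and>
    (\<forall>a \<in> elems A. h (astar A a) = astar B (h a))}"


section \<open>Quotients and completions\<close>

definition acoset :: "('a, 'm) star_algebra_scheme \<Rightarrow> 'a set \<Rightarrow> 'a \<Rightarrow> 'a set"
  where "acoset A I a = {b \<in> elems A. adiff A b a \<in> I}"

definition quotient_algebra ::
    "'a normed_star_algebra \<Rightarrow> 'a set \<Rightarrow> 'a set normed_star_algebra"
  where "quotient_algebra A I =
    \<lparr>elems = acoset A I ` elems A,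
     azero = acoset A I \<zero>\<^bsub>A\<^esub>,
     aadd = (\<lambda>P Q. \<Union>a\<in>P. \<Union>b\<in>Q. acoset A I (a \<oplus>\<^bsub>A\<^esub> b)),
     ascale = (\<lambda>c P. \<Union>a\<in>P. acoset A I (c \<odot>\<^bsub>A\<^esub> a)),
     amult = (\<lambda>P Q. \<Union>a\<in>P. \<Union>b\<in>Q. acoset A I (a \<otimes>\<^bsub>A\<^esub> b)),
     astar = (\<lambda>P. \<Union>a\<in>P. acoset A I (astar A a)),
     anorm = (\<lambda>P. INF a\<in>P. anorm A a)\<rparr>"

text \<open>
  Below \<open>A\<close> need only be seminormed: its Hausdorff completion consists of the Cauchy sequences
  modulo the null sequences.
\<close>

definition cauchy_sequences :: "'a normed_star_algebra \<Rightarrow> (nat \<Rightarrow> 'a) normed_star_algebra"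
  where "cauchy_sequences A =
    \<lparr>elems = {s. range s \<subseteq> elems A \<and>
               (\<forall>\<epsilon>>0. \<exists>N. \<forall>m\<ge>N. \<forall>n\<ge>N. anorm A (adiff A (s m) (s n)) < \<epsilon>)},
     azero = (\<lambda>_. \<zero>\<^bsub>A\<^esub>),
     aadd = (\<lambda>s t n. s n \<oplus>\<^bsub>A\<^esub> t n),
     ascale = (\<lambda>c s n. c \<odot>\<^bsub>A\<^esub> s n),
     amult = (\<lambda>s t n. s n \<otimes>\<^bsub>A\<^esub> t n),
     astar = (\<lambda>s n. astar A (s n)),
     anorm = (\<lambda>s. lim (\<lambda>n. anorm A (s n)))\<rparr>"

definition completion :: "'a normed_star_algebra \<Rightarrow> (nat \<Rightarrow> 'a) set normed_star_algebra"
  where "completion A = quotient_algebra (cauchy_sequences A)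
    {s \<in> elems (cauchy_sequences A). (\<lambda>n. anorm A (s n)) \<longlonglongrightarrow> 0}"


section \<open>Tensor products of C*-algebras\<close>

text \<open>
  The algebraic tensor product of \<open>A\<close> and \<open>B\<close> is presented by generators and relations. Formal
  tensors are the finitely supported functions on pairs, a function \<open>u\<close> standing for the formal sum
  of the \<open>u (a, b)\<close> times \<open>a \<otimes> b\<close>. They form a *-algebra with
  \<open>(a \<otimes> b) (a' \<otimes> b') = a a' \<otimes> b b'\<close> and \<open>(a \<otimes> b)* = a* \<otimes> b*\<close>. The relations that make
  \<open>\<otimes>\<close> bilinear are imposed in \<open>tensor_seminorms\<close>.
\<close>

definition formal_tensors ::
    "('a, 'm) star_algebra_scheme \<Rightarrow> ('b, 'n) star_algebra_scheme
      \<Rightarrow> ('a \<times> 'b \<Rightarrow> complex) star_algebra"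
  where "formal_tensors A B =
    \<lparr>elems = {u. finite {z. u z \<noteq> 0} \<and> {z. u z \<noteq> 0} \<subseteq> elems A \<times> elems B},
     azero = (\<lambda>_. 0),
     aadd = (\<lambda>u v z. u z + v z),
     ascale = (\<lambda>c u z. c * u z),
     amult = (\<lambda>u v z. \<Sum>((a, b), (a', b')) \<in> {x. u x \<noteq> 0} \<times> {y. v y \<noteq> 0}.
       if (a \<otimes>\<^bsub>A\<^esub> a', b \<otimes>\<^bsub>B\<^esub> b') = z then u (a, b) * v (a', b') else 0),
     astar = (\<lambda>u z. \<Sum>(a, b) \<in> {x. u x \<noteq> 0}.
       if (astar A a, astar B b) = z then cnj (u (a, b)) else 0)\<rparr>"

definition pure_tensor :: "'a \<Rightarrow> 'b \<Rightarrow> 'a \<times> 'b \<Rightarrow> complex"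
  where "pure_tensor a b = (\<lambda>z. if z = (a, b) then 1 else 0)"

definition cstar_seminorm :: "('a, 'm) star_algebra_scheme \<Rightarrow> ('a \<Rightarrow> real) \<Rightarrow> bool"
  where "cstar_seminorm A p \<longleftrightarrow>
    (\<forall>a \<in> elems A. 0 \<le> p a) \<and>
    (\<forall>a \<in> elems A. \<forall>b \<in> elems A. p (a \<oplus>\<^bsub>A\<^esub> b) \<le> p a + p b) \<and>
    (\<forall>c. \<forall>a \<in> elems A. p (c \<odot>\<^bsub>A\<^esub> a) = cmod c * p a) \<and>
    (\<forall>a \<in> elems A. \<forall>b \<in> elems A. p (a \<otimes>\<^bsub>A\<^esub> b) \<le> p a * p b) \<and>
    (\<forall>a \<in> elems A. p (astar A a \<otimes>\<^bsub>A\<^esub> a) = (p a)\<^sup>2)"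

text \<open>
  These are exactly the C*-seminorms of the algebraic tensor product. The last condition holds for
  each of them automatically; including it makes the supremum below visibly finite.
\<close>

definition tensor_seminorms ::
    "'a normed_star_algebra \<Rightarrow> 'b normed_star_algebra \<Rightarrow> (('a \<times> 'b \<Rightarrow> complex) \<Rightarrow> real) set"
  where "tensor_seminorms A B = {p. cstar_seminorm (formal_tensors A B) p \<and>
    (\<forall>a \<in> elems A. \<forall>a' \<in> elems A. \<forall>b \<in> elems B.
      p (\<lambda>z. pure_tensor (a \<oplus>\<^bsub>A\<^esub> a') b z - pure_tensor a b z - pure_tensor a' b z) = 0) \<and>
    (\<forall>a \<in> elems A. \<forall>b \<in> elems B. \<forall>b' \<in> elems B.
      p (\<lambda>z. pure_tensor a (b \<oplus>\<^bsub>B\<^esub> b') z - pure_tensor a b z - pure_tensor a b' z) = 0) \<and>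
    (\<forall>c. \<forall>a \<in> elems A. \<forall>b \<in> elems B.
      p (\<lambda>z. pure_tensor (c \<odot>\<^bsub>A\<^esub> a) b z - c * pure_tensor a b z) = 0) \<and>
    (\<forall>c. \<forall>a \<in> elems A. \<forall>b \<in> elems B.
      p (\<lambda>z. pure_tensor a (c \<odot>\<^bsub>B\<^esub> b) z - c * pure_tensor a b z) = 0) \<and>
    (\<forall>a \<in> elems A. \<forall>b \<in> elems B. p (pure_tensor a b) \<le> anorm A a * anorm B b)}"

text \<open>
  The completion of the algebraic tensor product in its largest C*-norm. When one factor is nuclear,
  as the compact operators are, that norm is the only C*-norm, so this is the C*-tensor product
  without ambiguity.
\<close>

definition cstar_tensor ::
    "'a normed_star_algebra \<Rightarrow> 'b normed_star_algebra
      \<Rightarrow> (nat \<Rightarrow> 'a \<times> 'b \<Rightarrow> complex) set normed_star_algebra"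
  where "cstar_tensor A B = completion
    (star_algebra.extend (formal_tensors A B)
      (normed_star_algebra.fields (\<lambda>u. SUP p\<in>tensor_seminorms A B. p u)))"


section \<open>Compact operators\<close>

text \<open>The separable Hilbert space is \<open>\<ell>\<^sup>2\<close> over the natural numbers.\<close>

type_synonym cseq = "nat \<Rightarrow> complex"

definition ell2 :: "cseq set"
  where "ell2 = {x. summable (\<lambda>n. (cmod (x n))\<^sup>2)}"

definition ell2_inner :: "cseq \<Rightarrow> cseq \<Rightarrow> complex"
  where "ell2_inner x y = (\<Sum>n. x n * cnj (y n))"

definition ell2_norm :: "cseq \<Rightarrow> real"
  where "ell2_norm x = sqrt (\<Sum>n. (cmod (x n))\<^sup>2)"

definition ell2_dist :: "cseq \<Rightarrow> cseq \<Rightarrow> real"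
  where "ell2_dist x y =
    (if x \<in> ell2 \<and> y \<in> ell2 then ell2_norm (\<lambda>n. x n - y n) else 0)"

abbreviation ell2_topology :: "cseq topology"
  where "ell2_topology \<equiv> Metric_space.mtopology ell2 ell2_dist"

definition compact_operators :: "(cseq \<Rightarrow> cseq) set"
  where "compact_operators = {T \<in> ell2 \<rightarrow>\<^sub>E ell2.
    (\<forall>x \<in> ell2. \<forall>y \<in> ell2. T (\<lambda>n. x n + y n) = (\<lambda>n. T x n + T y n)) \<and>
    (\<forall>c. \<forall>x \<in> ell2. T (\<lambda>n. c * x n) = (\<lambda>n. c * T x n)) \<and>
    compactin ell2_topology
      (ell2_topology closure_of (T ` {x \<in> ell2. ell2_norm x \<le> 1}))}"

definition compact_operator_algebra :: "(cseq \<Rightarrow> cseq) normed_star_algebra"  ("\<K>")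
  where "\<K> =
    \<lparr>elems = compact_operators,
     azero = (\<lambda>x\<in>ell2. \<lambda>_. 0),
     aadd = (\<lambda>S T. \<lambda>x\<in>ell2. \<lambda>n. S x n + T x n),
     ascale = (\<lambda>c T. \<lambda>x\<in>ell2. \<lambda>n. c * T x n),
     amult = (\<lambda>S T. compose ell2 S T),
     astar = (\<lambda>T. THE S. S \<in> compact_operators \<and>
       (\<forall>x \<in> ell2. \<forall>y \<in> ell2. ell2_inner (T x) y = ell2_inner x (S y))),
     anorm = (\<lambda>T. SUP x\<in>{x \<in> ell2. ell2_norm x \<le> 1}. ell2_norm (T x))\<rparr>"


section \<open>Coarse spaces and coarse maps\<close>

definition coarse_structure :: "'x set \<Rightarrow> ('x \<times> 'x) set set \<Rightarrow> bool"
  where "coarse_structure S \<E> \<longleftrightarrow>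
    (\<forall>E \<in> \<E>. E \<subseteq> S \<times> S) \<and>
    (\<forall>E \<in> \<E>. \<forall>E'. E' \<subseteq> E \<longrightarrow> E' \<in> \<E>) \<and>
    (\<forall>E \<in> \<E>. \<forall>E' \<in> \<E>. E \<union> E' \<in> \<E>) \<and>
    (\<forall>E \<in> \<E>. E\<inverse> \<in> \<E>) \<and>
    (\<forall>E \<in> \<E>. \<forall>E' \<in> \<E>. E O E' \<in> \<E>) \<and>
    Id_on S \<in> \<E> \<and>
    (\<forall>F. finite F \<and> F \<subseteq> S \<times> S \<longrightarrow> F \<in> \<E>)"

record 'x coarse_data =
  ctop :: "'x topology"
  entourages :: "('x \<times> 'x) set set"

abbreviation points :: "'x coarse_data \<Rightarrow> 'x set"
  where "points X \<equiv> topspace (ctop X)"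

definition coarsely_bounded :: "'x coarse_data \<Rightarrow> 'x set \<Rightarrow> bool"
  where "coarsely_bounded X B \<longleftrightarrow> B \<times> B \<in> entourages X"

text \<open>As usual for C*-algebras of functions, locally compact spaces are understood to be Hausdorff.\<close>

definition coarse_space :: "'x coarse_data \<Rightarrow> bool"
  where "coarse_space X \<longleftrightarrow>
    locally_compact_space (ctop X) \<and> Hausdorff_space (ctop X) \<and>
    coarse_structure (points X) (entourages X) \<and>
    (\<exists>E \<in> entourages X. \<exists>U. openin (prod_topology (ctop X) (ctop X)) U \<and>
      Id_on (points X) \<subseteq> U \<and> U \<subseteq> E) \<and>
    (\<forall>B. coarsely_bounded X B \<longrightarrow> compactin (ctop X) (ctop X closure_of B))"

definition borel_of :: "'x topology \<Rightarrow> 'x measure"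
  where "borel_of T = sigma (topspace T) {U. openin T U}"

definition coarse_maps :: "'x coarse_data \<Rightarrow> 'y coarse_data \<Rightarrow> ('x \<Rightarrow> 'y) set"
  where "coarse_maps X Y = {\<phi> \<in> points X \<rightarrow>\<^sub>E points Y.
    \<phi> \<in> borel_of (ctop X) \<rightarrow>\<^sub>M borel_of (ctop Y) \<and>
    (\<forall>E \<in> entourages X. map_prod \<phi> \<phi> ` E \<in> entourages Y) \<and>
    (\<forall>B. coarsely_bounded Y B \<longrightarrow> coarsely_bounded X (\<phi> -` B \<inter> points X))}"

definition close_maps :: "'x coarse_data \<Rightarrow> 'y coarse_data \<Rightarrow> ('x \<Rightarrow> 'y) \<Rightarrow> ('x \<Rightarrow> 'y) \<Rightarrow> bool"
  where "close_maps X Y \<phi> \<psi> \<longleftrightarrow> (\<lambda>x. (\<phi> x, \<psi> x)) ` points X \<in> entourages Y"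

definition closeness_class ::
    "'x coarse_data \<Rightarrow> 'y coarse_data \<Rightarrow> ('x \<Rightarrow> 'y) \<Rightarrow> ('x \<Rightarrow> 'y) set"
  where "closeness_class X Y \<phi> = {\<psi> \<in> coarse_maps X Y. close_maps X Y \<phi> \<psi>}"


section \<open>The stable Higson corona\<close>

definition vanishes_at_infinity :: "'x coarse_data \<Rightarrow> ('x \<Rightarrow> ennreal) \<Rightarrow> bool"
  where "vanishes_at_infinity X h \<longleftrightarrow>
    (\<forall>\<epsilon>>0. coarsely_bounded X {x \<in> points X. ennreal \<epsilon> \<le> h x})"

text \<open>Taken in the extended nonnegative reals, where the supremum of the empty set is \<open>0\<close>.\<close>

definition variation ::
    "'a normed_star_algebra \<Rightarrow> ('x \<times> 'x) set \<Rightarrow> ('x \<Rightarrow> 'a) \<Rightarrow> 'x \<Rightarrow> ennreal"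
  where "variation A E f x = (SUP y \<in> E `` {x}. ennreal (adist A (f x) (f y)))"

definition vanishing_variation ::
    "'a normed_star_algebra \<Rightarrow> 'x coarse_data \<Rightarrow> ('x \<Rightarrow> 'a) \<Rightarrow> bool"
  where "vanishing_variation A X f \<longleftrightarrow>
    (\<forall>E \<in> entourages X. vanishes_at_infinity X (variation A E f))"

definition algebra_topology :: "'a normed_star_algebra \<Rightarrow> 'a topology"
  where "algebra_topology A = Metric_space.mtopology (elems A) (adist A)"

definition vv_functions ::
    "'a normed_star_algebra \<Rightarrow> 'x coarse_data \<Rightarrow> ('x \<Rightarrow> 'a) normed_star_algebra"
  where "vv_functions A X =
    \<lparr>elems = {f \<in> points X \<rightarrow>\<^sub>E elems A.
       continuous_map (ctop X) (algebra_topology A) f \<and>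
       (\<exists>C. \<forall>x \<in> points X. anorm A (f x) \<le> C) \<and>
       vanishing_variation A X f},
     azero = (\<lambda>x\<in>points X. \<zero>\<^bsub>A\<^esub>),
     aadd = (\<lambda>f g. \<lambda>x\<in>points X. f x \<oplus>\<^bsub>A\<^esub> g x),
     ascale = (\<lambda>c f. \<lambda>x\<in>points X. c \<odot>\<^bsub>A\<^esub> f x),
     amult = (\<lambda>f g. \<lambda>x\<in>points X. f x \<otimes>\<^bsub>A\<^esub> g x),
     astar = (\<lambda>f. \<lambda>x\<in>points X. astar A (f x)),
     anorm = (\<lambda>f. Sup (insert 0 ((\<lambda>x. anorm A (f x)) ` points X)))\<rparr>"

definition C0_functions :: "'a normed_star_algebra \<Rightarrow> 'x topology \<Rightarrow> ('x \<Rightarrow> 'a) set"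
  where "C0_functions A T = {f \<in> topspace T \<rightarrow>\<^sub>E elems A.
    continuous_map T (algebra_topology A) f \<and>
    (\<forall>\<epsilon>>0. compactin T {x \<in> topspace T. \<epsilon> \<le> anorm A (f x)})}"

text \<open>The type of the elements of the tensor product of \<open>D\<close> with the compact operators.\<close>

type_synonym 'd stable = "(nat \<Rightarrow> 'd \<times> (cseq \<Rightarrow> cseq) \<Rightarrow> complex) set"

definition corona_functions ::
    "'d normed_star_algebra \<Rightarrow> 'x coarse_data \<Rightarrow> ('x \<Rightarrow> 'd stable) normed_star_algebra"
  where "corona_functions D X = vv_functions (cstar_tensor D \<K>) X"

definition corona_ideal :: "'d normed_star_algebra \<Rightarrow> 'x coarse_data \<Rightarrow> ('x \<Rightarrow> 'd stable) set"
  where "corona_ideal D X = C0_functions (cstar_tensor D \<K>) (ctop X)"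

definition corona ::
    "'d normed_star_algebra \<Rightarrow> 'x coarse_data \<Rightarrow> ('x \<Rightarrow> 'd stable) set normed_star_algebra"
  where "corona D X = quotient_algebra (corona_functions D X) (corona_ideal D X)"

definition corona_class ::
    "'d normed_star_algebra \<Rightarrow> 'x coarse_data \<Rightarrow> ('x \<Rightarrow> 'd stable) \<Rightarrow> ('x \<Rightarrow> 'd stable) set"
  where "corona_class D X f = acoset (corona_functions D X) (corona_ideal D X) f"

text \<open>
  If \<open>\<phi>\<close> is a Borel coarse map, then \<open>f \<circ> \<phi>\<close> is a Borel function of vanishing variation, in general
  not continuous. The image of the class of \<open>f\<close> consists of the functions in \<open>corona_functions D X\<close>
  that agree with \<open>f \<circ> \<phi>\<close> up to a (Borel) function vanishing at infinity.
\<close>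

definition corona_map ::
    "'d normed_star_algebra \<Rightarrow> 'x coarse_data \<Rightarrow> 'y coarse_data \<Rightarrow> ('x \<Rightarrow> 'y)
      \<Rightarrow> ('y \<Rightarrow> 'd stable) set \<Rightarrow> ('x \<Rightarrow> 'd stable) set"
  where "corona_map D X Y \<phi> = (\<lambda>P \<in> elems (corona D Y).
    {g \<in> elems (corona_functions D X). \<exists>f\<in>P.
      vanishes_at_infinity X (\<lambda>x. ennreal (adist (cstar_tensor D \<K>) (g x) (f (\<phi> x))))})"


section \<open>Categories\<close>

text \<open>\<open>Comp C X Y Z g f\<close> is the composite of \<open>f : X \<rightarrow> Y\<close> and \<open>g : Y \<rightarrow> Z\<close>.\<close>

record ('o, 'm) category =
  Obj :: "'o set"
  Hom :: "'o \<Rightarrow> 'o \<Rightarrow> 'm set"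
  Ident :: "'o \<Rightarrow> 'm"
  Comp :: "'o \<Rightarrow> 'o \<Rightarrow> 'o \<Rightarrow> 'm \<Rightarrow> 'm \<Rightarrow> 'm"

definition is_category :: "('o, 'm) category \<Rightarrow> bool"
  where "is_category C \<longleftrightarrow>
    (\<forall>X \<in> Obj C. Ident C X \<in> Hom C X X) \<and>
    (\<forall>X \<in> Obj C. \<forall>Y \<in> Obj C. \<forall>Z \<in> Obj C. \<forall>f \<in> Hom C X Y. \<forall>g \<in> Hom C Y Z.
      Comp C X Y Z g f \<in> Hom C X Z) \<and>
    (\<forall>X \<in> Obj C. \<forall>Y \<in> Obj C. \<forall>f \<in> Hom C X Y.
      Comp C X X Y f (Ident C X) = f \<and> Comp C X Y Y (Ident C Y) f = f) \<and>
    (\<forall>W \<in> Obj C. \<forall>X \<in> Obj C. \<forall>Y \<in> Obj C. \<forall>Z \<in> Obj C.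
      \<forall>f \<in> Hom C W X. \<forall>g \<in> Hom C X Y. \<forall>h \<in> Hom C Y Z.
      Comp C W Y Z h (Comp C W X Y g f) = Comp C W X Z (Comp C X Y Z h g) f)"

definition contravariant_functor ::
    "('o, 'm) category \<Rightarrow> ('p, 'n) category \<Rightarrow> ('o \<Rightarrow> 'p) \<Rightarrow> ('o \<Rightarrow> 'o \<Rightarrow> 'm \<Rightarrow> 'n) \<Rightarrow> bool"
  where "contravariant_functor C C' F G \<longleftrightarrow>
    is_category C \<and> is_category C' \<and>
    (\<forall>X \<in> Obj C. F X \<in> Obj C') \<and>
    (\<forall>X \<in> Obj C. \<forall>Y \<in> Obj C. \<forall>f \<in> Hom C X Y. G X Y f \<in> Hom C' (F Y) (F X)) \<and>
    (\<forall>X \<in> Obj C. G X X (Ident C X) = Ident C' (F X)) \<and>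
    (\<forall>X \<in> Obj C. \<forall>Y \<in> Obj C. \<forall>Z \<in> Obj C. \<forall>f \<in> Hom C X Y. \<forall>g \<in> Hom C Y Z.
      G X Z (Comp C X Y Z g f) = Comp C' (F Z) (F Y) (F X) (G X Y f) (G Y Z g))"

definition coarse_category :: "('x coarse_data, ('x \<Rightarrow> 'x) set) category"
  where "coarse_category =
    \<lparr>Obj = {X. coarse_space X},
     Hom = (\<lambda>X Y. closeness_class X Y ` coarse_maps X Y),
     Ident = (\<lambda>X. closeness_class X X (\<lambda>x\<in>points X. x)),
     Comp = (\<lambda>X Y Z G F. \<Union>\<psi>\<in>G. \<Union>\<phi>\<in>F. closeness_class X Z (compose (points X) \<psi> \<phi>))\<rparr>"

definition cstar_category :: "('a normed_star_algebra, 'a \<Rightarrow> 'a) category"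
  where "cstar_category =
    \<lparr>Obj = {A. cstar_algebra A},
     Hom = star_homs,
     Ident = (\<lambda>A. \<lambda>a\<in>elems A. a),
     Comp = (\<lambda>A B C g f. compose (elems A) g f)\<rparr>"

end

theory Submission
  imports Defs
begin

text \<open>
  Let \<open>A\<close> be the C*-algebra \<open>D \<otimes> \<K>\<close>. A class in the corona is a function of vanishing variation up to
  functions that vanish at infinity, so it only remembers behaviour at infinity. If \<open>\<phi> : X \<rightarrow> Y\<close> is
  a coarse map and \<open>f\<close> has vanishing variation on \<open>Y\<close>, then \<open>f \<circ> \<phi>\<close> has vanishing variation on \<open>X\<close>,
  and it differs from some continuous function \<open>g\<close> of vanishing variation by a function that vanishes
  at infinity (\<open>exists_V_approximation\<close>). The class of \<open>g\<close> is uniquely determined, and it is the image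
  of the class of \<open>f\<close> (\<open>pullback_coset\<close>). The rest follows from formal properties of the relation
  ``the difference vanishes at infinity'' (\<open>asymptotic\<close>): it is compatible with the algebraic
  operations on bounded functions and with composition with coarse maps, and \<open>f \<circ> \<phi>\<close> and \<open>f \<circ> \<psi>\<close> are
  related if \<open>\<phi>\<close> and \<open>\<psi>\<close> are close, because \<open>f\<close> varies little along the entourage of all
  \<open>(\<phi> x, \<psi> x)\<close> away from a bounded set.

  For the approximation, take a symmetric entourage \<open>E\<close> that contains an open neighbourhood of the
  diagonal. The value \<open>g x\<close> is to be no further from \<open>f (\<phi> x)\<close> than the variation of \<open>f \<circ> \<phi>\<close>
  at \<open>x\<close> along \<open>E\<close>; this confines it to a ball, which is convex, and near a point \<open>z\<close> the constant
  \<open>f (\<phi> z)\<close> is a solution. Finitely many constants are blended by Urysohn functions to a solution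
  on a compact set. The points that are joined to a given one by a chain along \<open>E\<close> form an open and
  closed subset that is exhausted by a sequence of compact sets, as bounded sets are relatively
  compact, and the solutions on these are blended in turn.

  That the corona is a C*-algebra is checked on representatives. Completeness is inherited from the
  algebra of functions by lifting a rapidly converging sequence term by term
  (\<open>seminorm_complete_Q\<close>). The C*-identity for the quotient norm holds because a function whose norm
  exceeds \<open>r\<close> only on a compact set can be truncated to norm \<open>r\<close> without leaving its class
  (\<open>cstar_algebra_corona\<close>). Finally, \<open>A\<close> itself is the completion of the *-algebra of formal tensors
  in a supremum of C*-seminorms. This rests on the *-algebra structure of \<open>\<K>\<close>, where the point is
  that a compact operator has a compact adjoint (\<open>adjoint_exists\<close>).
\<close>

section \<open>Algebra and C*-seminorms\<close>

context star_algebra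
begin

abbreviation adiff_syntax (infixl "\<ominus>" 65) where "a \<ominus> b \<equiv> adiff A a b"

lemmas closed = zero_closed add_closed scale_closed mult_closed star_closed
declare closed [simp, intro]

lemma diff_closed [simp, intro]: "\<lbrakk>a \<in> elems A; b \<in> elems A\<rbrakk> \<Longrightarrow> a \<ominus> b \<in> elems A"
  by (simp add: adiff_def)

lemma add_left_commute:
  "\<lbrakk>a \<in> elems A; b \<in> elems A; d \<in> elems A\<rbrakk> \<Longrightarrow> a \<oplus> (b \<oplus> d) = b \<oplus> (a \<oplus> d)"
  by (metis add_assoc add_commute)

lemmas add_ac = add_assoc add_commute add_left_commute

lemma add_zero: "a \<in> elems A \<Longrightarrow> a \<oplus> \<zero> = a"
  by (metis add_commute zero_add zero_closed)

lemma scale_zero_left: "a \<in> elems A \<Longrightarrow> 0 \<odot> a = \<zero>"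
  using scale_add_left[of a 1 "-1"] by (simp add: scale_one add_uminus)

lemma scale_zero_right: "c \<odot> \<zero> = \<zero>"
  using scale_scale[of "\<zero>" c 0] by (simp add: scale_zero_left)

lemma diff_self: "a \<in> elems A \<Longrightarrow> a \<ominus> a = \<zero>"
  by (simp add: adiff_def add_uminus)

lemma diff_zero: "a \<in> elems A \<Longrightarrow> a \<ominus> \<zero> = a"
  by (simp add: adiff_def scale_zero_right add_zero)

lemma minus_add_cancel: "\<lbrakk>a \<in> elems A; b \<in> elems A\<rbrakk> \<Longrightarrow> b \<oplus> ((-1) \<odot> b \<oplus> a) = a"
  by (metis add_assoc add_uminus scale_closed zero_add)

lemma add_diff_cancel: "\<lbrakk>a \<in> elems A; b \<in> elems A\<rbrakk> \<Longrightarrow> b \<oplus> (a \<ominus> b) = a"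
  unfolding adiff_def by (metis add_commute minus_add_cancel scale_closed)

lemma add_diff_cancel_left: "\<lbrakk>a \<in> elems A; b \<in> elems A\<rbrakk> \<Longrightarrow> (b \<oplus> a) \<ominus> b = a"
  unfolding adiff_def by (simp add: add_assoc) (metis add_commute minus_add_cancel scale_closed)

lemma diff_eq_zero: "\<lbrakk>a \<in> elems A; b \<in> elems A\<rbrakk> \<Longrightarrow> a \<ominus> b = \<zero> \<longleftrightarrow> a = b"
  by (metis add_diff_cancel add_zero diff_self)

lemma diff_add_diff:
  "\<lbrakk>a \<in> elems A; b \<in> elems A; d \<in> elems A\<rbrakk> \<Longrightarrow> (a \<ominus> b) \<oplus> (b \<ominus> d) = a \<ominus> d"
  unfolding adiff_def by (simp add: add_assoc) (metis add_assoc add_commute minus_add_cancel scale_closed)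

lemma add_diff_add:
  "\<lbrakk>a \<in> elems A; b \<in> elems A; a' \<in> elems A; b' \<in> elems A\<rbrakk>
    \<Longrightarrow> (a \<oplus> b) \<ominus> (a' \<oplus> b') = (a \<ominus> a') \<oplus> (b \<ominus> b')"
  unfolding adiff_def by (simp add: scale_add_right add_ac)

lemma scale_diff:
  "\<lbrakk>a \<in> elems A; b \<in> elems A\<rbrakk> \<Longrightarrow> c \<odot> a \<ominus> c \<odot> b = c \<odot> (a \<ominus> b)"
  unfolding adiff_def by (simp add: scale_add_right scale_scale)

lemma scale_diff_left: "a \<in> elems A \<Longrightarrow> c \<odot> a \<ominus> c' \<odot> a = (c - c') \<odot> a"
  unfolding adiff_def using scale_add_left[of a c "-c'"] by (simp add: scale_scale)

lemma minus_diff: "\<lbrakk>a \<in> elems A; b \<in> elems A\<rbrakk> \<Longrightarrow> (-1) \<odot> (a \<ominus> b) = b \<ominus> a"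
  unfolding adiff_def by (simp add: scale_add_right scale_scale scale_one add_commute)

lemma star_diff: "\<lbrakk>a \<in> elems A; b \<in> elems A\<rbrakk> \<Longrightarrow> astar A a \<ominus> astar A b = astar A (a \<ominus> b)"
  unfolding adiff_def by (simp add: star_add star_scale)

lemma mult_diff:
  assumes "a \<in> elems A" "b \<in> elems A" "a' \<in> elems A" "b' \<in> elems A"
  shows "a \<otimes> b \<ominus> a' \<otimes> b' = a \<otimes> (b \<ominus> b') \<oplus> (a \<ominus> a') \<otimes> b'"
proof -
  have "a \<otimes> (b \<ominus> b') = a \<otimes> b \<ominus> a \<otimes> b'" "(a \<ominus> a') \<otimes> b' = a \<otimes> b' \<ominus> a' \<otimes> b'"
    using assms unfolding adiff_def
    by (simp_all add: mult_add_left mult_add_right mult_scale_left mult_scale_right)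
  then show ?thesis using assms by (simp add: diff_add_diff)
qed

text \<open>
  Applied to \<open>c\<close> and to its inverse, an inequality becomes an equation. Infima and suprema of seminorms
  visibly satisfy the inequality only.
\<close>

lemma seminorm_scale:
  assumes nonneg: "\<And>a. a \<in> elems A \<Longrightarrow> 0 \<le> p a"
    and le: "\<And>c a. a \<in> elems A \<Longrightarrow> p (c \<odot> a) \<le> cmod c * p a"
    and a: "a \<in> elems A"
  shows "p (c \<odot> a) = cmod c * p a"
proof (cases "c = 0")
  case True then show ?thesis using le[OF a, of 0] nonneg[of "0 \<odot> a"] a by simp
next
  case False
  have "p a \<le> cmod (inverse c) * p (c \<odot> a)"
    using le[of "c \<odot> a" "inverse c"] a False by (simp add: scale_scale scale_one)
  then have "cmod c * p a \<le> p (c \<odot> a)"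
    using False by (simp add: norm_inverse norm_divide field_simps)
  then show ?thesis using le[OF a, of c] by simp
qed

end

text \<open>
  All C*-algebras below arise in the same way: a *-algebra with a seminorm that satisfies the
  C*-identity is divided by an ideal.
\<close>

locale cstar_seminormed = star_algebra A for A :: "'a normed_star_algebra" (structure) +
  assumes norm_nonneg: "a \<in> elems A \<Longrightarrow> 0 \<le> anorm A a"
    and norm_triangle:
      "\<lbrakk>a \<in> elems A; b \<in> elems A\<rbrakk> \<Longrightarrow> anorm A (a \<oplus> b) \<le> anorm A a + anorm A b"
    and norm_scale: "a \<in> elems A \<Longrightarrow> anorm A (c \<odot> a) = cmod c * anorm A a"
    and norm_mult:
      "\<lbrakk>a \<in> elems A; b \<in> elems A\<rbrakk> \<Longrightarrow> anorm A (a \<otimes> b) \<le> anorm A a * anorm A b"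
    and cstar_identity: "a \<in> elems A \<Longrightarrow> anorm A (astar A a \<otimes> a) = (anorm A a)\<^sup>2"

lemma Cauchy_combine:
  fixes p q r :: "nat \<Rightarrow> nat \<Rightarrow> real"
  assumes p: "\<forall>\<epsilon>>0. \<exists>N. \<forall>m\<ge>N. \<forall>n\<ge>N. p m n < \<epsilon>" and q: "\<forall>\<epsilon>>0. \<exists>N. \<forall>m\<ge>N. \<forall>n\<ge>N. q m n < \<epsilon>"
    and nonneg: "\<And>m n. 0 \<le> p m n" "\<And>m n. 0 \<le> q m n"
    and le: "\<And>m n. r m n \<le> K * (p m n + q m n)"
  shows "\<forall>\<epsilon>>0. \<exists>N. \<forall>m\<ge>N. \<forall>n\<ge>N. r m n < \<epsilon>"
proof (intro allI impI)
  fix e :: real assume e: "e > 0"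
  \<comment> \<open>The summand \<open>1\<close> keeps \<open>d\<close> meaningful for \<open>K = 0\<close>.\<close>
  define d where "d = e / (2 * (\<bar>K\<bar> + 1))"
  have d: "d > 0" using e by (simp add: d_def)
  obtain M where M: "\<forall>m\<ge>M. \<forall>n\<ge>M. p m n < d" using p d by blast
  obtain N where N: "\<forall>m\<ge>N. \<forall>n\<ge>N. q m n < d" using q d by blast
  have "r m n < e" if mn: "m \<ge> max M N" "n \<ge> max M N" for m n
  proof -
    have "p m n < d" "q m n < d" using M N mn by auto
    then have "K * (p m n + q m n) \<le> \<bar>K\<bar> * (p m n + q m n)" "\<bar>K\<bar> * (p m n + q m n) \<le> \<bar>K\<bar> * (2 * d)"
      using nonneg by (auto intro!: mult_right_mono mult_left_mono)
    moreover have "\<bar>K\<bar> * (2 * d) < (\<bar>K\<bar> + 1) * (2 * d)" using d by simp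
    moreover have "(\<bar>K\<bar> + 1) * (2 * d) = e" by (simp add: d_def field_simps add_pos_nonneg)
    ultimately show ?thesis using le[of m n] by linarith
  qed
  then show "\<exists>N. \<forall>m\<ge>N. \<forall>n\<ge>N. r m n < e" by blast
qed

definition seminorm_complete :: "'a normed_star_algebra \<Rightarrow> bool"
  where "seminorm_complete A \<longleftrightarrow>
    (\<forall>s. (\<forall>n. s n \<in> elems A) \<longrightarrow>
      (\<forall>\<epsilon>>0. \<exists>N::nat. \<forall>m\<ge>N. \<forall>n\<ge>N. anorm A (adiff A (s m) (s n)) < \<epsilon>) \<longrightarrow>
      (\<exists>a \<in> elems A. (\<lambda>n. anorm A (adiff A (s n) a)) \<longlonglongrightarrow> 0))"

lemma seminorm_completeD:
  assumes "seminorm_complete A" "\<And>n. s n \<in> elems A"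
    and "\<And>\<epsilon>. \<epsilon> > 0 \<Longrightarrow> \<exists>N::nat. \<forall>m\<ge>N. \<forall>n\<ge>N. anorm A (adiff A (s m) (s n)) < \<epsilon>"
  shows "\<exists>a \<in> elems A. (\<lambda>n. anorm A (adiff A (s n) a)) \<longlonglongrightarrow> 0"
  using assms(1)[unfolded seminorm_complete_def, THEN spec, of s] assms(2,3) by simp

context cstar_seminormed
begin

lemma norm_zero: "anorm A \<zero> = 0"
  using norm_scale[of "\<zero>" 0] by (simp add: scale_zero_left)

lemma norm_diff_commute: "\<lbrakk>a \<in> elems A; b \<in> elems A\<rbrakk> \<Longrightarrow> anorm A (a \<ominus> b) = anorm A (b \<ominus> a)"
  using norm_scale[of "a \<ominus> b" "-1"] by (simp add: minus_diff)

lemma norm_diff_triangle: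
  "\<lbrakk>a \<in> elems A; b \<in> elems A; d \<in> elems A\<rbrakk>
    \<Longrightarrow> anorm A (a \<ominus> d) \<le> anorm A (a \<ominus> b) + anorm A (b \<ominus> d)"
  using norm_triangle[of "a \<ominus> b" "b \<ominus> d"] by (simp add: diff_add_diff)

lemma norm_triangle_diff:
  "\<lbrakk>a \<in> elems A; b \<in> elems A\<rbrakk> \<Longrightarrow> anorm A a \<le> anorm A b + anorm A (a \<ominus> b)"
  using norm_triangle[of b "a \<ominus> b"] by (simp add: add_diff_cancel)

lemma norm_diff_le:
  "\<lbrakk>a \<in> elems A; b \<in> elems A\<rbrakk> \<Longrightarrow> anorm A (a \<ominus> b) \<le> anorm A a + anorm A b"
  using norm_diff_triangle[of a "\<zero>" b] norm_diff_commute[of "\<zero>" b] by (simp add: diff_zero)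

lemma abs_norm_diff_le:
  "\<lbrakk>a \<in> elems A; b \<in> elems A\<rbrakk> \<Longrightarrow> \<bar>anorm A a - anorm A b\<bar> \<le> anorm A (a \<ominus> b)"
  using norm_triangle_diff[of a b] norm_triangle_diff[of b a] norm_diff_commute[of a b] by simp

lemma norm_add_diff_add:
  "\<lbrakk>a \<in> elems A; b \<in> elems A; a' \<in> elems A; b' \<in> elems A\<rbrakk>
    \<Longrightarrow> anorm A ((a \<oplus> b) \<ominus> (a' \<oplus> b')) \<le> anorm A (a \<ominus> a') + anorm A (b \<ominus> b')"
  by (simp add: add_diff_add norm_triangle)

text \<open>Submultiplicativity and the C*-identity give \<open>\<parallel>a\<parallel>\<^sup>2 \<le> \<parallel>a*\<parallel> \<parallel>a\<parallel>\<close>.\<close>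

lemma norm_star: assumes "a \<in> elems A" shows "anorm A (astar A a) = anorm A a"
proof -
  have *: "anorm A b \<le> anorm A (astar A b)" if "b \<in> elems A" for b
  proof -
    have "(anorm A b)\<^sup>2 \<le> anorm A (astar A b) * anorm A b"
      using that by (metis cstar_identity norm_mult star_closed)
    then show ?thesis
      using that norm_nonneg[of b] norm_nonneg[of "astar A b"]
      by (cases "anorm A b = 0") (auto simp: power2_eq_square)
  qed
  from *[of a] *[of "astar A a"] show ?thesis using assms by (simp add: star_star)
qed

lemma norm_star_diff:
  "\<lbrakk>a \<in> elems A; b \<in> elems A\<rbrakk> \<Longrightarrow> anorm A (astar A a \<ominus> astar A b) = anorm A (a \<ominus> b)"
  by (simp add: star_diff norm_star)

lemma norm_mult_diff:
  assumes "a \<in> elems A" "b \<in> elems A" "a' \<in> elems A" "b' \<in> elems A"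
  shows "anorm A (a \<otimes> b \<ominus> a' \<otimes> b')
    \<le> anorm A a * anorm A (b \<ominus> b') + anorm A (a \<ominus> a') * anorm A b'"
  using norm_triangle[of "a \<otimes> (b \<ominus> b')" "(a \<ominus> a') \<otimes> b'"] norm_mult[of a "b \<ominus> b'"]
    norm_mult[of "a \<ominus> a'" b'] assms by (simp add: mult_diff)

lemma norm_scale_diff:
  assumes "a \<in> elems A" "b \<in> elems A"
  shows "anorm A (c \<odot> a \<ominus> c' \<odot> b) \<le> cmod c * anorm A (a \<ominus> b) + cmod (c - c') * anorm A b"
  using norm_diff_triangle[of "c \<odot> a" "c \<odot> b" "c' \<odot> b"] assms
  by (simp add: scale_diff scale_diff_left norm_scale)

lemma Cauchy_limit_of_subsequence:
  assumes s: "\<And>n. s n \<in> elems A"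
    and C: "\<And>\<epsilon>. \<epsilon> > 0 \<Longrightarrow> \<exists>N::nat. \<forall>m\<ge>N. \<forall>n\<ge>N. anorm A (s m \<ominus> s n) < \<epsilon>"
    and r: "strict_mono r" and a: "a \<in> elems A"
    and lim: "(\<lambda>n. anorm A (s (r n) \<ominus> a)) \<longlonglongrightarrow> 0"
  shows "(\<lambda>n. anorm A (s n \<ominus> a)) \<longlonglongrightarrow> 0"
proof (rule LIMSEQ_I)
  fix e :: real assume e: "e > 0"
  obtain N where N: "\<forall>m\<ge>N. \<forall>n\<ge>N. anorm A (s m \<ominus> s n) < e/2" using C[of "e/2"] e by auto
  obtain M where M: "\<forall>n\<ge>M. anorm A (s (r n) \<ominus> a) < e/2"
    using order_tendstoD(2)[OF lim, of "e/2"] e unfolding eventually_sequentially by auto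
  have "anorm A (s n \<ominus> a) < e" if "n \<ge> N" for n
  proof -
    let ?k = "max N M"
    have "r ?k \<ge> N" using seq_suble[OF r, of ?k] by linarith
    then have "anorm A (s n \<ominus> s (r ?k)) < e/2" using N that by blast
    moreover have "anorm A (s (r ?k) \<ominus> a) < e/2" using M by simp
    ultimately show ?thesis using norm_diff_triangle[of "s n" "s (r ?k)" a] s a by force
  qed
  then show "\<exists>no. \<forall>n\<ge>no. norm (anorm A (s n \<ominus> a) - 0) < e"
    using norm_nonneg s a by (intro exI[of _ N]) (auto simp: abs_of_nonneg)
qed

context
  assumes norm_eq_zero: "\<And>a. a \<in> elems A \<Longrightarrow> anorm A a = 0 \<longleftrightarrow> a = \<zero>"
begin

lemma Metric_space_adist: "Metric_space (elems A) (adist A)"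
proof
  show "0 \<le> adist A x y" for x y by (simp add: adist_def norm_nonneg)
  show "adist A x y = adist A y x" for x y by (auto simp: adist_def norm_diff_commute)
  show "adist A x y = 0 \<longleftrightarrow> x = y" if "x \<in> elems A" "y \<in> elems A" for x y
    using that by (simp add: adist_def norm_eq_zero diff_eq_zero)
  show "adist A x z \<le> adist A x y + adist A y z"
    if "x \<in> elems A" "y \<in> elems A" "z \<in> elems A" for x y z
    using that by (simp add: adist_def norm_diff_triangle)
qed

text \<open>
  The algebras of Cauchy sequences and of functions are handled with their seminorms alone; the metric
  enters only when the result is stated.
\<close>

lemma mcomplete_iff_seminorm_complete:
  "Metric_space.mcomplete (elems A) (adist A) \<longleftrightarrow> seminorm_complete A"
proof -
  interpret Metric_space "elems A" "adist A" by (rule Metric_space_adist)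
  have C: "MCauchy s \<longleftrightarrow> (\<forall>n. s n \<in> elems A) \<and>
      (\<forall>\<epsilon>>0. \<exists>N::nat. \<forall>m\<ge>N. \<forall>n\<ge>N. anorm A (adiff A (s m) (s n)) < \<epsilon>)" for s
    unfolding MCauchy_def by (fastforce simp: adist_def image_subset_iff)
  have L: "limitin mtopology s a sequentially \<longleftrightarrow>
      a \<in> elems A \<and> (\<lambda>n. anorm A (adiff A (s n) a)) \<longlonglongrightarrow> 0" if "\<forall>n. s n \<in> elems A" for s a
    using that unfolding limitin_metric_dist_null by (cases "a \<in> elems A") (simp_all add: adist_def)
  have "(\<exists>a. limitin mtopology s a sequentially) \<longleftrightarrow>
      (\<exists>a \<in> elems A. (\<lambda>n. anorm A (adiff A (s n) a)) \<longlonglongrightarrow> 0)" if "\<forall>n. s n \<in> elems A" for s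
    using L[OF that] by (simp add: Bex_def)
  then show ?thesis
    by (simp add: mcomplete_def seminorm_complete_def C imp_conjL cong: imp_cong)
qed

lemma cstar_algebraI: "seminorm_complete A \<Longrightarrow> cstar_algebra A"
  by unfold_locales
    (auto simp: norm_nonneg norm_eq_zero norm_triangle norm_scale norm_mult cstar_identity
      mcomplete_iff_seminorm_complete)

end

end

sublocale cstar_algebra \<subseteq> cstar_seminormed
  by unfold_locales (simp_all add: norm_nonneg norm_triangle norm_scale norm_mult cstar_identity)

lemma (in cstar_algebra) seminorm_complete: "seminorm_complete A"
  using complete mcomplete_iff_seminorm_complete norm_eq_zero by blast

sublocale cstar_algebra \<subseteq> metric: Metric_space "elems A" "adist A"
  by (rule Metric_space_adist[OF norm_eq_zero])


lemma cstar_seminormedI: "\<lbrakk>star_algebra A; cstar_seminorm A (anorm A)\<rbrakk> \<Longrightarrow> cstar_seminormed A"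
  by (simp add: cstar_seminormed_def cstar_seminormed_axioms_def cstar_seminorm_def)

text \<open>
  Suprema preserve C*-seminorms because the C*-identity is an equation between \<open>p (a* a)\<close> and
  a monotone function of \<open>p a\<close>. Both the sup norm of functions and the largest C*-norm of a tensor
  product are of this form.
\<close>

lemma cstar_seminorm_SUP:
  assumes P: "\<And>p. p \<in> P \<Longrightarrow> cstar_seminorm T p" and "P \<noteq> {}" and T: "star_algebra T"
    and bdd: "\<And>u. u \<in> elems T \<Longrightarrow> bdd_above ((\<lambda>p. p u) ` P)"
  shows "cstar_seminorm T (\<lambda>u. SUP p\<in>P. p u)"
proof -
  interpret T: star_algebra T by (rule T)
  obtain q where q: "q \<in> P" using \<open>P \<noteq> {}\<close> by blast
  let ?N = "\<lambda>u. SUP p\<in>P. p u"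
  have le: "p u \<le> ?N u" if "p \<in> P" "u \<in> elems T" for p u
    using that by (intro cSUP_upper bdd) auto
  have nonneg: "0 \<le> p u" if "p \<in> P" "u \<in> elems T" for p u
    using P[OF that(1)] that by (simp add: cstar_seminorm_def)
  have N_nonneg: "0 \<le> ?N u" if "u \<in> elems T" for u
    using le[OF q that] nonneg[OF q that] by linarith
  have least: "?N u \<le> x" if "\<And>p. p \<in> P \<Longrightarrow> p u \<le> x" for u x
    using that \<open>P \<noteq> {}\<close> by (intro cSUP_least) auto
  have scale_le: "?N (c \<odot>\<^bsub>T\<^esub> u) \<le> cmod c * ?N u" if "u \<in> elems T" for c u
  proof (rule least)
    fix p assume p: "p \<in> P"
    then have "p (c \<odot>\<^bsub>T\<^esub> u) = cmod c * p u" using P that by (simp add: cstar_seminorm_def)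
    then show "p (c \<odot>\<^bsub>T\<^esub> u) \<le> cmod c * ?N u" using le[OF p that] by (simp add: mult_left_mono)
  qed
  show ?thesis
    unfolding cstar_seminorm_def
  proof (intro conjI ballI allI)
    fix u assume u: "u \<in> elems T"
    show "0 \<le> ?N u" by (rule N_nonneg[OF u])
    show "?N (c \<odot>\<^bsub>T\<^esub> u) = cmod c * ?N u" for c
      using N_nonneg scale_le u by (rule T.seminorm_scale)
    show "?N (astar T u \<otimes>\<^bsub>T\<^esub> u) = (?N u)\<^sup>2"
    proof (rule antisym)
      show "?N (astar T u \<otimes>\<^bsub>T\<^esub> u) \<le> (?N u)\<^sup>2"
      proof (rule least)
        fix p assume p: "p \<in> P"
        then have "p (astar T u \<otimes>\<^bsub>T\<^esub> u) = (p u)\<^sup>2" using P u by (simp add: cstar_seminorm_def)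
        then show "p (astar T u \<otimes>\<^bsub>T\<^esub> u) \<le> (?N u)\<^sup>2"
          using le[OF p u] nonneg[OF p u] by (simp add: power_mono)
      qed
      have "?N u \<le> sqrt (?N (astar T u \<otimes>\<^bsub>T\<^esub> u))"
      proof (rule least)
        fix p assume p: "p \<in> P"
        then have "(p u)\<^sup>2 = p (astar T u \<otimes>\<^bsub>T\<^esub> u)" using P u by (simp add: cstar_seminorm_def)
        also have "\<dots> \<le> ?N (astar T u \<otimes>\<^bsub>T\<^esub> u)" using u by (intro le p) simp
        finally show "p u \<le> sqrt (?N (astar T u \<otimes>\<^bsub>T\<^esub> u))" by (rule real_le_rsqrt)
      qed
      then have "(?N u)\<^sup>2 \<le> (sqrt (?N (astar T u \<otimes>\<^bsub>T\<^esub> u)))\<^sup>2"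
        using N_nonneg[OF u] by (rule power_mono)
      then show "(?N u)\<^sup>2 \<le> ?N (astar T u \<otimes>\<^bsub>T\<^esub> u)"
        using N_nonneg[of "astar T u \<otimes>\<^bsub>T\<^esub> u"] u by simp
    qed
    fix v assume v: "v \<in> elems T"
    show "?N (u \<oplus>\<^bsub>T\<^esub> v) \<le> ?N u + ?N v"
    proof (rule least)
      fix p assume p: "p \<in> P"
      then have "p (u \<oplus>\<^bsub>T\<^esub> v) \<le> p u + p v" using P u v by (simp add: cstar_seminorm_def)
      then show "p (u \<oplus>\<^bsub>T\<^esub> v) \<le> ?N u + ?N v" using le[OF p u] le[OF p v] by linarith
    qed
    show "?N (u \<otimes>\<^bsub>T\<^esub> v) \<le> ?N u * ?N v"
    proof (rule least)
      fix p assume p: "p \<in> P"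
      then have "p (u \<otimes>\<^bsub>T\<^esub> v) \<le> p u * p v" using P u v by (simp add: cstar_seminorm_def)
      also have "\<dots> \<le> ?N u * ?N v"
        using le[OF p u] le[OF p v] nonneg[OF p v] N_nonneg[OF u] by (intro mult_mono)
      finally show "p (u \<otimes>\<^bsub>T\<^esub> v) \<le> ?N u * ?N v" .
    qed
  qed
qed


section \<open>Quotients by ideals\<close>

lemma UN_eq_constant: "\<lbrakk>x \<in> S; \<And>y. y \<in> S \<Longrightarrow> f y = C\<rbrakk> \<Longrightarrow> (\<Union>y\<in>S. f y) = C"
  by auto

locale star_ideal = cstar_seminormed A for A :: "'a normed_star_algebra" (structure) +
  fixes I
  assumes ideal_subset: "I \<subseteq> elems A"
    and ideal_zero: "\<zero> \<in> I"
    and ideal_add: "\<lbrakk>i \<in> I; j \<in> I\<rbrakk> \<Longrightarrow> i \<oplus> j \<in> I"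
    and ideal_scale: "i \<in> I \<Longrightarrow> c \<odot> i \<in> I"
    and ideal_mult_left: "\<lbrakk>a \<in> elems A; i \<in> I\<rbrakk> \<Longrightarrow> a \<otimes> i \<in> I"
    and ideal_mult_right: "\<lbrakk>a \<in> elems A; i \<in> I\<rbrakk> \<Longrightarrow> i \<otimes> a \<in> I"
    and ideal_star: "i \<in> I \<Longrightarrow> astar A i \<in> I"
begin

abbreviation coset where "coset a \<equiv> acoset A I a"
abbreviation Q where "Q \<equiv> quotient_algebra A I"

lemma ideal_closed [simp, intro]: "i \<in> I \<Longrightarrow> i \<in> elems A"
  using ideal_subset by blast

lemma mem_coset_iff: "b \<in> coset a \<longleftrightarrow> b \<in> elems A \<and> b \<ominus> a \<in> I"
  by (simp add: acoset_def)

lemma self_mem_coset: "a \<in> elems A \<Longrightarrow> a \<in> coset a"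
  by (simp add: mem_coset_iff diff_self ideal_zero)

lemma add_mem_coset: "\<lbrakk>a \<in> elems A; i \<in> I\<rbrakk> \<Longrightarrow> a \<oplus> i \<in> coset a"
  by (simp add: mem_coset_iff add_diff_cancel_left)

lemma mem_cosetE:
  assumes "b \<in> coset a" "a \<in> elems A" obtains i where "i \<in> I" "b = a \<oplus> i"
  using assms by (metis add_diff_cancel mem_coset_iff)

lemma coset_eqI: assumes "a \<in> elems A" "b \<in> elems A" "a \<ominus> b \<in> I" shows "coset a = coset b"
proof -
  have b: "b \<ominus> a \<in> I" using ideal_scale[OF assms(3), of "-1"] assms by (simp add: minus_diff)
  have "x \<ominus> b \<in> I" if "x \<in> elems A" "x \<ominus> a \<in> I" for x
    using ideal_add[OF that(2) assms(3)] that assms by (simp add: diff_add_diff)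
  moreover have "x \<ominus> a \<in> I" if "x \<in> elems A" "x \<ominus> b \<in> I" for x
    using ideal_add[OF that(2) b] that assms by (simp add: diff_add_diff)
  ultimately show ?thesis by (auto simp: acoset_def)
qed

lemma coset_eq_iff: "\<lbrakk>a \<in> elems A; b \<in> elems A\<rbrakk> \<Longrightarrow> coset a = coset b \<longleftrightarrow> a \<ominus> b \<in> I"
  using coset_eqI self_mem_coset mem_coset_iff by metis

lemma coset_eq_of_mem: "\<lbrakk>b \<in> coset a; a \<in> elems A\<rbrakk> \<Longrightarrow> coset b = coset a"
  by (simp add: mem_coset_iff coset_eqI)

lemma elems_Q: "elems Q = coset ` elems A"
  and zero_Q: "azero Q = coset \<zero>"
  by (simp_all add: quotient_algebra_def)

lemma add_Q: assumes "a \<in> elems A" "b \<in> elems A" shows "coset a \<oplus>\<^bsub>Q\<^esub> coset b = coset (a \<oplus> b)"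
proof -
  have "coset (a' \<oplus> b') = coset (a \<oplus> b)" if "a' \<in> coset a" "b' \<in> coset b" for a' b'
    using that assms by (intro coset_eqI) (auto simp: mem_coset_iff add_diff_add ideal_add)
  note * = this
  show ?thesis
    by (simp add: quotient_algebra_def) (intro UN_eq_constant[OF self_mem_coset] * assms)
qed

lemma scale_Q: assumes "a \<in> elems A" shows "c \<odot>\<^bsub>Q\<^esub> coset a = coset (c \<odot> a)"
proof -
  have "coset (c \<odot> a') = coset (c \<odot> a)" if "a' \<in> coset a" for a'
    using that assms by (intro coset_eqI) (auto simp: mem_coset_iff scale_diff ideal_scale)
  note * = this
  show ?thesis
    by (simp add: quotient_algebra_def) (intro UN_eq_constant[OF self_mem_coset] * assms)
qed

lemma mult_Q: assumes "a \<in> elems A" "b \<in> elems A" shows "coset a \<otimes>\<^bsub>Q\<^esub> coset b = coset (a \<otimes> b)"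
proof -
  have "coset (a' \<otimes> b') = coset (a \<otimes> b)" if "a' \<in> coset a" "b' \<in> coset b" for a' b'
    using that assms
    by (intro coset_eqI) (auto simp: mem_coset_iff mult_diff ideal_mult_left ideal_mult_right ideal_add)
  note * = this
  show ?thesis
    by (simp add: quotient_algebra_def) (intro UN_eq_constant[OF self_mem_coset] * assms)
qed

lemma star_Q: assumes "a \<in> elems A" shows "astar Q (coset a) = coset (astar A a)"
proof -
  have "coset (astar A a') = coset (astar A a)" if "a' \<in> coset a" for a'
    using that assms by (intro coset_eqI) (auto simp: mem_coset_iff star_diff ideal_star)
  note * = this
  show ?thesis
    by (simp add: quotient_algebra_def) (intro UN_eq_constant[OF self_mem_coset] * assms)
qed

lemmas Q_simps = add_Q scale_Q mult_Q star_Q zero_Q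

lemma diff_Q: "\<lbrakk>a \<in> elems A; b \<in> elems A\<rbrakk> \<Longrightarrow> adiff Q (coset a) (coset b) = coset (a \<ominus> b)"
  by (simp add: adiff_def Q_simps)

lemma star_algebra_Q: "star_algebra Q"
proof
qed (auto simp: elems_Q Q_simps add_ac zero_add add_zero add_uminus scale_one scale_scale
    scale_add_left scale_add_right mult_assoc mult_add_left mult_add_right mult_scale_left
    mult_scale_right star_star star_add star_scale star_mult)

lemma norm_Q: "anorm Q (coset a) = (INF b\<in>coset a. anorm A b)"
  by (simp add: quotient_algebra_def)

lemma norm_Q_le: "b \<in> coset a \<Longrightarrow> anorm Q (coset a) \<le> anorm A b"
  unfolding norm_Q by (rule cINF_lower) (auto intro!: bdd_belowI[of _ 0] simp: mem_coset_iff norm_nonneg)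

lemma norm_Q_greatest:
  "\<lbrakk>a \<in> elems A; \<And>b. b \<in> coset a \<Longrightarrow> x \<le> anorm A b\<rbrakk> \<Longrightarrow> x \<le> anorm Q (coset a)"
  unfolding norm_Q using self_mem_coset by (intro cINF_greatest) auto

lemma norm_Q_greatest_mult:
  assumes "a \<in> elems A" "0 \<le> k" "\<And>b. b \<in> coset a \<Longrightarrow> x \<le> k * anorm A b"
  shows "x \<le> k * anorm Q (coset a)"
proof (cases "k = 0")
  case True then show ?thesis using assms(3)[OF self_mem_coset[OF assms(1)]] by simp
next
  case False
  then have "x / k \<le> anorm Q (coset a)"
    using assms by (intro norm_Q_greatest) (auto simp: field_simps)
  then show ?thesis using False assms(2) by (simp add: field_simps)
qed

lemma norm_Q_lessE:
  assumes "a \<in> elems A" "anorm Q (coset a) < r" obtains b where "b \<in> coset a" "anorm A b < r"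
  using norm_Q_greatest[OF assms(1), of r] assms(2) by force

text \<open>
  Submultiplicativity of the quotient seminorm gives one half of the C*-identity. The other half is
  a property of the ideal, the assumption below; for a closed ideal in a C*-algebra it needs
  approximate units in general, but the ideals of interest have elementary reasons for it.
\<close>

lemma cstar_seminormed_Q:
  assumes cstar: "\<And>a i e. \<lbrakk>a \<in> elems A; i \<in> I; e > 0\<rbrakk>
    \<Longrightarrow> \<exists>j\<in>I. anorm A (a \<oplus> j) \<le> sqrt (anorm A (astar A a \<otimes> a \<oplus> i)) + e"
  shows "cstar_seminormed Q"
proof -
  interpret Q: star_algebra Q by (rule star_algebra_Q)
  have nonneg: "0 \<le> anorm Q (coset a)" if "a \<in> elems A" for a
    using that by (intro norm_Q_greatest) (auto simp: mem_coset_iff norm_nonneg)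
  have scale_le: "anorm Q (coset (c \<odot> a)) \<le> cmod c * anorm Q (coset a)" if "a \<in> elems A" for c a
  proof (rule norm_Q_greatest_mult[OF that])
    fix b assume b: "b \<in> coset a"
    then have "c \<odot> b \<in> coset (c \<odot> a)" using that by (simp add: mem_coset_iff scale_diff ideal_scale)
    then show "anorm Q (coset (c \<odot> a)) \<le> cmod c * anorm A b"
      using norm_Q_le b by (fastforce simp: mem_coset_iff norm_scale)
  qed simp
  have mult: "anorm Q (coset (a \<otimes> b)) \<le> anorm Q (coset a) * anorm Q (coset b)"
    if ab: "a \<in> elems A" "b \<in> elems A" for a b
  proof (rule norm_Q_greatest_mult[OF ab(2) nonneg[OF ab(1)]])
    fix b' assume b': "b' \<in> coset b"
    then have b'': "b' \<in> elems A" by (simp add: mem_coset_iff)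
    have "anorm Q (coset (a \<otimes> b)) \<le> anorm A b' * anorm Q (coset a)"
    proof (rule norm_Q_greatest_mult[OF ab(1) norm_nonneg[OF b'']])
      fix a' assume a': "a' \<in> coset a"
      then have a'': "a' \<in> elems A" by (simp add: mem_coset_iff)
      have "coset (a \<otimes> b) = coset (a' \<otimes> b')"
        using a' b' ab a'' b'' by (metis coset_eq_of_mem mult_Q)
      then have "anorm Q (coset (a \<otimes> b)) \<le> anorm A (a' \<otimes> b')"
        using norm_Q_le[OF self_mem_coset[of "a' \<otimes> b'"]] a'' b'' by simp
      also have "\<dots> \<le> anorm A b' * anorm A a'" using norm_mult a'' b'' by (simp add: mult.commute)
      finally show "anorm Q (coset (a \<otimes> b)) \<le> anorm A b' * anorm A a'" .
    qed
    then show "anorm Q (coset (a \<otimes> b)) \<le> anorm Q (coset a) * anorm A b'"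
      by (simp add: mult.commute)
  qed
  have tri: "anorm Q (coset (a \<oplus> b)) \<le> anorm Q (coset a) + anorm Q (coset b)"
    if ab: "a \<in> elems A" "b \<in> elems A" for a b
  proof (rule field_le_epsilon)
    fix e :: real assume "e > 0"
    obtain a' where a': "a' \<in> coset a" "anorm A a' < anorm Q (coset a) + e/2"
      using norm_Q_lessE[OF ab(1), of "anorm Q (coset a) + e/2"] \<open>e > 0\<close> by auto
    obtain b' where b': "b' \<in> coset b" "anorm A b' < anorm Q (coset b) + e/2"
      using norm_Q_lessE[OF ab(2), of "anorm Q (coset b) + e/2"] \<open>e > 0\<close> by auto
    have "a' \<oplus> b' \<in> coset (a \<oplus> b)"
      using a' b' ab by (simp add: mem_coset_iff add_diff_add ideal_add)
    then have "anorm Q (coset (a \<oplus> b)) \<le> anorm A (a' \<oplus> b')" by (rule norm_Q_le)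
    also have "\<dots> \<le> anorm A a' + anorm A b'" using a' b' by (simp add: mem_coset_iff norm_triangle)
    finally show "anorm Q (coset (a \<oplus> b)) \<le> anorm Q (coset a) + anorm Q (coset b) + e"
      using a' b' by simp
  qed
  have scale: "anorm Q (coset (c \<odot> a)) = cmod c * anorm Q (coset a)" if "a \<in> elems A" for c a
    using seminorm_scale[of "\<lambda>a. anorm Q (coset a)"] nonneg scale_le that by blast
  have cstar_id: "anorm Q (coset (astar A a \<otimes> a)) = (anorm Q (coset a))\<^sup>2" if a: "a \<in> elems A" for a
  proof (rule antisym)
    \<comment> \<open>The square root is moved to the left since the quotient norm is an infimum of norms, not of their squares.\<close>
    have "sqrt (anorm Q (coset (astar A a \<otimes> a))) \<le> anorm Q (coset a)"
    proof (rule norm_Q_greatest[OF a])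
      fix b assume b: "b \<in> coset a"
      then have bA: "b \<in> elems A" by (simp add: mem_coset_iff)
      have "coset (astar A a \<otimes> a) = coset (astar A b \<otimes> b)"
        using a b bA by (metis coset_eq_of_mem mult_Q star_Q star_closed)
      then have "anorm Q (coset (astar A a \<otimes> a)) \<le> (anorm A b)\<^sup>2"
        using norm_Q_le[OF self_mem_coset[of "astar A b \<otimes> b"]] bA by (simp add: cstar_identity)
      then show "sqrt (anorm Q (coset (astar A a \<otimes> a))) \<le> anorm A b"
        using norm_nonneg[OF bA] by (metis real_sqrt_abs real_sqrt_le_mono abs_of_nonneg)
    qed
    then show "anorm Q (coset (astar A a \<otimes> a)) \<le> (anorm Q (coset a))\<^sup>2"
      by (rule sqrt_le_D)
    show "(anorm Q (coset a))\<^sup>2 \<le> anorm Q (coset (astar A a \<otimes> a))"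
    proof (rule norm_Q_greatest)
      fix b assume b: "b \<in> coset (astar A a \<otimes> a)"
      then obtain i where i: "i \<in> I" "b = astar A a \<otimes> a \<oplus> i" using a by (elim mem_cosetE) auto
      have "anorm Q (coset a) \<le> sqrt (anorm A b)"
      proof (rule field_le_epsilon)
        fix e :: real assume "e > 0"
        then obtain j where "j \<in> I" "anorm A (a \<oplus> j) \<le> sqrt (anorm A b) + e"
          using cstar[OF a i(1)] i(2) by blast
        then show "anorm Q (coset a) \<le> sqrt (anorm A b) + e"
          using norm_Q_le[OF add_mem_coset[OF a]] by force
      qed
      then show "(anorm Q (coset a))\<^sup>2 \<le> anorm A b"
        using nonneg[OF a] norm_nonneg[of b] b
        by (metis mem_coset_iff power_mono real_sqrt_pow2)
    qed (use a in simp)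
  qed
  show ?thesis
    by unfold_locales (auto simp: elems_Q Q_simps nonneg tri scale mult cstar_id)
qed

text \<open>
  Given a Cauchy sequence in the quotient, a subsequence whose steps shrink geometrically lifts,
  one step after the other, to a sequence with the same property.
\<close>

lemma seminorm_complete_Q:
  assumes complete: "seminorm_complete A" and "cstar_seminormed Q"
  shows "seminorm_complete Q"
  unfolding seminorm_complete_def
proof (intro allI impI)
  interpret Q: cstar_seminormed Q by fact
  fix P :: "nat \<Rightarrow> 'a set"
  assume P: "\<forall>n. P n \<in> elems Q"
    and C: "\<forall>\<epsilon>>0. \<exists>N. \<forall>m\<ge>N. \<forall>n\<ge>N. anorm Q (adiff Q (P m) (P n)) < \<epsilon>"
  define small where "small k N \<longleftrightarrow> (\<forall>m\<ge>N. \<forall>n\<ge>N. anorm Q (adiff Q (P m) (P n)) < (1/2)^k)"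
    for k :: nat and N :: nat
  have ex_small: "\<exists>N. small k N" for k unfolding small_def using C by simp
  \<comment> \<open>From the index \<open>r k\<close> on, the sequence varies by less than \<open>(1/2)^k\<close>.\<close>
  have "\<exists>r. \<forall>k. small k (r k) \<and> r k < r (Suc k)"
  proof (rule dependent_nat_choice)
    show "\<exists>x. small 0 x" by (rule ex_small)
    fix x k
    obtain N where "small (Suc k) N" using ex_small by blast
    then have "small (Suc k) (max N (Suc x))" by (simp add: small_def)
    then show "\<exists>y. small (Suc k) y \<and> x < y" by (intro exI[of _ "max N (Suc x)"]) auto
  qed
  then obtain r where r: "\<And>k. small k (r k)" "\<And>k. r k < r (Suc k)" by blast
  then have mono: "strict_mono r" by (simp add: strict_mono_Suc_iff)
  have "\<exists>a. \<forall>k. (a k \<in> elems A \<and> coset (a k) = P (r k)) \<and> anorm A (a (Suc k) \<ominus> a k) < (1/2)^k"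
  proof (rule dependent_nat_choice)
    show "\<exists>x. x \<in> elems A \<and> coset x = P (r 0)" using P[rule_format, of "r 0"] by (auto simp: elems_Q)
    fix x k assume x: "x \<in> elems A \<and> coset x = P (r k)"
    obtain y where y: "y \<in> elems A" "coset y = P (r (Suc k))"
      using P[rule_format, of "r (Suc k)"] by (auto simp: elems_Q)
    have "anorm Q (coset (y \<ominus> x)) < (1/2)^k"
      using r[of k] x y unfolding small_def by (metis diff_Q less_imp_le order_refl)
    then obtain b where b: "b \<in> coset (y \<ominus> x)" "anorm A b < (1/2)^k"
      using norm_Q_lessE x y by (metis diff_closed)
    then have bA: "b \<in> elems A" by (simp add: mem_coset_iff)
    have "coset (x \<oplus> b) = coset x \<oplus>\<^bsub>Q\<^esub> coset (y \<ominus> x)"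
      using add_Q[of x b] x bA coset_eq_of_mem[OF b(1)] y by simp
    also have "\<dots> = coset y" using x y add_Q[of x "y \<ominus> x"] by (simp add: add_diff_cancel)
    finally have "coset (x \<oplus> b) = P (r (Suc k))" using y by simp
    then show "\<exists>z. (z \<in> elems A \<and> coset z = P (r (Suc k))) \<and> anorm A (z \<ominus> x) < (1/2)^k"
      using x bA b by (intro exI[of _ "x \<oplus> b"]) (simp add: add_diff_cancel_left)
  qed
  then obtain a where a: "\<And>k. a k \<in> elems A" "\<And>k. coset (a k) = P (r k)"
    and step: "\<And>k. anorm A (a (Suc k) \<ominus> a k) < (1/2)^k" by blast
  have tail: "anorm A (a (k + j) \<ominus> a k) \<le> (2 - 2 * (1/2)^j) * (1/2)^k" for k j
  proof (induction j)
    case 0 then show ?case using a by (simp add: diff_self norm_zero)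
  next
    case (Suc j)
    have "anorm A (a (k + Suc j) \<ominus> a k) \<le> anorm A (a (Suc (k + j)) \<ominus> a (k + j)) + anorm A (a (k + j) \<ominus> a k)"
      using norm_diff_triangle a by simp
    also have "\<dots> \<le> (1/2)^(k+j) + (2 - 2 * (1/2)^j) * (1/2)^k" using step[of "k + j"] Suc by simp
    also have "\<dots> = (2 - 2 * (1/2)^Suc j) * (1/2)^k" by (simp add: power_add algebra_simps)
    finally show ?case .
  qed
  have tail': "anorm A (a m \<ominus> a k) \<le> 2 * (1/2)^k" if "m \<ge> k" for m k
  proof -
    have "anorm A (a m \<ominus> a k) \<le> (2 - 2 * (1/2)^(m-k)) * (1/2)^k" using tail[of k "m - k"] that by simp
    also have "\<dots> \<le> 2 * (1/2)^k" by (intro mult_right_mono) auto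
    finally show ?thesis .
  qed
  have "\<forall>\<epsilon>>0. \<exists>N. \<forall>m\<ge>N. \<forall>n\<ge>N. anorm A (a m \<ominus> a n) < \<epsilon>"
  proof (intro allI impI)
    fix e :: real assume "e > 0"
    then obtain N where N: "(1/2::real)^N < e/4" using real_arch_pow_inv[of "e/4" "1/2"] by auto
    have "anorm A (a m \<ominus> a n) < e" if "m \<ge> N" "n \<ge> N" for m n
      using norm_diff_triangle[of "a m" "a N" "a n"] tail'[OF that(1)] tail'[OF that(2)] N a
        norm_diff_commute[of "a n" "a N"] by fastforce
    then show "\<exists>N. \<forall>m\<ge>N. \<forall>n\<ge>N. anorm A (a m \<ominus> a n) < e" by blast
  qed
  then obtain l where l: "l \<in> elems A" "(\<lambda>n. anorm A (a n \<ominus> l)) \<longlonglongrightarrow> 0"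
    using seminorm_completeD[of A a, OF complete a(1)] by auto
  have "(\<lambda>k. anorm Q (adiff Q (P (r k)) (coset l))) \<longlonglongrightarrow> 0"
  proof (rule tendsto_sandwich[OF _ _ tendsto_const l(2)])
    have "0 \<le> anorm Q (adiff Q (P (r k)) (coset l))" for k
      using P l by (intro Q.norm_nonneg Q.diff_closed) (auto simp: elems_Q)
    then show "\<forall>\<^sub>F k in sequentially. 0 \<le> anorm Q (adiff Q (P (r k)) (coset l))" by simp
    have "anorm Q (adiff Q (P (r k)) (coset l)) \<le> anorm A (a k \<ominus> l)" for k
      using a l by (metis diff_Q diff_closed norm_Q_le self_mem_coset)
    then show "\<forall>\<^sub>F k in sequentially. anorm Q (adiff Q (P (r k)) (coset l)) \<le> anorm A (a k \<ominus> l)" by simp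
  qed
  moreover have "coset l \<in> elems Q" using l by (simp add: elems_Q)
  ultimately have "(\<lambda>n. anorm Q (adiff Q (P n) (coset l))) \<longlonglongrightarrow> 0"
    using Q.Cauchy_limit_of_subsequence[OF P[rule_format] C[rule_format] mono] by simp
  with \<open>coset l \<in> elems Q\<close> show "\<exists>p\<in>elems Q. (\<lambda>n. anorm Q (adiff Q (P n) p)) \<longlonglongrightarrow> 0" ..
qed

text \<open>
  The second assumption says that the ideal is closed; it is what makes the quotient seminorm a norm.
\<close>

theorem cstar_algebra_quotient:
  assumes complete: "seminorm_complete A"
    and closed: "\<And>a. \<lbrakk>a \<in> elems A; \<And>e. e > 0 \<Longrightarrow> \<exists>i\<in>I. anorm A (a \<ominus> i) < e\<rbrakk> \<Longrightarrow> a \<in> I"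
    and cstar: "\<And>a i e. \<lbrakk>a \<in> elems A; i \<in> I; e > 0\<rbrakk>
      \<Longrightarrow> \<exists>j\<in>I. anorm A (a \<oplus> j) \<le> sqrt (anorm A (astar A a \<otimes> a \<oplus> i)) + e"
  shows "cstar_algebra Q"
proof -
  interpret Q: cstar_seminormed Q by (rule cstar_seminormed_Q) (rule cstar)
  show ?thesis
  proof (rule Q.cstar_algebraI[OF _ seminorm_complete_Q[OF complete Q.cstar_seminormed_axioms]])
    fix p assume "p \<in> elems Q"
    then obtain a where a: "a \<in> elems A" "p = coset a" by (auto simp: elems_Q)
    have "a \<in> I" if 0: "anorm Q (coset a) = 0"
    proof (rule closed[OF a(1)])
      fix e :: real assume "e > 0"
      then obtain b where b: "b \<in> coset a" "anorm A b < e" using norm_Q_lessE[OF a(1), of e] 0 by auto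
      have bA: "b \<in> elems A" using b by (simp add: mem_coset_iff)
      have ab: "a \<ominus> b \<in> I" using b a bA coset_eq_iff coset_eq_of_mem by metis
      have "a \<ominus> (a \<ominus> b) = b"
        using a bA by (metis add_diff_cancel add_diff_cancel_left diff_closed add_commute)
      then show "\<exists>i\<in>I. anorm A (a \<ominus> i) < e" using ab b by (intro bexI[of _ "a \<ominus> b"]) auto
    qed
    then show "anorm Q p = 0 \<longleftrightarrow> p = azero Q"
      using a coset_eq_iff[of a "\<zero>"] Q.norm_zero by (auto simp: zero_Q diff_zero)
  qed
qed

end

section \<open>Hausdorff completions\<close>

context cstar_seminormed
begin

abbreviation CS where "CS \<equiv> cauchy_sequences A"

lemma mem_CS_iff: "s \<in> elems CS \<longleftrightarrow> (\<forall>n. s n \<in> elems A) \<and>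
    (\<forall>\<epsilon>>0. \<exists>N. \<forall>m\<ge>N. \<forall>n\<ge>N. anorm A (s m \<ominus> s n) < \<epsilon>)"
  by (auto simp: cauchy_sequences_def image_subset_iff)

lemma mem_CS_D: "s \<in> elems CS \<Longrightarrow> s n \<in> elems A"
  by (simp add: mem_CS_iff)

lemma CS_ops: "azero CS = (\<lambda>_. \<zero>)" "aadd CS s t = (\<lambda>n. s n \<oplus> t n)" "ascale CS c s = (\<lambda>n. c \<odot> s n)"
  "amult CS s t = (\<lambda>n. s n \<otimes> t n)" "astar CS s = (\<lambda>n. astar A (s n))"
  "adiff CS s t = (\<lambda>n. s n \<ominus> t n)"
  by (simp_all add: cauchy_sequences_def adiff_def)

text \<open>
  Each algebraic operation satisfies an estimate of this form. For the product, \<open>K\<close> bounds the norms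
  of the factors.
\<close>

lemma CS_memI:
  assumes s: "s \<in> elems CS" and t: "t \<in> elems CS" and u: "\<And>n. u n \<in> elems A"
    and le: "\<And>m n. anorm A (u m \<ominus> u n) \<le> K * (anorm A (s m \<ominus> s n) + anorm A (t m \<ominus> t n))"
  shows "u \<in> elems CS"
  unfolding mem_CS_iff
proof (intro conjI)
  show "\<forall>n. u n \<in> elems A" using u ..
  show "\<forall>\<epsilon>>0. \<exists>N. \<forall>m\<ge>N. \<forall>n\<ge>N. anorm A (u m \<ominus> u n) < \<epsilon>"
    using s t mem_CS_D[OF s] mem_CS_D[OF t]
    by (intro Cauchy_combine[OF _ _ _ _ le]) (simp_all add: mem_CS_iff norm_nonneg)
qed

lemma norm_CS: assumes "s \<in> elems CS" shows "(\<lambda>n. anorm A (s n)) \<longlonglongrightarrow> anorm CS s"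
proof -
  have "Cauchy (\<lambda>n. anorm A (s n))"
  proof (rule CauchyI)
    fix e :: real assume "0 < e"
    then obtain N where N: "\<forall>m\<ge>N. \<forall>n\<ge>N. anorm A (s m \<ominus> s n) < e" using assms by (auto simp: mem_CS_iff)
    then have "\<forall>m\<ge>N. \<forall>n\<ge>N. norm (anorm A (s m) - anorm A (s n)) < e"
      using abs_norm_diff_le mem_CS_D[OF assms] by (metis order.strict_trans1 real_norm_def)
    then show "\<exists>M. \<forall>m\<ge>M. \<forall>n\<ge>M. norm (anorm A (s m) - anorm A (s n)) < e" by blast
  qed
  then show ?thesis
    by (simp add: cauchy_sequences_def Cauchy_convergent_iff convergent_LIMSEQ_iff)
qed

lemma CS_bounded: assumes "s \<in> elems CS" obtains B where "0 \<le> B" "\<And>n. anorm A (s n) \<le> B"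
proof -
  have "Bseq (\<lambda>n. anorm A (s n))" using norm_CS[OF assms] convergent_def convergent_imp_Bseq by blast
  then obtain K where "K > 0" "\<And>n. norm (anorm A (s n)) \<le> K" by (auto simp: Bseq_def)
  then show thesis by (intro that[of K]) (auto simp: abs_le_iff)
qed

lemma mult_mem_CS: assumes s: "s \<in> elems CS" and t: "t \<in> elems CS" shows "(\<lambda>n. s n \<otimes> t n) \<in> elems CS"
proof -
  obtain B where B: "0 \<le> B" "\<And>n. anorm A (s n) \<le> B" using CS_bounded[OF s] by blast
  obtain B' where B': "0 \<le> B'" "\<And>n. anorm A (t n) \<le> B'" using CS_bounded[OF t] by blast
  show ?thesis
  proof (rule CS_memI[OF s t])
    fix m n
    have n: "0 \<le> anorm A (s m \<ominus> s n)" "0 \<le> anorm A (t m \<ominus> t n)"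
      using mem_CS_D[OF s] mem_CS_D[OF t] by (simp_all add: norm_nonneg)
    have "anorm A (s m \<otimes> t m \<ominus> s n \<otimes> t n)
        \<le> anorm A (s m) * anorm A (t m \<ominus> t n) + anorm A (s m \<ominus> s n) * anorm A (t n)"
      using mem_CS_D[OF s] mem_CS_D[OF t] by (simp add: norm_mult_diff)
    also have "\<dots> \<le> (B + B') * anorm A (t m \<ominus> t n) + anorm A (s m \<ominus> s n) * (B + B')"
      using B(1) B'(1) B(2)[of m] B'(2)[of n] n norm_nonneg[OF mem_CS_D[OF t]]
      by (intro add_mono mult_mono) auto
    finally show "anorm A (s m \<otimes> t m \<ominus> s n \<otimes> t n)
        \<le> (B + B') * (anorm A (s m \<ominus> s n) + anorm A (t m \<ominus> t n))"
      by (simp add: algebra_simps)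
  qed (use mem_CS_D[OF s] mem_CS_D[OF t] in simp)
qed

lemma star_algebra_CS: "star_algebra CS"
proof
  show "azero CS \<in> elems CS" by (simp add: mem_CS_iff CS_ops diff_self norm_zero)
  show "s \<otimes>\<^bsub>CS\<^esub> t \<in> elems CS" if "s \<in> elems CS" "t \<in> elems CS" for s t
    using mult_mem_CS that by (simp add: CS_ops)
  show "s \<oplus>\<^bsub>CS\<^esub> t \<in> elems CS" if "s \<in> elems CS" "t \<in> elems CS" for s t
    unfolding CS_ops by (rule CS_memI[OF that, of _ 1]) (use that mem_CS_D in \<open>simp_all add: norm_add_diff_add\<close>)
  show "c \<odot>\<^bsub>CS\<^esub> s \<in> elems CS" if "s \<in> elems CS" for c s
    unfolding CS_ops by (rule CS_memI[OF that that, of _ "cmod c"])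
      (use that mem_CS_D norm_nonneg in \<open>simp_all add: scale_diff norm_scale\<close>)
  show "astar CS s \<in> elems CS" if "s \<in> elems CS" for s
    unfolding CS_ops by (rule CS_memI[OF that that, of _ 1])
      (use that mem_CS_D norm_nonneg in \<open>simp_all add: norm_star_diff\<close>)
qed (simp_all add: CS_ops mem_CS_D fun_eq_iff add_ac zero_add add_zero add_uminus scale_one scale_scale
    scale_add_left scale_add_right mult_assoc mult_add_left mult_add_right mult_scale_left
    mult_scale_right star_star star_add star_scale star_mult)

lemma cstar_seminormed_CS: "cstar_seminormed CS"
proof -
  interpret CS: star_algebra CS by (rule star_algebra_CS)
  note [simp] = CS.closed[unfolded CS_ops]
  show ?thesis
  proof
    fix s assume s: "s \<in> elems CS"
    show "0 \<le> anorm CS s"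
      using s by (intro LIMSEQ_le_const[OF norm_CS[OF s]]) (auto simp: mem_CS_D norm_nonneg)
    show "anorm CS (c \<odot>\<^bsub>CS\<^esub> s) = cmod c * anorm CS s" for c
      using norm_CS[OF CS.scale_closed[OF s, of c]] tendsto_mult[OF tendsto_const norm_CS[OF s]] s
      by (intro LIMSEQ_unique) (auto simp: CS_ops mem_CS_D norm_scale)
    show "anorm CS (astar CS s \<otimes>\<^bsub>CS\<^esub> s) = (anorm CS s)\<^sup>2"
      using norm_CS[OF CS.mult_closed[OF CS.star_closed[OF s] s]] tendsto_power[OF norm_CS[OF s], of 2] s
      by (intro LIMSEQ_unique) (auto simp: CS_ops mem_CS_D cstar_identity)
    fix t assume t: "t \<in> elems CS"
    show "anorm CS (s \<oplus>\<^bsub>CS\<^esub> t) \<le> anorm CS s + anorm CS t"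
      using norm_CS[OF CS.add_closed[OF s t]] tendsto_add[OF norm_CS[OF s] norm_CS[OF t]] s t
      by (intro LIMSEQ_le) (auto simp: CS_ops mem_CS_D norm_triangle)
    show "anorm CS (s \<otimes>\<^bsub>CS\<^esub> t) \<le> anorm CS s * anorm CS t"
      using norm_CS[OF CS.mult_closed[OF s t]] tendsto_mult[OF norm_CS[OF s] norm_CS[OF t]] s t
      by (intro LIMSEQ_le) (auto simp: CS_ops mem_CS_D norm_mult)
  qed
qed

text \<open>
  The limit of a Cauchy sequence of Cauchy sequences \<open>s k\<close> is the diagonal sequence \<open>s k (N k)\<close>,
  where \<open>s k\<close> varies by less than \<open>1 / (k + 1)\<close> from the index \<open>N k\<close> on.
\<close>

lemma seminorm_complete_CS: "seminorm_complete CS"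
  unfolding seminorm_complete_def
proof (intro allI impI)
  interpret CS: cstar_seminormed CS by (rule cstar_seminormed_CS)
  fix s :: "nat \<Rightarrow> nat \<Rightarrow> 'a"
  assume s: "\<forall>k. s k \<in> elems CS"
    and cauchy: "\<forall>\<epsilon>>0. \<exists>N. \<forall>m\<ge>N. \<forall>n\<ge>N. anorm CS (adiff CS (s m) (s n)) < \<epsilon>"
  have sA [simp]: "s k n \<in> elems A" for k n using s mem_CS_D by blast
  have "\<forall>k. \<exists>N. \<forall>m\<ge>N. \<forall>n\<ge>N. anorm A (s k m \<ominus> s k n) < inverse (real (Suc k))"
    using s by (simp add: mem_CS_iff)
  then obtain N where N: "\<And>k m n. \<lbrakk>m \<ge> N k; n \<ge> N k\<rbrakk> \<Longrightarrow> anorm A (s k m \<ominus> s k n) < inverse (real (Suc k))"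
    by metis
  define t where "t = (\<lambda>k. s k (N k))"
  have tA [simp]: "t k \<in> elems A" for k by (simp add: t_def)
  have near: "anorm A (s k i \<ominus> t k) \<le> inverse (real (Suc k))" if "i \<ge> N k" for i k
    using N[OF that, of "N k"] by (simp add: t_def)
  have limC: "(\<lambda>i. anorm A (s k i \<ominus> s l i)) \<longlonglongrightarrow> anorm CS (adiff CS (s k) (s l))" for k l
    using norm_CS[of "adiff CS (s k) (s l)"] s by (simp add: CS_ops(6) CS.diff_closed[unfolded CS_ops])
  have t_near: "anorm A (t k \<ominus> t l)
      \<le> inverse (real (Suc k)) + anorm CS (adiff CS (s k) (s l)) + inverse (real (Suc l))" for k l
  proof (rule LIMSEQ_le_const[OF tendsto_add[OF tendsto_add[OF tendsto_const limC] tendsto_const]])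
    have "anorm A (t k \<ominus> t l) \<le> inverse (real (Suc k)) + anorm A (s k i \<ominus> s l i) + inverse (real (Suc l))"
      if "i \<ge> max (N k) (N l)" for i
      using norm_diff_triangle[of "t k" "s k i" "t l"] norm_diff_triangle[of "s k i" "s l i" "t l"]
        near[of k i] near[of l i] norm_diff_commute[of "t k" "s k i"] that by simp
    then show "\<exists>M. \<forall>i\<ge>M. anorm A (t k \<ominus> t l)
        \<le> inverse (real (Suc k)) + anorm A (s k i \<ominus> s l i) + inverse (real (Suc l))" by blast
  qed
  have tail: "\<exists>M. \<forall>k\<ge>M. \<forall>l\<ge>M. anorm A (t k \<ominus> t l) < e" if e: "e > 0" for e
  proof -
    obtain M where M: "\<forall>k\<ge>M. \<forall>l\<ge>M. anorm CS (adiff CS (s k) (s l)) < e/3"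
      using cauchy[rule_format, of "e/3"] e by auto
    obtain M' where M': "inverse (real (Suc M')) < e/3" using reals_Archimedean[of "e/3"] e by auto
    have M'': "inverse (real (Suc k)) < e/3" if "k \<ge> M'" for k
    proof -
      have "inverse (real (Suc k)) \<le> inverse (real (Suc M'))" using that by simp
      then show ?thesis using M' by linarith
    qed
    have "anorm A (t k \<ominus> t l) < e" if "k \<ge> max M M'" "l \<ge> max M M'" for k l
    proof -
      have "anorm CS (adiff CS (s k) (s l)) < e/3" using M that by simp
      then show ?thesis using t_near[of k l] M''[of k] M''[of l] that by simp
    qed
    then show ?thesis by blast
  qed
  then have tC: "t \<in> elems CS" by (simp add: mem_CS_iff)
  have "(\<lambda>k. anorm CS (adiff CS (s k) t)) \<longlonglongrightarrow> 0"
  proof (rule LIMSEQ_I)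
    fix e :: real assume e: "e > 0"
    obtain M where M: "\<forall>k\<ge>M. \<forall>l\<ge>M. anorm A (t k \<ominus> t l) < e/4" using tail[of "e/4"] e by auto
    obtain M' where M': "inverse (real (Suc M')) < e/4" using reals_Archimedean[of "e/4"] e by auto
    have "anorm CS (adiff CS (s k) t) < e" if k: "k \<ge> max M M'" for k
    proof -
      have "inverse (real (Suc k)) \<le> inverse (real (Suc M'))" using k by simp
      then have k': "inverse (real (Suc k)) < e/4" using M' by linarith
      have "(\<lambda>i. anorm A (s k i \<ominus> t i)) \<longlonglongrightarrow> anorm CS (adiff CS (s k) t)"
        using norm_CS[of "adiff CS (s k) t"] s tC by (simp add: CS_ops(6) CS.diff_closed[unfolded CS_ops])
      moreover have "anorm A (s k i \<ominus> t i) \<le> e/2" if "i \<ge> max M (N k)" for i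
      proof -
        have "anorm A (t k \<ominus> t i) < e/4" using M k that by simp
        then show ?thesis
          using norm_diff_triangle[of "s k i" "t k" "t i"] near[of k i] k' that by simp
      qed
      ultimately have "anorm CS (adiff CS (s k) t) \<le> e/2" by (blast intro: LIMSEQ_le_const2)
      then show ?thesis using e by simp
    qed
    moreover have "norm (anorm CS (adiff CS (s k) t) - 0) = anorm CS (adiff CS (s k) t)" for k
      using s tC by (simp add: CS.norm_nonneg)
    ultimately show "\<exists>no. \<forall>k\<ge>no. norm (anorm CS (adiff CS (s k) t) - 0) < e" by metis
  qed
  then show "\<exists>a\<in>elems CS. (\<lambda>k. anorm CS (adiff CS (s k) a)) \<longlonglongrightarrow> 0"
    using tC by (rule bexI)
qed

text \<open>
  Adding a null sequence does not change the limit of the norms. So the quotient seminorm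
  is this limit again, and the C*-identity for it is the limit of the C*-identities of the terms.
\<close>

theorem cstar_algebra_completion: "cstar_algebra (completion A)"
proof -
  interpret CS: cstar_seminormed CS by (rule cstar_seminormed_CS)
  define N where "N = {s \<in> elems CS. anorm CS s = 0}"
  have N_eq: "{s \<in> elems CS. (\<lambda>n. anorm A (s n)) \<longlonglongrightarrow> 0} = N"
  proof -
    have "(\<lambda>n. anorm A (s n)) \<longlonglongrightarrow> 0 \<longleftrightarrow> anorm CS s = 0" if "s \<in> elems CS" for s
      using norm_CS[OF that] LIMSEQ_unique[OF norm_CS[OF that], of 0] by metis
    then show ?thesis unfolding N_def by (intro Collect_cong conj_cong refl)
  qed
  have le_0: "s \<in> N" if "s \<in> elems CS" "anorm CS s \<le> 0" for s
    using that CS.norm_nonneg by (force simp: N_def)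
  interpret star_ideal CS N
  proof
    show "N \<subseteq> elems CS" by (auto simp: N_def)
    show "azero CS \<in> N" by (simp add: N_def CS.norm_zero)
    show "s \<oplus>\<^bsub>CS\<^esub> t \<in> N" if "s \<in> N" "t \<in> N" for s t
      using that CS.norm_triangle[of s t] by (intro le_0) (auto simp: N_def)
    show "c \<odot>\<^bsub>CS\<^esub> s \<in> N" if "s \<in> N" for c s using that by (auto simp: N_def CS.norm_scale)
    show "s \<otimes>\<^bsub>CS\<^esub> t \<in> N" if "s \<in> elems CS" "t \<in> N" for s t
      using that CS.norm_mult[of s t] by (intro le_0) (auto simp: N_def)
    show "t \<otimes>\<^bsub>CS\<^esub> s \<in> N" if "s \<in> elems CS" "t \<in> N" for s t
      using that CS.norm_mult[of t s] by (intro le_0) (auto simp: N_def)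
    show "astar CS s \<in> N" if "s \<in> N" for s using that by (auto simp: N_def CS.norm_star)
  qed
  have "cstar_algebra (quotient_algebra CS N)"
  proof (rule cstar_algebra_quotient[OF seminorm_complete_CS])
    fix s assume s: "s \<in> elems CS" and close: "\<And>e. e > 0 \<Longrightarrow> \<exists>i\<in>N. anorm CS (adiff CS s i) < e"
    show "s \<in> N"
    proof (rule le_0[OF s], rule field_le_epsilon)
      fix e :: real assume "e > 0"
      then obtain i where i: "i \<in> N" "anorm CS (adiff CS s i) < e" using close by blast
      then have "i \<in> elems CS" "anorm CS i = 0" unfolding N_def by blast+
      then show "anorm CS s \<le> 0 + e" using CS.norm_triangle_diff[OF s, of i] i(2) by simp
    qed
  next
    fix s i and e :: real assume s: "s \<in> elems CS" and i: "i \<in> N" and "e > 0"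
    let ?ss = "astar CS s \<otimes>\<^bsub>CS\<^esub> s"
    have iC: "i \<in> elems CS" "anorm CS i = 0" using i unfolding N_def by blast+
    have ss: "?ss \<in> elems CS" "?ss \<oplus>\<^bsub>CS\<^esub> i \<in> elems CS" using s iC by simp_all
    have "anorm CS ?ss \<le> anorm CS (?ss \<oplus>\<^bsub>CS\<^esub> i) + anorm CS (adiff CS (?ss \<oplus>\<^bsub>CS\<^esub> i) ?ss)"
      using CS.norm_triangle_diff[OF ss] CS.norm_diff_commute[OF ss] by simp
    then have "(anorm CS s)\<^sup>2 \<le> anorm CS (?ss \<oplus>\<^bsub>CS\<^esub> i)"
      by (simp add: CS.add_diff_cancel_left[OF iC(1) ss(1)] CS.cstar_identity[OF s] iC(2))
    then have "anorm CS s \<le> sqrt (anorm CS (?ss \<oplus>\<^bsub>CS\<^esub> i))" using real_le_rsqrt by blast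
    then show "\<exists>j\<in>N. anorm CS (s \<oplus>\<^bsub>CS\<^esub> j) \<le> sqrt (anorm CS (?ss \<oplus>\<^bsub>CS\<^esub> i)) + e"
      using \<open>e > 0\<close> by (intro bexI[OF _ ideal_zero]) (simp add: CS.add_zero[OF s])
  qed
  then show ?thesis by (simp add: completion_def N_eq)
qed

end

section \<open>Formal tensors\<close>

text \<open>
  Formal tensors form the algebra of a semigroup with involution. It is convenient to regard them as
  measures and to compute with their integrals against functions: the product of measures is
  the image of the product measure, so that associativity, for example, is inherited from the
  semigroup.
\<close>

definition pairing :: "('z \<Rightarrow> complex) \<Rightarrow> ('z \<Rightarrow> complex) \<Rightarrow> complex"
  where "pairing u F = (\<Sum>x | u x \<noteq> 0. u x * F x)"

lemma pairing_superset:
  "\<lbrakk>finite S; {x. u x \<noteq> 0} \<subseteq> S\<rbrakk> \<Longrightarrow> pairing u F = (\<Sum>x\<in>S. u x * F x)"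
  unfolding pairing_def by (intro sum.mono_neutral_left) auto

lemma pairing_indicator: "finite {x. u x \<noteq> 0} \<Longrightarrow> pairing u (\<lambda>x. if x = z then 1 else 0) = u z"
  by (subst pairing_superset[of "insert z {x. u x \<noteq> 0}"]) (auto simp: if_distrib sum.delta cong: if_cong)

lemma pairing_cong: "\<lbrakk>\<And>x. u x \<noteq> 0 \<Longrightarrow> F x = G x\<rbrakk> \<Longrightarrow> pairing u F = pairing u G"
  unfolding pairing_def by (intro sum.cong) auto

text \<open>
  A formal tensor is recovered from its integrals against indicator functions.
\<close>

lemma pairing_ext:
  assumes "finite {x. u x \<noteq> 0}" "finite {x. v x \<noteq> 0}" "\<And>F. pairing u F = pairing v F"
  shows "u = v"
  using assms by (metis (no_types, lifting) ext pairing_indicator)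

lemma pairing_add:
  assumes "finite {x. u x \<noteq> 0}" "finite {x. v x \<noteq> 0}"
  shows "pairing (\<lambda>x. u x + v x) F = pairing u F + pairing v F"
proof -
  let ?S = "{x. u x \<noteq> 0} \<union> {x. v x \<noteq> 0}"
  have "pairing (\<lambda>x. u x + v x) F = (\<Sum>x\<in>?S. (u x + v x) * F x)"
    using assms by (intro pairing_superset) auto
  also have "\<dots> = (\<Sum>x\<in>?S. u x * F x) + (\<Sum>x\<in>?S. v x * F x)"
    by (simp add: distrib_right sum.distrib)
  also have "\<dots> = pairing u F + pairing v F"
    using assms by (subst (1 2) pairing_superset[of ?S]) auto
  finally show ?thesis .
qed

lemma pairing_scale:
  assumes "finite {x. u x \<noteq> 0}" shows "pairing (\<lambda>x. c * u x) F = c * pairing u F"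
  by (subst (1 2) pairing_superset[OF assms]) (auto simp: sum_distrib_left mult.assoc)

lemma pairing_add_right: "pairing u (\<lambda>x. F x + G x) = pairing u F + pairing u G"
  by (simp add: pairing_def distrib_left sum.distrib)

lemma pairing_scale_right: "pairing u (\<lambda>x. c * F x) = c * pairing u F"
  by (simp add: pairing_def sum_distrib_left algebra_simps)

lemma pairing_swap: "pairing u (\<lambda>x. pairing v (\<lambda>y. F x y)) = pairing v (\<lambda>y. pairing u (\<lambda>x. F x y))"
  by (simp add: pairing_def sum_distrib_left sum.swap[of _ "{x. u x \<noteq> 0}"] mult.left_commute)

locale tensor_factors = A: star_algebra A + B: star_algebra B
  for A :: "('a, 'm) star_algebra_scheme" and B :: "('b, 'n) star_algebra_scheme"
begin

abbreviation T where "T \<equiv> formal_tensors A B"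

definition pair_mult :: "'a \<times> 'b \<Rightarrow> 'a \<times> 'b \<Rightarrow> 'a \<times> 'b"
  where "pair_mult x y = (fst x \<otimes>\<^bsub>A\<^esub> fst y, snd x \<otimes>\<^bsub>B\<^esub> snd y)"

definition pair_star :: "'a \<times> 'b \<Rightarrow> 'a \<times> 'b"
  where "pair_star x = (astar A (fst x), astar B (snd x))"

lemma mem_T_iff: "u \<in> elems T \<longleftrightarrow> finite {z. u z \<noteq> 0} \<and> {z. u z \<noteq> 0} \<subseteq> elems A \<times> elems B"
  by (simp add: formal_tensors_def)

lemma finite_support: "u \<in> elems T \<Longrightarrow> finite {z. u z \<noteq> 0}"
  by (simp add: mem_T_iff)

lemma support: "\<lbrakk>u \<in> elems T; u x \<noteq> 0\<rbrakk> \<Longrightarrow> x \<in> elems A \<times> elems B"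
  by (auto simp: mem_T_iff)

lemma T_ops: "azero T = (\<lambda>_. 0)" "aadd T u v = (\<lambda>z. u z + v z)" "ascale T c u = (\<lambda>z. c * u z)"
  by (simp_all add: formal_tensors_def)

lemma mult_T: "amult T u v z = pairing u (\<lambda>x. pairing v (\<lambda>y. if pair_mult x y = z then 1 else 0))"
  by (simp add: formal_tensors_def pairing_def sum_distrib_left sum.cartesian_product pair_mult_def
      if_distrib split_def cong: if_cong)

lemma star_T: "astar T u z = (\<Sum>x | u x \<noteq> 0. cnj (u x) * (if pair_star x = z then 1 else 0))"
  by (simp add: formal_tensors_def pair_star_def split_def if_distrib cong: if_cong)

lemma mult_T_support:
  "{z. amult T u v z \<noteq> 0} \<subseteq> (\<lambda>(x, y). pair_mult x y) ` ({x. u x \<noteq> 0} \<times> {y. v y \<noteq> 0})"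
  (is "_ \<subseteq> ?P")
proof (rule subsetI, rule ccontr)
  fix z assume z: "z \<in> {z. amult T u v z \<noteq> 0}" "z \<notin> ?P"
  then have "amult T u v z = pairing u (\<lambda>x. pairing v (\<lambda>y. 0))"
    unfolding mult_T by (intro pairing_cong) force
  with z show False by (simp add: pairing_def)
qed

lemma star_T_support: "{z. astar T u z \<noteq> 0} \<subseteq> pair_star ` {x. u x \<noteq> 0}"
proof (rule subsetI, rule ccontr)
  fix z assume z: "z \<in> {z. astar T u z \<noteq> 0}" "z \<notin> pair_star ` {x. u x \<noteq> 0}"
  then have "astar T u z = 0" unfolding star_T by (intro sum.neutral) auto
  with z show False by simp
qed

lemma pairing_mult:
  assumes u: "finite {x. u x \<noteq> 0}" and v: "finite {x. v x \<noteq> 0}"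
  shows "pairing (amult T u v) F = pairing u (\<lambda>x. pairing v (\<lambda>y. F (pair_mult x y)))"
proof -
  let ?P = "(\<lambda>(x, y). pair_mult x y) ` ({x. u x \<noteq> 0} \<times> {y. v y \<noteq> 0})"
  have fin: "finite ?P" using u v by simp
  have "pairing (amult T u v) F = (\<Sum>z\<in>?P. amult T u v z * F z)"
    using fin mult_T_support by (rule pairing_superset)
  also have "\<dots> = (\<Sum>z\<in>?P. \<Sum>x | u x \<noteq> 0. \<Sum>y | v y \<noteq> 0. u x * v y * ((if pair_mult x y = z then 1 else 0) * F z))"
    by (simp add: mult_T pairing_def sum_distrib_left sum_distrib_right mult.assoc)
  also have "\<dots> = (\<Sum>x | u x \<noteq> 0. \<Sum>z\<in>?P. \<Sum>y | v y \<noteq> 0. u x * v y * ((if pair_mult x y = z then 1 else 0) * F z))"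
    by (rule sum.swap)
  also have "\<dots> = (\<Sum>x | u x \<noteq> 0. \<Sum>y | v y \<noteq> 0. \<Sum>z\<in>?P. u x * v y * ((if pair_mult x y = z then 1 else 0) * F z))"
    by (intro sum.cong refl sum.swap)
  also have "\<dots> = (\<Sum>x | u x \<noteq> 0. \<Sum>y | v y \<noteq> 0. u x * v y * F (pair_mult x y))"
  proof (intro sum.cong refl)
    fix x y assume "x \<in> {x. u x \<noteq> 0}" "y \<in> {x. v x \<noteq> 0}"
    then have "pair_mult x y \<in> ?P" by force
    moreover have "(\<Sum>z\<in>?P. (if pair_mult x y = z then 1 else 0) * F z) = (\<Sum>z\<in>?P. if pair_mult x y = z then F z else 0)"
      by (intro sum.cong) auto
    ultimately have "(\<Sum>z\<in>?P. (if pair_mult x y = z then 1 else 0) * F z) = F (pair_mult x y)"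
      using fin by (simp add: sum.delta)
    then show "(\<Sum>z\<in>?P. u x * v y * ((if pair_mult x y = z then 1 else 0) * F z)) = u x * v y * F (pair_mult x y)"
      by (simp flip: sum_distrib_left)
  qed
  also have "\<dots> = pairing u (\<lambda>x. pairing v (\<lambda>y. F (pair_mult x y)))"
    by (simp add: pairing_def sum_distrib_left mult.assoc)
  finally show ?thesis .
qed

lemma pairing_star:
  assumes u: "finite {x. u x \<noteq> 0}"
  shows "pairing (astar T u) F = cnj (pairing u (\<lambda>x. cnj (F (pair_star x))))"
proof -
  let ?P = "pair_star ` {x. u x \<noteq> 0}"
  have fin: "finite ?P" using u by simp
  have "pairing (astar T u) F = (\<Sum>z\<in>?P. astar T u z * F z)"
    using fin star_T_support by (rule pairing_superset)
  also have "\<dots> = (\<Sum>z\<in>?P. \<Sum>x | u x \<noteq> 0. cnj (u x) * ((if pair_star x = z then 1 else 0) * F z))"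
    by (simp add: star_T sum_distrib_right mult.assoc)
  also have "\<dots> = (\<Sum>x | u x \<noteq> 0. \<Sum>z\<in>?P. cnj (u x) * ((if pair_star x = z then 1 else 0) * F z))"
    by (rule sum.swap)
  also have "\<dots> = (\<Sum>x | u x \<noteq> 0. cnj (u x) * F (pair_star x))"
  proof (intro sum.cong refl)
    fix x assume "x \<in> {x. u x \<noteq> 0}"
    then have "pair_star x \<in> ?P" by force
    moreover have "(\<Sum>z\<in>?P. (if pair_star x = z then 1 else 0) * F z) = (\<Sum>z\<in>?P. if pair_star x = z then F z else 0)"
      by (intro sum.cong) auto
    ultimately have "(\<Sum>z\<in>?P. (if pair_star x = z then 1 else 0) * F z) = F (pair_star x)"
      using fin by (simp add: sum.delta)
    then show "(\<Sum>z\<in>?P. cnj (u x) * ((if pair_star x = z then 1 else 0) * F z)) = cnj (u x) * F (pair_star x)"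
      by (simp flip: sum_distrib_left)
  qed
  also have "\<dots> = cnj (pairing u (\<lambda>x. cnj (F (pair_star x))))"
    by (simp add: pairing_def)
  finally show ?thesis .
qed

lemma T_closed:
  assumes u: "u \<in> elems T"
  shows "v \<in> elems T \<Longrightarrow> aadd T u v \<in> elems T" "ascale T c u \<in> elems T"
    "v \<in> elems T \<Longrightarrow> amult T u v \<in> elems T" "astar T u \<in> elems T"
proof -
  show "ascale T c u \<in> elems T"
    using u unfolding mem_T_iff T_ops by (auto elim!: rev_finite_subset)
  show "aadd T u v \<in> elems T" if v: "v \<in> elems T"
  proof -
    have "{z. u z + v z \<noteq> 0} \<subseteq> {z. u z \<noteq> 0} \<union> {z. v z \<noteq> 0}" by auto
    then show ?thesis using u v unfolding mem_T_iff T_ops by (blast intro: finite_subset)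
  qed
  show "amult T u v \<in> elems T" if v: "v \<in> elems T"
  proof -
    have "finite ((\<lambda>(x, y). pair_mult x y) ` ({x. u x \<noteq> 0} \<times> {y. v y \<noteq> 0}))"
      using finite_support[OF u] finite_support[OF v] by simp
    moreover have "(\<lambda>(x, y). pair_mult x y) ` ({x. u x \<noteq> 0} \<times> {y. v y \<noteq> 0}) \<subseteq> elems A \<times> elems B"
      using support[OF u] support[OF v] by (fastforce simp: pair_mult_def)
    ultimately show ?thesis
      unfolding mem_T_iff using mult_T_support[of u v] by (meson finite_subset order_trans)
  qed
  show "astar T u \<in> elems T"
  proof -
    have "pair_star ` {x. u x \<noteq> 0} \<subseteq> elems A \<times> elems B"
      using support[OF u] by (fastforce simp: pair_star_def)
    then show ?thesis
      unfolding mem_T_iff using star_T_support[of u] finite_support[OF u]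
      by (meson finite_imageI finite_subset order_trans)
  qed
qed

lemma T_ext: "\<lbrakk>u \<in> elems T; v \<in> elems T; \<And>F. pairing u F = pairing v F\<rbrakk> \<Longrightarrow> u = v"
  by (intro pairing_ext finite_support)

lemma pairing_T:
  assumes u: "u \<in> elems T"
  shows "v \<in> elems T \<Longrightarrow> pairing (aadd T u v) F = pairing u F + pairing v F"
    "pairing (ascale T c u) F = c * pairing u F"
    "v \<in> elems T \<Longrightarrow> pairing (amult T u v) F = pairing u (\<lambda>x. pairing v (\<lambda>y. F (pair_mult x y)))"
    "pairing (astar T u) F = cnj (pairing u (\<lambda>x. cnj (F (pair_star x))))"
  using finite_support[OF u] finite_support[of v]
  by (simp_all add: T_ops pairing_add pairing_scale pairing_mult pairing_star)

lemma star_algebra_T: "star_algebra T"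
proof
  show "azero T \<in> elems T" by (simp add: T_ops mem_T_iff)
next
  fix u v w assume u: "u \<in> elems T" and v: "v \<in> elems T" and w: "w \<in> elems T"
  note [simp] = T_closed
  have "pairing (u \<otimes>\<^bsub>T\<^esub> v \<otimes>\<^bsub>T\<^esub> w) F = pairing (u \<otimes>\<^bsub>T\<^esub> (v \<otimes>\<^bsub>T\<^esub> w)) F" for F
    unfolding pairing_T(3)[OF T_closed(3)[OF u v] w] pairing_T(3)[OF u v]
      pairing_T(3)[OF u T_closed(3)[OF v w]] pairing_T(3)[OF v w]
    using support[OF u] support[OF v] support[OF w]
    by (intro pairing_cong) (simp add: pair_mult_def A.mult_assoc B.mult_assoc mem_Times_iff)
  then show "u \<otimes>\<^bsub>T\<^esub> v \<otimes>\<^bsub>T\<^esub> w = u \<otimes>\<^bsub>T\<^esub> (v \<otimes>\<^bsub>T\<^esub> w)"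
    using u v w by (intro T_ext) simp_all
  show "(u \<oplus>\<^bsub>T\<^esub> v) \<otimes>\<^bsub>T\<^esub> w = u \<otimes>\<^bsub>T\<^esub> w \<oplus>\<^bsub>T\<^esub> v \<otimes>\<^bsub>T\<^esub> w"
    using u v w by (intro T_ext) (simp_all add: pairing_T)
  show "w \<otimes>\<^bsub>T\<^esub> (u \<oplus>\<^bsub>T\<^esub> v) = w \<otimes>\<^bsub>T\<^esub> u \<oplus>\<^bsub>T\<^esub> w \<otimes>\<^bsub>T\<^esub> v"
    using u v w by (intro T_ext) (simp_all add: pairing_T pairing_add_right)
next
  fix u v c assume u: "u \<in> elems T" and v: "v \<in> elems T"
  note [simp] = T_closed
  show "(c \<odot>\<^bsub>T\<^esub> u) \<otimes>\<^bsub>T\<^esub> v = c \<odot>\<^bsub>T\<^esub> (u \<otimes>\<^bsub>T\<^esub> v)"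
    using u v by (intro T_ext) (simp_all add: pairing_T)
  show "u \<otimes>\<^bsub>T\<^esub> (c \<odot>\<^bsub>T\<^esub> v) = c \<odot>\<^bsub>T\<^esub> (u \<otimes>\<^bsub>T\<^esub> v)"
    using u v by (intro T_ext) (simp_all add: pairing_T pairing_scale_right)
  show "astar T (u \<oplus>\<^bsub>T\<^esub> v) = astar T u \<oplus>\<^bsub>T\<^esub> astar T v"
    using u v by (intro T_ext) (simp_all add: pairing_T)
  show "astar T (c \<odot>\<^bsub>T\<^esub> u) = cnj c \<odot>\<^bsub>T\<^esub> astar T u"
    using u by (intro T_ext) (simp_all add: pairing_T)
  have "pairing (astar T (astar T u)) F = pairing u F" for F
    unfolding pairing_T(4)[OF T_closed(4)[OF u]] pairing_T(4)[OF u] complex_cnj_cnj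
    using support[OF u] by (intro pairing_cong) (simp add: pair_star_def A.star_star B.star_star mem_Times_iff)
  then show "astar T (astar T u) = u" using u by (intro T_ext) simp_all
  have "pairing (astar T (u \<otimes>\<^bsub>T\<^esub> v)) F = pairing (astar T v \<otimes>\<^bsub>T\<^esub> astar T u) F" for F
  proof -
    have "pairing (astar T (u \<otimes>\<^bsub>T\<^esub> v)) F
        = cnj (pairing u (\<lambda>x. pairing v (\<lambda>y. cnj (F (pair_star (pair_mult x y))))))"
      using u v by (simp add: pairing_T)
    also have "\<dots> = cnj (pairing u (\<lambda>x. pairing v (\<lambda>y. cnj (F (pair_mult (pair_star y) (pair_star x))))))"
      using support[OF u] support[OF v]
      by (intro arg_cong[where f=cnj] pairing_cong)
        (simp add: pair_star_def pair_mult_def A.star_mult B.star_mult mem_Times_iff)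
    also have "\<dots> = pairing (astar T v \<otimes>\<^bsub>T\<^esub> astar T u) F"
      using u v by (simp add: pairing_T pairing_swap[of v u])
    finally show ?thesis .
  qed
  then show "astar T (u \<otimes>\<^bsub>T\<^esub> v) = astar T v \<otimes>\<^bsub>T\<^esub> astar T u" using u v by (intro T_ext) simp_all
qed (simp_all add: T_closed, simp_all add: T_ops fun_eq_iff algebra_simps)

end

section \<open>The largest C*-seminorm on a tensor product\<close>

lemma cstar_seminormed_extend:
  assumes "star_algebra T" "cstar_seminorm T p"
  shows "cstar_seminormed (star_algebra.extend T (normed_star_algebra.fields p))"
proof (rule cstar_seminormedI)
  interpret star_algebra T by fact
  show "star_algebra (star_algebra.extend T (normed_star_algebra.fields p))"
    by unfold_locales
      (simp_all add: star_algebra.defs normed_star_algebra.defs add_ac zero_add add_zero add_uminus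
        scale_one scale_scale scale_add_left scale_add_right mult_assoc mult_add_left mult_add_right
        mult_scale_left mult_scale_right star_star star_add star_scale star_mult)
qed (use assms(2) in \<open>simp add: star_algebra.defs normed_star_algebra.defs cstar_seminorm_def\<close>)

text \<open>
  By subadditivity, the value of any of the seminorms at a formal tensor is bounded by the sum of
  the products of norms. The supremum of all of them is therefore finite.
\<close>

lemma tensor_seminorm_le:
  assumes p: "p \<in> tensor_seminorms A B" and A: "star_algebra A" and B: "star_algebra B"
    and u: "u \<in> elems (formal_tensors A B)"
  shows "p u \<le> (\<Sum>x | u x \<noteq> 0. cmod (u x) * (anorm A (fst x) * anorm B (snd x)))"
proof -
  interpret tensor_factors A B by (simp add: tensor_factors_def A B)
  interpret T: star_algebra T by (rule star_algebra_T)
  have add: "\<And>u v. \<lbrakk>u \<in> elems T; v \<in> elems T\<rbrakk> \<Longrightarrow> p (u \<oplus>\<^bsub>T\<^esub> v) \<le> p u + p v"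
    and scale: "\<And>u c. u \<in> elems T \<Longrightarrow> p (c \<odot>\<^bsub>T\<^esub> u) = cmod c * p u"
    and pure: "\<And>a b. \<lbrakk>a \<in> elems A; b \<in> elems B\<rbrakk> \<Longrightarrow> p (pure_tensor a b) \<le> anorm A a * anorm B b"
    using p by (auto simp: tensor_seminorms_def cstar_seminorm_def)
  have *: "p v \<le> (\<Sum>x\<in>S. cmod (v x) * (anorm A (fst x) * anorm B (snd x)))"
    if "finite S" "v \<in> elems T" "{x. v x \<noteq> 0} \<subseteq> S" "S \<subseteq> elems A \<times> elems B" for v S
    using that
  proof (induction S arbitrary: v rule: finite_induct)
    case empty
    then have "v = 0 \<odot>\<^bsub>T\<^esub> v" by (auto simp: T_ops)
    then show ?case using scale[OF empty(1), of 0] by simp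
  next
    case (insert z S)
    define v' where "v' = v(z := 0)"
    have z: "fst z \<in> elems A" "snd z \<in> elems B" using insert.prems by auto
    have pz: "pure_tensor (fst z) (snd z) \<in> elems T"
      using z by (simp add: mem_T_iff pure_tensor_def mem_Times_iff)
    have "{x. v' x \<noteq> 0} \<subseteq> {x. v x \<noteq> 0}" by (auto simp: v'_def)
    then have v': "v' \<in> elems T" using insert.prems(1) unfolding mem_T_iff by (meson finite_subset order_trans)
    have "v = v' \<oplus>\<^bsub>T\<^esub> v z \<odot>\<^bsub>T\<^esub> pure_tensor (fst z) (snd z)"
      by (auto simp: T_ops v'_def pure_tensor_def)
    then have "p v \<le> p v' + p (v z \<odot>\<^bsub>T\<^esub> pure_tensor (fst z) (snd z))"
      using add[OF v' T.scale_closed[OF pz]] by metis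
    also have "\<dots> = p v' + cmod (v z) * p (pure_tensor (fst z) (snd z))"
      using scale[OF pz] by simp
    also have "\<dots> \<le> (\<Sum>x\<in>S. cmod (v' x) * (anorm A (fst x) * anorm B (snd x)))
        + cmod (v z) * (anorm A (fst z) * anorm B (snd z))"
      using insert z by (intro add_mono insert.IH mult_left_mono pure v') (auto simp: v'_def)
    also have "(\<Sum>x\<in>S. cmod (v' x) * (anorm A (fst x) * anorm B (snd x)))
        = (\<Sum>x\<in>S. cmod (v x) * (anorm A (fst x) * anorm B (snd x)))"
      using insert by (intro sum.cong) (auto simp: v'_def)
    finally show ?case using insert by (simp add: add.commute)
  qed
  show ?thesis using u by (intro *) (auto simp: mem_T_iff)
qed

theorem cstar_algebra_tensor:
  assumes A: "star_algebra A" and B: "star_algebra B"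
    and nonneg: "\<And>a. a \<in> elems A \<Longrightarrow> 0 \<le> anorm A a" "\<And>b. b \<in> elems B \<Longrightarrow> 0 \<le> anorm B b"
  shows "cstar_algebra (cstar_tensor A B)"
proof -
  interpret tensor_factors A B by (simp add: tensor_factors_def A B)
  \<comment> \<open>The supremum is taken over a nonempty set. Nonnegativity of the norms is used here.\<close>
  have "(\<lambda>_. 0) \<in> tensor_seminorms A B"
    using nonneg by (simp add: tensor_seminorms_def cstar_seminorm_def)
  then have "cstar_seminorm T (\<lambda>u. SUP p\<in>tensor_seminorms A B. p u)"
    using tensor_seminorm_le[OF _ A B]
    by (intro cstar_seminorm_SUP star_algebra_T) (auto simp: tensor_seminorms_def intro!: bdd_aboveI2)
  then show ?thesis
    unfolding cstar_tensor_def
    by (intro cstar_seminormed.cstar_algebra_completion cstar_seminormed_extend star_algebra_T)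
qed

section \<open>Square-summable sequences\<close>

text \<open>
  The Euclidean norms of the initial segments satisfy the triangle and Cauchy-Schwarz inequalities;
  both carry over to \<open>\<ell>\<^sup>2\<close> because the norm there is the supremum of these.
\<close>

abbreviation head_norm :: "cseq \<Rightarrow> nat \<Rightarrow> real"
  where "head_norm x M \<equiv> L2_set (\<lambda>n. cmod (x n)) {..<M}"

lemma ell2_boundedI:
  assumes "\<And>M. head_norm x M \<le> B"
  shows "x \<in> ell2" "ell2_norm x \<le> B"
proof -
  have B: "0 \<le> B" using assms[of 0] by simp
  have le: "(\<Sum>n<M. (cmod (x n))\<^sup>2) \<le> B\<^sup>2" for M
    using assms[of M] B unfolding L2_set_def by (metis sqrt_le_D)
  have sm: "summable (\<lambda>n. (cmod (x n))\<^sup>2)" using le by (intro summableI_nonneg_bounded) auto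
  then show "x \<in> ell2" by (simp add: ell2_def)
  have "(\<Sum>n. (cmod (x n))\<^sup>2) \<le> B\<^sup>2" using le sm by (intro suminf_le_const) auto
  then show "ell2_norm x \<le> B" using B by (simp add: ell2_norm_def real_le_lsqrt)
qed

lemma head_norm_le: "x \<in> ell2 \<Longrightarrow> head_norm x M \<le> ell2_norm x"
  unfolding L2_set_def ell2_norm_def ell2_def by (auto intro!: sum_le_suminf)

lemma ell2_norm_nonneg [simp]: "x \<in> ell2 \<Longrightarrow> 0 \<le> ell2_norm x"
  using head_norm_le[of x 0] by simp

lemma ell2_add:
  assumes "x \<in> ell2" "y \<in> ell2"
  shows "(\<lambda>n. x n + y n) \<in> ell2" "ell2_norm (\<lambda>n. x n + y n) \<le> ell2_norm x + ell2_norm y"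
proof -
  have "head_norm (\<lambda>n. x n + y n) M \<le> ell2_norm x + ell2_norm y" for M
  proof -
    have "head_norm (\<lambda>n. x n + y n) M \<le> L2_set (\<lambda>n. cmod (x n) + cmod (y n)) {..<M}"
      by (intro L2_set_mono) (auto simp: norm_triangle_ineq)
    also have "\<dots> \<le> head_norm x M + head_norm y M" by (rule L2_set_triangle_ineq)
    finally show ?thesis using head_norm_le[OF assms(1), of M] head_norm_le[OF assms(2), of M] by linarith
  qed
  then show "(\<lambda>n. x n + y n) \<in> ell2" "ell2_norm (\<lambda>n. x n + y n) \<le> ell2_norm x + ell2_norm y"
    by (rule ell2_boundedI)+
qed

lemma ell2_scale:
  assumes "x \<in> ell2"
  shows "(\<lambda>n. c * x n) \<in> ell2" "ell2_norm (\<lambda>n. c * x n) = cmod c * ell2_norm x"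
proof -
  have sm: "summable (\<lambda>n. (cmod (x n))\<^sup>2)" using assms by (simp add: ell2_def)
  show "(\<lambda>n. c * x n) \<in> ell2" using sm by (simp add: ell2_def norm_mult power_mult_distrib summable_mult)
  show "ell2_norm (\<lambda>n. c * x n) = cmod c * ell2_norm x"
    by (simp add: ell2_norm_def norm_mult power_mult_distrib suminf_mult[OF sm] real_sqrt_mult)
qed

lemma ell2_zero [simp]: "(\<lambda>_. 0) \<in> ell2" "ell2_norm (\<lambda>_. 0) = 0"
  by (simp_all add: ell2_def ell2_norm_def)

lemma ell2_diff:
  assumes "x \<in> ell2" "y \<in> ell2"
  shows "(\<lambda>n. x n - y n) \<in> ell2" "ell2_norm (\<lambda>n. x n - y n) \<le> ell2_norm x + ell2_norm y"
  using ell2_add[OF assms(1) ell2_scale(1)[OF assms(2), of "-1"]] ell2_scale(2)[OF assms(2), of "-1"]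
  by simp_all

lemmas ell2_closed [simp] = ell2_add(1) ell2_scale(1) ell2_diff(1)

lemma ell2_norm_diff_commute: "ell2_norm (\<lambda>n. x n - y n) = ell2_norm (\<lambda>n. y n - x n)"
  by (simp add: ell2_norm_def norm_minus_commute)

lemma ell2_norm_eq_0: "x \<in> ell2 \<Longrightarrow> ell2_norm x = 0 \<longleftrightarrow> x = (\<lambda>_. 0)"
  unfolding ell2_norm_def ell2_def by (auto simp: suminf_eq_zero_iff fun_eq_iff)

lemma ell2_norm_diff_triangle:
  assumes "x \<in> ell2" "y \<in> ell2" "z \<in> ell2"
  shows "ell2_norm (\<lambda>n. x n - z n) \<le> ell2_norm (\<lambda>n. x n - y n) + ell2_norm (\<lambda>n. y n - z n)"
  using ell2_add(2)[OF ell2_diff(1)[OF assms(1,2)] ell2_diff(1)[OF assms(2,3)]] by simp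

interpretation ell2: Metric_space ell2 ell2_dist
proof
  show "0 \<le> ell2_dist x y" for x y by (simp add: ell2_dist_def)
  show "ell2_dist x y = ell2_dist y x" for x y
    by (simp add: ell2_dist_def ell2_norm_diff_commute[of x y])
  show "ell2_dist x y = 0 \<longleftrightarrow> x = y" if "x \<in> ell2" "y \<in> ell2" for x y
    using that ell2_norm_eq_0[OF ell2_diff(1)[OF that]] by (simp add: ell2_dist_def fun_eq_iff)
  show "ell2_dist x z \<le> ell2_dist x y + ell2_dist y z"
    if "x \<in> ell2" "y \<in> ell2" "z \<in> ell2" for x y z
    using that by (simp add: ell2_dist_def ell2_norm_diff_triangle)
qed

definition ell2_Cauchy :: "(nat \<Rightarrow> cseq) \<Rightarrow> bool"
  where "ell2_Cauchy s \<longleftrightarrow> (\<forall>\<epsilon>>0. \<exists>N. \<forall>m\<ge>N. \<forall>n\<ge>N. ell2_norm (\<lambda>k. s m k - s n k) < \<epsilon>)"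

lemma ell2_MCauchy_iff: "ell2.MCauchy s \<longleftrightarrow> (\<forall>n. s n \<in> ell2) \<and> ell2_Cauchy s"
proof (cases "\<forall>n. s n \<in> ell2")
  case True
  then show ?thesis unfolding ell2.MCauchy_def ell2_Cauchy_def
    by (simp add: ell2_dist_def image_subset_iff)
qed (auto simp: ell2.MCauchy_def)

lemma ell2_component_le: assumes "x \<in> ell2" shows "cmod (x n) \<le> ell2_norm x"
  using member_le_L2_set[of "{..<Suc n}" n "\<lambda>n. cmod (x n)"] head_norm_le[OF assms, of "Suc n"] by simp

text \<open>
  The coordinatewise limit works, since the distance to it on an initial segment is a limit of
  distances between terms.
\<close>

lemma ell2_complete: "ell2.mcomplete"
  unfolding ell2.mcomplete_def ell2_MCauchy_iff
proof (intro allI impI, elim conjE)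
  fix s assume s: "\<forall>n. s n \<in> ell2" and C: "ell2_Cauchy s"
  have "Cauchy (\<lambda>n. s n k)" for k
  proof (rule CauchyI)
    fix e :: real assume "e > 0"
    then obtain N where N: "\<forall>m\<ge>N. \<forall>n\<ge>N. ell2_norm (\<lambda>k. s m k - s n k) < e"
      using C unfolding ell2_Cauchy_def by blast
    have "norm (s m k - s n k) < e" if "m \<ge> N" "n \<ge> N" for m n
      using ell2_component_le[OF ell2_diff(1)[of "s m" "s n"], of k] N s that
      by (meson order.strict_trans1)
    then show "\<exists>M. \<forall>m\<ge>M. \<forall>n\<ge>M. norm (s m k - s n k) < e" by blast
  qed
  then have "\<forall>k. \<exists>l. (\<lambda>n. s n k) \<longlonglongrightarrow> l" using Cauchy_convergent_iff convergent_def by metis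
  then obtain x where x: "\<And>k. (\<lambda>n. s n k) \<longlonglongrightarrow> x k" by metis
  have close: "\<exists>N. \<forall>n\<ge>N. (\<lambda>k. s n k - x k) \<in> ell2 \<and> ell2_norm (\<lambda>k. s n k - x k) \<le> e" if e: "e > 0" for e
  proof -
    obtain N where N: "\<forall>m\<ge>N. \<forall>n\<ge>N. ell2_norm (\<lambda>k. s m k - s n k) < e"
      using C e unfolding ell2_Cauchy_def by blast
    have "head_norm (\<lambda>k. s n k - x k) M \<le> e" if n: "n \<ge> N" for n M
    proof (rule LIMSEQ_le_const2)
      show "(\<lambda>m. head_norm (\<lambda>k. s n k - s m k) M) \<longlonglongrightarrow> head_norm (\<lambda>k. s n k - x k) M"
        unfolding L2_set_def by (intro tendsto_intros x)
      have "head_norm (\<lambda>k. s n k - s m k) M \<le> e" if "m \<ge> N" for m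
        using head_norm_le[OF ell2_diff(1)[of "s n" "s m"], of M] N s n that
        by (meson less_imp_le order_trans)
      then show "\<exists>N. \<forall>m\<ge>N. head_norm (\<lambda>k. s n k - s m k) M \<le> e" by blast
    qed
    then show ?thesis by (intro exI[of _ N] allI impI conjI ell2_boundedI)
  qed
  obtain N where "(\<lambda>k. s N k - x k) \<in> ell2" using close[of 1] by auto
  then have xl: "x \<in> ell2" using ell2_diff(1)[of "s N" "\<lambda>k. s N k - x k"] s by simp
  have "limitin ell2.mtopology s x sequentially"
    unfolding ell2.limit_metric_sequentially
  proof (intro conjI allI impI xl)
    fix e :: real assume "e > 0"
    then obtain N where "\<forall>n\<ge>N. ell2_norm (\<lambda>k. s n k - x k) \<le> e/2" using close[of "e/2"] by auto
    then have "\<forall>n\<ge>N. s n \<in> ell2 \<and> ell2_dist (s n) x < e"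
      using s xl \<open>e > 0\<close> by (force simp: ell2_dist_def)
    then show "\<exists>N. \<forall>n\<ge>N. s n \<in> ell2 \<and> ell2_dist (s n) x < e" by blast
  qed
  then show "\<exists>x. limitin ell2.mtopology s x sequentially" by (rule exI[of _ x])
qed

lemma ell2_inner_sums:
  assumes "x \<in> ell2" "y \<in> ell2"
  shows "(\<lambda>n. x n * cnj (y n)) sums ell2_inner x y" "cmod (ell2_inner x y) \<le> ell2_norm x * ell2_norm y"
proof -
  have le: "(\<Sum>n<M. cmod (x n * cnj (y n))) \<le> ell2_norm x * ell2_norm y" for M
  proof -
    have "(\<Sum>n<M. cmod (x n * cnj (y n))) \<le> head_norm x M * head_norm y M"
      using L2_set_mult_ineq[of "\<lambda>n. cmod (x n)" "\<lambda>n. cmod (y n)" "{..<M}"] by (simp add: norm_mult)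
    also have "\<dots> \<le> ell2_norm x * ell2_norm y"
      using assms by (intro mult_mono head_norm_le) (auto simp: L2_set_nonneg)
    finally show ?thesis .
  qed
  have sm: "summable (\<lambda>n. cmod (x n * cnj (y n)))" using le by (intro summableI_nonneg_bounded) auto
  show "(\<lambda>n. x n * cnj (y n)) sums ell2_inner x y"
    unfolding ell2_inner_def by (rule summable_sums[OF summable_norm_cancel[OF sm]])
  have "cmod (ell2_inner x y) \<le> (\<Sum>n. cmod (x n * cnj (y n)))"
    unfolding ell2_inner_def by (rule summable_norm[OF sm])
  also have "\<dots> \<le> ell2_norm x * ell2_norm y" using sm le by (rule suminf_le_const)
  finally show "cmod (ell2_inner x y) \<le> ell2_norm x * ell2_norm y" .
qed

lemma ell2_inner_add_left:
  assumes "x \<in> ell2" "y \<in> ell2" "z \<in> ell2"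
  shows "ell2_inner (\<lambda>n. x n + y n) z = ell2_inner x z + ell2_inner y z"
  using sums_add[OF ell2_inner_sums(1)[OF assms(1,3)] ell2_inner_sums(1)[OF assms(2,3)]]
  unfolding ell2_inner_def[of "\<lambda>n. x n + y n"] by (simp add: distrib_right sums_iff)

lemma ell2_inner_scale_left:
  assumes "x \<in> ell2" "z \<in> ell2" shows "ell2_inner (\<lambda>n. c * x n) z = c * ell2_inner x z"
  using sums_mult[OF ell2_inner_sums(1)[OF assms], of c]
  unfolding ell2_inner_def[of "\<lambda>n. c * x n"] by (simp add: mult.assoc sums_iff)

lemma ell2_inner_commute:
  assumes "x \<in> ell2" "y \<in> ell2" shows "ell2_inner y x = cnj (ell2_inner x y)"
proof -
  have "(\<lambda>n. cnj (x n * cnj (y n))) sums cnj (ell2_inner x y)"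
    using ell2_inner_sums(1)[OF assms] by (simp only: sums_cnj)
  then show ?thesis unfolding ell2_inner_def[of y] by (simp add: mult.commute sums_iff)
qed

lemma ell2_inner_self: "x \<in> ell2 \<Longrightarrow> ell2_inner x x = of_real ((ell2_norm x)\<^sup>2)"
  unfolding ell2_inner_def ell2_norm_def ell2_def
  by (simp add: complex_norm_square[symmetric] suminf_of_real suminf_nonneg del: of_real_power)

definition unit_vec :: "nat \<Rightarrow> cseq" where "unit_vec n = (\<lambda>k. if k = n then 1 else 0)"

definition head_part :: "nat \<Rightarrow> cseq \<Rightarrow> cseq" where "head_part N x = (\<lambda>n. if n < N then x n else 0)"

lemma unit_vec_ell2 [simp]: "unit_vec n \<in> ell2"
proof -
  have "(\<lambda>k. (cmod (unit_vec n k))\<^sup>2) = (\<lambda>k. if k = n then 1 else 0)" by (auto simp: unit_vec_def)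
  then show ?thesis unfolding ell2_def using sums_single[of n "\<lambda>_. 1::real"] by (auto simp: sums_iff)
qed

lemma ell2_inner_unit_vec: "ell2_inner (unit_vec n) z = cnj (z n)"
proof -
  have "(\<lambda>k. unit_vec n k * cnj (z k)) = (\<lambda>k. if k = n then cnj (z k) else 0)"
    by (auto simp: unit_vec_def)
  then show ?thesis
    unfolding ell2_inner_def using sums_single[of n "\<lambda>k. cnj (z k)"] by (simp add: sums_iff)
qed

lemma head_norm_head_part: "head_norm (head_part N x) M \<le> head_norm x N"
proof -
  have "(\<Sum>n<M. (cmod (head_part N x n))\<^sup>2) = (\<Sum>n\<in>{..<M} \<inter> {..<N}. (cmod (x n))\<^sup>2)"
    by (intro sum.mono_neutral_cong_right) (auto simp: head_part_def)
  also have "\<dots> \<le> (\<Sum>n<N. (cmod (x n))\<^sup>2)" by (intro sum_mono2) auto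
  finally show ?thesis by (simp add: L2_set_def)
qed

lemma head_part_ell2 [simp]: "head_part N x \<in> ell2" "ell2_norm (head_part N x) \<le> head_norm x N"
  using ell2_boundedI[OF head_norm_head_part] by auto

lemma head_part_tendsto:
  assumes "x \<in> ell2" shows "(\<lambda>N. ell2_norm (\<lambda>n. x n - head_part N x n)) \<longlonglongrightarrow> 0"
proof -
  let ?f = "\<lambda>n. (cmod (x n))\<^sup>2"
  have sm: "summable ?f" using assms by (simp add: ell2_def)
  have "(\<Sum>n. (cmod (x n - head_part N x n))\<^sup>2) = suminf ?f - (\<Sum>n<N. ?f n)" for N
  proof -
    have "(\<lambda>n. ?f n - (if n \<in> {..<N} then ?f n else 0)) sums (suminf ?f - (\<Sum>n<N. ?f n))"
      by (intro sums_diff summable_sums[OF sm] sums_If_finite_set) auto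
    also have "(\<lambda>n. ?f n - (if n \<in> {..<N} then ?f n else 0)) = (\<lambda>n. (cmod (x n - head_part N x n))\<^sup>2)"
      by (auto simp: head_part_def)
    finally show ?thesis by (simp add: sums_iff)
  qed
  moreover have "(\<lambda>N. sqrt (suminf ?f - (\<Sum>n<N. ?f n))) \<longlonglongrightarrow> sqrt (suminf ?f - suminf ?f)"
    by (intro tendsto_intros summable_LIMSEQ[OF sm])
  ultimately show ?thesis by (simp add: ell2_norm_def)
qed


section \<open>Compact operators\<close>

text \<open>As \<open>\<ell>\<^sup>2\<close> is complete, the relatively compact sets are the totally bounded ones.\<close>

lemma compact_operators_iff:
  "T \<in> compact_operators \<longleftrightarrow> T \<in> ell2 \<rightarrow>\<^sub>E ell2 \<and>
    (\<forall>x \<in> ell2. \<forall>y \<in> ell2. T (\<lambda>n. x n + y n) = (\<lambda>n. T x n + T y n)) \<and>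
    (\<forall>c. \<forall>x \<in> ell2. T (\<lambda>n. c * x n) = (\<lambda>n. c * T x n)) \<and>
    (\<forall>s. (\<forall>n. s n \<in> ell2 \<and> ell2_norm (s n) \<le> 1) \<longrightarrow>
      (\<exists>r::nat \<Rightarrow> nat. strict_mono r \<and> ell2_Cauchy (\<lambda>n. T (s (r n)))))"
proof -
  let ?B = "{x \<in> ell2. ell2_norm x \<le> 1}"
  have "compactin ell2_topology (ell2_topology closure_of (T ` ?B)) \<longleftrightarrow>
      (\<forall>s. (\<forall>n. s n \<in> ell2 \<and> ell2_norm (s n) \<le> 1) \<longrightarrow>
        (\<exists>r::nat \<Rightarrow> nat. strict_mono r \<and> ell2_Cauchy (\<lambda>n. T (s (r n)))))" (is "?L \<longleftrightarrow> ?R")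
    if T: "T \<in> ell2 \<rightarrow>\<^sub>E ell2"
  proof -
    have T': "T x \<in> ell2" if "x \<in> ell2" for x using T that by auto
    have "?L \<longleftrightarrow> ell2.mtotally_bounded (T ` ?B)"
      using ell2.mtotally_bounded_eq_compact_closure_of[OF ell2_complete, of "T ` ?B"] T' by auto
    also have "\<dots> \<longleftrightarrow> (\<forall>s::nat \<Rightarrow> cseq. range s \<subseteq> T ` ?B \<longrightarrow> (\<exists>r. strict_mono r \<and> ell2.MCauchy (s \<circ> r)))"
      using T' by (auto simp: ell2.mtotally_bounded_sequentially)
    also have "\<dots> \<longleftrightarrow> ?R"
    proof (intro iffI allI impI)
      fix s :: "nat \<Rightarrow> cseq"
      assume H: "\<forall>s::nat \<Rightarrow> cseq. range s \<subseteq> T ` ?B \<longrightarrow> (\<exists>r. strict_mono r \<and> ell2.MCauchy (s \<circ> r))"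
        and s: "\<forall>n. s n \<in> ell2 \<and> ell2_norm (s n) \<le> 1"
      have "range (\<lambda>n. T (s n)) \<subseteq> T ` ?B" using s by auto
      then obtain r where "strict_mono r" "ell2.MCauchy ((\<lambda>n. T (s n)) \<circ> r)" using H by blast
      then show "\<exists>r. strict_mono r \<and> ell2_Cauchy (\<lambda>n. T (s (r n)))"
        by (auto simp: ell2_MCauchy_iff o_def)
    next
      fix s :: "nat \<Rightarrow> cseq" assume H: ?R and s: "range s \<subseteq> T ` ?B"
      then have "\<forall>n. \<exists>x. x \<in> ?B \<and> s n = T x" using range_subsetD[OF s] by (auto simp: image_iff)
      then obtain t where t: "\<And>n. t n \<in> ?B" "\<And>n. s n = T (t n)" by metis
      then obtain r where "strict_mono r" "ell2_Cauchy (\<lambda>n. T (t (r n)))"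
        using H[rule_format, of t] by auto
      then show "\<exists>r. strict_mono r \<and> ell2.MCauchy (s \<circ> r)"
        using t T' by (auto simp: ell2_MCauchy_iff o_def intro!: exI[of _ r])
    qed
    finally show ?thesis .
  qed
  then show ?thesis unfolding compact_operators_def by auto
qed

locale compact_operator =
  fixes T assumes T: "T \<in> compact_operators"
begin

lemma mem_ell2 [simp]: "x \<in> ell2 \<Longrightarrow> T x \<in> ell2"
  and extensional: "T \<in> extensional ell2"
  and add: "\<lbrakk>x \<in> ell2; y \<in> ell2\<rbrakk> \<Longrightarrow> T (\<lambda>n. x n + y n) = (\<lambda>n. T x n + T y n)"
  and scale: "x \<in> ell2 \<Longrightarrow> T (\<lambda>n. c * x n) = (\<lambda>n. c * T x n)"
  and subseq: "\<lbrakk>\<And>n. s n \<in> ell2; \<And>n. ell2_norm (s n) \<le> 1\<rbrakk>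
    \<Longrightarrow> \<exists>r::nat \<Rightarrow> nat. strict_mono r \<and> ell2_Cauchy (\<lambda>n. T (s (r n)))"
  using T by (auto simp: compact_operators_iff PiE_def)

lemma zero: "T (\<lambda>_. 0) = (\<lambda>_. 0)"
  using scale[of "\<lambda>_. 0" 0] by simp

lemma diff: "\<lbrakk>x \<in> ell2; y \<in> ell2\<rbrakk> \<Longrightarrow> T (\<lambda>n. x n - y n) = (\<lambda>n. T x n - T y n)"
  using add[of x "\<lambda>n. (-1) * y n"] scale[of y "-1"] ell2_scale(1)[of y "-1"] by simp

lemma bounded: obtains K where "0 \<le> K" "\<And>x. x \<in> ell2 \<Longrightarrow> ell2_norm (T x) \<le> K * ell2_norm x"
proof -
  let ?B = "{x \<in> ell2. ell2_norm x \<le> 1}"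
  have "ell2.mtotally_bounded (T ` ?B)"
    using ell2.mtotally_bounded_eq_compact_closure_of[OF ell2_complete, of "T ` ?B"] T
    by (auto simp: compact_operators_def)
  then have "ell2.mbounded (T ` ?B)" by (rule ell2.mtotally_bounded_imp_mbounded)
  then obtain K where K: "\<And>x y. \<lbrakk>x \<in> ?B; y \<in> ?B\<rbrakk> \<Longrightarrow> ell2_dist (T x) (T y) \<le> K"
    unfolding ell2.mbounded_alt by auto
  have B: "ell2_norm (T x) \<le> K" if "x \<in> ?B" for x
    using K[OF that, of "\<lambda>_. 0"] that by (simp add: ell2_dist_def zero)
  have K0: "0 \<le> K" using B[of "\<lambda>_. 0"] by (simp add: zero)
  have "ell2_norm (T x) \<le> K * ell2_norm x" if x: "x \<in> ell2" for x
  proof (cases "ell2_norm x = 0")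
    case True then show ?thesis using ell2_norm_eq_0[OF x] by (simp add: zero)
  next
    case False
    let ?c = "complex_of_real (inverse (ell2_norm x))"
    have "ell2_norm (T (\<lambda>n. ?c * x n)) \<le> K"
      using x False by (intro B) (simp add: ell2_scale norm_inverse)
    moreover have "ell2_norm (T (\<lambda>n. ?c * x n)) = inverse (ell2_norm x) * ell2_norm (T x)"
      unfolding scale[OF x] ell2_scale(2)[OF mem_ell2[OF x]] using x by (simp only: norm_of_real) simp
    ultimately have "inverse (ell2_norm x) * ell2_norm (T x) \<le> K" by (simp only:)
    moreover have "ell2_norm x > 0" using False ell2_norm_nonneg[OF x] by linarith
    ultimately show ?thesis by (simp add: field_simps)
  qed
  then show thesis using that K0 by blast
qed

lemma subseq_bounded:
  assumes s: "\<And>n. s n \<in> ell2" "\<And>n. ell2_norm (s n) \<le> B"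
  shows "\<exists>r::nat \<Rightarrow> nat. strict_mono r \<and> ell2_Cauchy (\<lambda>n. T (s (r n)))"
proof -
  define b where "b = max B 1"
  have b: "b > 0" "B \<le> b" by (auto simp: b_def)
  let ?c = "complex_of_real (inverse b)"
  have norm_le: "ell2_norm (\<lambda>k. ?c * s n k) \<le> 1" for n
  proof -
    have "ell2_norm (\<lambda>k. ?c * s n k) = inverse b * ell2_norm (s n)"
      unfolding ell2_scale(2)[OF s(1)] using b by (simp only: norm_of_real) simp
    also have "\<dots> \<le> 1" using s(2)[of n] b by (simp add: field_simps)
    finally show ?thesis .
  qed
  obtain r :: "nat \<Rightarrow> nat" where r: "strict_mono r" "ell2_Cauchy (\<lambda>n. T (\<lambda>k. ?c * s (r n) k))"
    using subseq[of "\<lambda>n k. ?c * s n k"] ell2_scale(1)[OF s(1)] norm_le by blast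
  have "ell2_Cauchy (\<lambda>n. T (s (r n)))"
    unfolding ell2_Cauchy_def
  proof (intro allI impI)
    fix e :: real assume "e > 0"
    then have "e / b > 0" using b by simp
    then obtain N where N: "\<forall>m\<ge>N. \<forall>n\<ge>N. ell2_norm (\<lambda>k. T (\<lambda>k. ?c * s (r m) k) k - T (\<lambda>k. ?c * s (r n) k) k) < e / b"
      using r(2) unfolding ell2_Cauchy_def by blast
    have "ell2_norm (\<lambda>k. T (\<lambda>k. ?c * s (r m) k) k - T (\<lambda>k. ?c * s (r n) k) k)
        = inverse b * ell2_norm (\<lambda>k. T (s (r m)) k - T (s (r n)) k)" for m n
      using ell2_scale(2)[OF ell2_diff(1)[OF mem_ell2[OF s(1)] mem_ell2[OF s(1)]], of ?c "r m" "r n"] b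
      by (simp only: scale[OF s(1)] right_diff_distrib norm_of_real) (simp add: abs_of_pos)
    then have "\<forall>m\<ge>N. \<forall>n\<ge>N. ell2_norm (\<lambda>k. T (s (r m)) k - T (s (r n)) k) < e"
      using N b by (simp add: field_simps)
    then show "\<exists>N. \<forall>m\<ge>N. \<forall>n\<ge>N. ell2_norm (\<lambda>k. T (s (r m)) k - T (s (r n)) k) < e" by blast
  qed
  then show ?thesis using r by blast
qed

end

lemma ell2_Cauchy_subseq: "\<lbrakk>ell2_Cauchy s; strict_mono r\<rbrakk> \<Longrightarrow> ell2_Cauchy (\<lambda>n. s (r n))"
  unfolding ell2_Cauchy_def by (meson order_trans seq_suble)

lemma ell2_Cauchy_le:
  assumes "ell2_Cauchy s" "ell2_Cauchy t"
    and ell2: "\<And>n. s n \<in> ell2" "\<And>n. t n \<in> ell2"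
    and le: "\<And>m n. ell2_norm (\<lambda>k. u m k - u n k)
      \<le> K * (ell2_norm (\<lambda>k. s m k - s n k) + ell2_norm (\<lambda>k. t m k - t n k))"
  shows "ell2_Cauchy u"
  using assms(1,2) ell2 unfolding ell2_Cauchy_def
  by (intro Cauchy_combine[OF _ _ _ _ le]) simp_all

lemma K_ops: "azero \<K> = (\<lambda>x\<in>ell2. \<lambda>_. 0)" "aadd \<K> S T = (\<lambda>x\<in>ell2. \<lambda>n. S x n + T x n)"
  "ascale \<K> c T = (\<lambda>x\<in>ell2. \<lambda>n. c * T x n)" "amult \<K> S T = compose ell2 S T"
  "elems \<K> = compact_operators"
  by (simp_all add: compact_operator_algebra_def)

lemma K_zero_closed: "azero \<K> \<in> compact_operators"
  unfolding K_ops compact_operators_iff using ell2_add(1) ell2_scale(1)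
  by (auto simp: ell2_Cauchy_def intro!: exI[of _ id] strict_mono_id)

lemma K_add_closed:
  assumes "S \<in> compact_operators" "T \<in> compact_operators"
  shows "aadd \<K> S T \<in> compact_operators"
proof -
  interpret S: compact_operator S by standard fact
  interpret T: compact_operator T by standard fact
  have "\<exists>r::nat \<Rightarrow> nat. strict_mono r \<and> ell2_Cauchy (\<lambda>n. aadd \<K> S T (s (r n)))"
    if s: "\<forall>n. s n \<in> ell2 \<and> ell2_norm (s n) \<le> 1" for s
  proof -
    obtain r :: "nat \<Rightarrow> nat" where r: "strict_mono r" "ell2_Cauchy (\<lambda>n. S (s (r n)))" using S.subseq s by blast
    obtain q :: "nat \<Rightarrow> nat" where q: "strict_mono q" "ell2_Cauchy (\<lambda>n. T (s (r (q n))))"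
      using T.subseq[of "\<lambda>n. s (r n)"] s by blast
    have "ell2_Cauchy (\<lambda>n. aadd \<K> S T (s (r (q n))))"
    proof (rule ell2_Cauchy_le[OF ell2_Cauchy_subseq[OF r(2) q(1)] q(2), of _ 1])
      show "S (s (r (q n))) \<in> ell2" "T (s (r (q n))) \<in> ell2" for n using s by simp_all
      fix m n
      let ?x = "s (r (q m))" and ?y = "s (r (q n))"
      have "ell2_norm (\<lambda>k. (S ?x k - S ?y k) + (T ?x k - T ?y k))
          \<le> ell2_norm (\<lambda>k. S ?x k - S ?y k) + ell2_norm (\<lambda>k. T ?x k - T ?y k)"
        using s by (intro ell2_add ell2_diff) auto
      then show "ell2_norm (\<lambda>k. aadd \<K> S T ?x k - aadd \<K> S T ?y k)
          \<le> 1 * (ell2_norm (\<lambda>k. S ?x k - S ?y k) + ell2_norm (\<lambda>k. T ?x k - T ?y k))"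
        using s by (simp add: K_ops algebra_simps)
    qed
    moreover have "strict_mono (\<lambda>n. r (q n))" using r q by (simp add: strict_mono_def)
    ultimately show ?thesis by blast
  qed
  then show ?thesis
    unfolding compact_operators_iff
    by (auto simp: K_ops ell2_add(1) ell2_scale(1) S.add S.scale T.add T.scale fun_eq_iff algebra_simps)
qed

lemma K_scale_closed:
  assumes "T \<in> compact_operators" shows "ascale \<K> c T \<in> compact_operators"
proof -
  interpret T: compact_operator T by standard fact
  have "\<exists>r::nat \<Rightarrow> nat. strict_mono r \<and> ell2_Cauchy (\<lambda>n. ascale \<K> c T (s (r n)))"
    if s: "\<forall>n. s n \<in> ell2 \<and> ell2_norm (s n) \<le> 1" for s
  proof -
    obtain r :: "nat \<Rightarrow> nat" where r: "strict_mono r" "ell2_Cauchy (\<lambda>n. T (s (r n)))" using T.subseq s by blast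
    have "ell2_Cauchy (\<lambda>n. ascale \<K> c T (s (r n)))"
    proof (rule ell2_Cauchy_le[OF r(2) r(2), of _ "cmod c"])
      show "T (s (r n)) \<in> ell2" "T (s (r n)) \<in> ell2" for n using s by simp_all
      fix m n
      let ?x = "s (r m)" and ?y = "s (r n)"
      have "ell2_norm (\<lambda>k. c * (T ?x k - T ?y k)) = cmod c * ell2_norm (\<lambda>k. T ?x k - T ?y k)"
        using s by (intro ell2_scale ell2_diff) auto
      then show "ell2_norm (\<lambda>k. ascale \<K> c T ?x k - ascale \<K> c T ?y k)
          \<le> cmod c * (ell2_norm (\<lambda>k. T ?x k - T ?y k) + ell2_norm (\<lambda>k. T ?x k - T ?y k))"
        using s by (simp add: K_ops algebra_simps)
    qed
    then show ?thesis using r by blast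
  qed
  then show ?thesis
    unfolding compact_operators_iff
    by (auto simp: K_ops ell2_add(1) ell2_scale(1) T.add T.scale fun_eq_iff algebra_simps)
qed

lemma K_mult_closed:
  assumes "S \<in> compact_operators" "T \<in> compact_operators"
  shows "amult \<K> S T \<in> compact_operators"
proof -
  interpret S: compact_operator S by standard fact
  interpret T: compact_operator T by standard fact
  obtain K where K: "0 \<le> K" "\<And>x. x \<in> ell2 \<Longrightarrow> ell2_norm (S x) \<le> K * ell2_norm x" using S.bounded by blast
  have "\<exists>r::nat \<Rightarrow> nat. strict_mono r \<and> ell2_Cauchy (\<lambda>n. amult \<K> S T (s (r n)))"
    if s: "\<forall>n. s n \<in> ell2 \<and> ell2_norm (s n) \<le> 1" for s
  proof -
    obtain r :: "nat \<Rightarrow> nat" where r: "strict_mono r" "ell2_Cauchy (\<lambda>n. T (s (r n)))" using T.subseq s by blast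
    have "ell2_Cauchy (\<lambda>n. amult \<K> S T (s (r n)))"
    proof (rule ell2_Cauchy_le[OF r(2) r(2), of _ K])
      show "T (s (r n)) \<in> ell2" "T (s (r n)) \<in> ell2" for n using s by simp_all
      fix m n
      let ?x = "s (r m)" and ?y = "s (r n)"
      have "ell2_norm (\<lambda>k. S (T ?x) k - S (T ?y) k) \<le> K * ell2_norm (\<lambda>k. T ?x k - T ?y k)"
        using K(2)[of "\<lambda>k. T ?x k - T ?y k"] s by (simp add: S.diff ell2_diff(1))
      moreover have "0 \<le> K * ell2_norm (\<lambda>k. T ?x k - T ?y k)" using K s by simp
      ultimately show "ell2_norm (\<lambda>k. amult \<K> S T ?x k - amult \<K> S T ?y k)
          \<le> K * (ell2_norm (\<lambda>k. T ?x k - T ?y k) + ell2_norm (\<lambda>k. T ?x k - T ?y k))"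
        using s by (simp add: K_ops compose_def algebra_simps)
    qed
    then show ?thesis using r by blast
  qed
  then show ?thesis
    unfolding compact_operators_iff
    by (auto simp: K_ops compose_def ell2_add(1) ell2_scale(1) S.add S.scale T.add T.scale)
qed

text \<open>
  The adjoint \<open>S\<close> of \<open>T\<close> is given by the conjugate transpose of its matrix. It is compact because
  \<open>\<parallel>S y\<parallel>\<^sup>2 = \<langle>T (S y), y\<rangle> \<le> \<parallel>T (S y)\<parallel> \<parallel>y\<parallel>\<close> and \<open>T S\<close> is compact.
\<close>

lemma (in compact_operator) adjoint_exists:
  "\<exists>S \<in> compact_operators. \<forall>x \<in> ell2. \<forall>y \<in> ell2. ell2_inner (T x) y = ell2_inner x (S y)"
proof -
  obtain K where K: "0 \<le> K" "\<And>x. x \<in> ell2 \<Longrightarrow> ell2_norm (T x) \<le> K * ell2_norm x" using bounded by blast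
  define s where "s = (\<lambda>y n. ell2_inner y (T (unit_vec n)))"
  have trunc: "ell2_inner (T (head_part N x)) y = (\<Sum>n<N. x n * cnj (s y n))" if y: "y \<in> ell2" for N x y
  proof (induction N)
    case 0
    then show ?case by (simp add: head_part_def zero ell2_inner_def)
  next
    case (Suc N)
    have e: "(\<lambda>n. x N * unit_vec N n) \<in> ell2" by (simp add: ell2_scale)
    have "head_part (Suc N) x = (\<lambda>n. head_part N x n + x N * unit_vec N n)"
      by (auto simp: head_part_def unit_vec_def less_Suc_eq)
    then have "T (head_part (Suc N) x) = (\<lambda>n. T (head_part N x) n + x N * T (unit_vec N) n)"
      using add[OF head_part_ell2(1) e] by (simp add: scale)
    then have "ell2_inner (T (head_part (Suc N) x)) y
        = ell2_inner (T (head_part N x)) y + x N * ell2_inner (T (unit_vec N)) y"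
      using y by (simp add: ell2_inner_add_left ell2_inner_scale_left ell2_scale)
    then show ?case
      using Suc ell2_inner_commute[of y "T (unit_vec N)"] y by (simp add: s_def)
  qed
  \<comment> \<open>Testing \<open>y\<close> against \<open>T\<close> applied to the initial segment of \<open>s y\<close> produces the square of its norm.\<close>
  have head: "head_norm (s y) N \<le> K * ell2_norm y" if y: "y \<in> ell2" for y N
  proof -
    let ?t = "head_part N (s y)" and ?h = "head_norm (s y) N"
    have "(\<Sum>n<N. s y n * cnj (s y n)) = complex_of_real (\<Sum>n<N. (cmod (s y n))\<^sup>2)"
      by (simp only: of_real_sum complex_norm_square)
    also have "(\<Sum>n<N. (cmod (s y n))\<^sup>2) = ?h\<^sup>2" by (simp add: L2_set_def sum_nonneg)
    finally have "ell2_inner (T ?t) y = complex_of_real (?h\<^sup>2)" by (simp add: trunc[OF y])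
    then have "?h\<^sup>2 = cmod (ell2_inner (T ?t) y)" by (simp add: norm_power)
    also have "\<dots> \<le> ell2_norm (T ?t) * ell2_norm y" using y by (intro ell2_inner_sums) auto
    also have "\<dots> \<le> (K * ?h) * ell2_norm y"
      using K(2)[of ?t] mult_left_mono[OF head_part_ell2(2)[of N "s y"] K(1)] y
      by (intro mult_right_mono) auto
    finally have "?h * ?h \<le> (K * ell2_norm y) * ?h" by (simp add: power2_eq_square mult_ac)
    then show ?thesis
      using L2_set_nonneg[of "\<lambda>n. cmod (s y n)" "{..<N}"] K(1) y by (cases "?h = 0") auto
  qed
  note s_ell2 = ell2_boundedI[OF head]
  define S where "S = restrict s ell2"
  have S: "S y \<in> ell2" "ell2_norm (S y) \<le> K * ell2_norm y" if "y \<in> ell2" for y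
    using that s_ell2 by (auto simp: S_def)
  \<comment> \<open>For finitely supported \<open>x\<close> this is the definition of \<open>S\<close>; both sides are continuous in \<open>x\<close>.\<close>
  have adj: "ell2_inner (T x) y = ell2_inner x (S y)" if x: "x \<in> ell2" and y: "y \<in> ell2" for x y
  proof (rule LIMSEQ_unique)
    show "(\<lambda>N. ell2_inner (T (head_part N x)) y) \<longlonglongrightarrow> ell2_inner x (S y)"
      using ell2_inner_sums(1)[OF x S(1)[OF y]] y by (simp add: trunc S_def sums_def)
    have diff': "ell2_inner (T (head_part N x)) y - ell2_inner (T x) y
        = - ell2_inner (T (\<lambda>n. x n - head_part N x n)) y" for N
    proof -
      have "ell2_inner (T x) y = ell2_inner (T (\<lambda>n. x n - head_part N x n)) y + ell2_inner (T (head_part N x)) y"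
        using x y ell2_inner_add_left[of "T (\<lambda>n. x n - head_part N x n)" "T (head_part N x)" y]
        by (simp add: diff ell2_diff(1))
      then show ?thesis by simp
    qed
    have "(\<lambda>N. ell2_inner (T (head_part N x)) y - ell2_inner (T x) y) \<longlonglongrightarrow> 0"
    proof (rule Lim_null_comparison)
      have "norm (ell2_inner (T (head_part N x)) y - ell2_inner (T x) y)
          \<le> K * ell2_norm (\<lambda>n. x n - head_part N x n) * ell2_norm y" for N
      proof -
        let ?d = "\<lambda>n. x n - head_part N x n"
        have d: "?d \<in> ell2" using x by (simp add: ell2_diff)
        have "cmod (ell2_inner (T ?d) y) \<le> ell2_norm (T ?d) * ell2_norm y"
          using d y by (intro ell2_inner_sums) auto
        also have "\<dots> \<le> K * ell2_norm ?d * ell2_norm y" using K(2)[OF d] y by (intro mult_right_mono) auto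
        finally show ?thesis by (simp add: diff')
      qed
      then show "\<forall>\<^sub>F N in sequentially. norm (ell2_inner (T (head_part N x)) y - ell2_inner (T x) y)
          \<le> K * ell2_norm (\<lambda>n. x n - head_part N x n) * ell2_norm y" by simp
      show "(\<lambda>N. K * ell2_norm (\<lambda>n. x n - head_part N x n) * ell2_norm y) \<longlonglongrightarrow> 0"
        using tendsto_mult_right_zero[OF tendsto_mult_left_zero[OF head_part_tendsto[OF x]]]
        by (intro tendsto_mult_left_zero tendsto_mult_right_zero head_part_tendsto x)
    qed
    then show "(\<lambda>N. ell2_inner (T (head_part N x)) y) \<longlonglongrightarrow> ell2_inner (T x) y"
      by (simp add: LIM_zero_iff)
  qed
  have S_add: "S (\<lambda>n. x n + y n) = (\<lambda>n. S x n + S y n)" if "x \<in> ell2" "y \<in> ell2" for x y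
    using that by (simp add: S_def s_def ell2_add ell2_inner_add_left)
  have S_scale: "S (\<lambda>n. c * x n) = (\<lambda>n. c * S x n)" if "x \<in> ell2" for c x
    using that by (simp add: S_def s_def ell2_scale ell2_inner_scale_left)
  have S_diff: "S (\<lambda>n. x n - y n) = (\<lambda>n. S x n - S y n)" if "x \<in> ell2" "y \<in> ell2" for x y
    using S_add[of x "\<lambda>n. (-1) * y n"] S_scale[of y "-1"] ell2_scale(1)[of y "-1"] that by simp
  have "\<exists>r::nat \<Rightarrow> nat. strict_mono r \<and> ell2_Cauchy (\<lambda>n. S (y (r n)))"
    if y: "\<forall>n. y n \<in> ell2 \<and> ell2_norm (y n) \<le> 1" for y
  proof -
    have "ell2_norm (S (y n)) \<le> K" for n
      using S(2)[of "y n"] y mult_left_mono[of "ell2_norm (y n)" 1 K] K(1) by force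
    then obtain r :: "nat \<Rightarrow> nat" where r: "strict_mono r" and C: "ell2_Cauchy (\<lambda>n. T (S (y (r n))))"
      using subseq_bounded[of "\<lambda>n. S (y n)" K] S(1) y by blast
    have sq: "(ell2_norm (\<lambda>k. S (y m) k - S (y n) k))\<^sup>2
        \<le> 2 * ell2_norm (\<lambda>k. T (S (y m)) k - T (S (y n)) k)" for m n
    proof -
      let ?d = "\<lambda>k. y m k - y n k"
      have "ell2_norm (y m) \<le> 1" "ell2_norm (y n) \<le> 1" using y by auto
      moreover have "ell2_norm ?d \<le> ell2_norm (y m) + ell2_norm (y n)" using y by (intro ell2_diff) auto
      ultimately have d: "?d \<in> ell2" "ell2_norm ?d \<le> 2" using y by (simp, linarith)
      have "complex_of_real ((ell2_norm (S ?d))\<^sup>2) = ell2_inner (T (S ?d)) ?d"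
        using d S by (simp add: adj ell2_inner_self)
      then have "(ell2_norm (S ?d))\<^sup>2 = cmod (ell2_inner (T (S ?d)) ?d)"
        by (metis norm_of_real abs_of_nonneg zero_le_power2)
      also have "\<dots> \<le> ell2_norm (T (S ?d)) * ell2_norm ?d" using d S by (intro ell2_inner_sums) auto
      also have "\<dots> \<le> ell2_norm (T (S ?d)) * 2" using d S by (intro mult_left_mono) auto
      finally show ?thesis using y S by (simp add: S_diff diff)
    qed
    have "ell2_Cauchy (\<lambda>n. S (y (r n)))"
      unfolding ell2_Cauchy_def
    proof (intro allI impI)
      fix e :: real assume e: "e > 0"
      then obtain N where N: "\<forall>m\<ge>N. \<forall>n\<ge>N. ell2_norm (\<lambda>k. T (S (y (r m))) k - T (S (y (r n))) k) < e\<^sup>2 / 2"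
        using C unfolding ell2_Cauchy_def by (metis half_gt_zero zero_less_power)
      have "ell2_norm (\<lambda>k. S (y (r m)) k - S (y (r n)) k) < e" if "m \<ge> N" "n \<ge> N" for m n
      proof -
        have "(ell2_norm (\<lambda>k. S (y (r m)) k - S (y (r n)) k))\<^sup>2 < e\<^sup>2"
          using sq[of "r m" "r n"] N that by fastforce
        then show ?thesis using e by (simp add: power_less_imp_less_base)
      qed
      then show "\<exists>N. \<forall>m\<ge>N. \<forall>n\<ge>N. ell2_norm (\<lambda>k. S (y (r m)) k - S (y (r n)) k) < e" by blast
    qed
    then show ?thesis using r by blast
  qed
  then have "S \<in> compact_operators"
    unfolding compact_operators_iff using S(1) S_add S_scale by (auto simp: S_def)
  then show ?thesis using adj by blast
qed

lemma adjoint_unique: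
  assumes "S \<in> compact_operators" "S' \<in> compact_operators"
    and "\<And>x y. \<lbrakk>x \<in> ell2; y \<in> ell2\<rbrakk> \<Longrightarrow> ell2_inner x (S y) = ell2_inner x (S' y)"
  shows "S = S'"
proof -
  have "S y n = S' y n" if "y \<in> ell2" for y n
    using assms(3)[OF unit_vec_ell2 that, of n] by (simp add: ell2_inner_unit_vec)
  then show ?thesis
    using compact_operator.extensional[OF compact_operator.intro] assms(1,2)
    by (intro extensionalityI[of _ ell2] ext) auto
qed

text \<open>
  The involution is a definite description of the adjoint, which is meaningful because the adjoint
  exists and is unique.
\<close>

lemma star_K:
  assumes T: "T \<in> compact_operators"
  shows star_K_closed: "astar \<K> T \<in> compact_operators"
    and star_K_adjoint: "\<lbrakk>x \<in> ell2; y \<in> ell2\<rbrakk> \<Longrightarrow> ell2_inner (T x) y = ell2_inner x (astar \<K> T y)"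
proof -
  let ?P = "\<lambda>S. S \<in> compact_operators \<and> (\<forall>x\<in>ell2. \<forall>y\<in>ell2. ell2_inner (T x) y = ell2_inner x (S y))"
  obtain S where "?P S" using compact_operator.adjoint_exists[OF compact_operator.intro[OF T]] by blast
  then have "?P (THE S. ?P S)"
    by (intro theI[where P = ?P and a = S]) (auto intro!: adjoint_unique)
  then show "astar \<K> T \<in> compact_operators"
    "\<lbrakk>x \<in> ell2; y \<in> ell2\<rbrakk> \<Longrightarrow> ell2_inner (T x) y = ell2_inner x (astar \<K> T y)"
    by (auto simp: compact_operator_algebra_def)
qed

lemma star_K_eqI:
  assumes "T \<in> compact_operators" "S \<in> compact_operators"
    and "\<And>x y. \<lbrakk>x \<in> ell2; y \<in> ell2\<rbrakk> \<Longrightarrow> ell2_inner (T x) y = ell2_inner x (S y)"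
  shows "astar \<K> T = S"
  using assms star_K by (intro adjoint_unique) auto

lemma ell2_inner_add_right:
  "\<lbrakk>x \<in> ell2; y \<in> ell2; z \<in> ell2\<rbrakk> \<Longrightarrow> ell2_inner z (\<lambda>n. x n + y n) = ell2_inner z x + ell2_inner z y"
  by (simp add: ell2_inner_commute[of _ z] ell2_add ell2_inner_add_left)

lemma ell2_inner_scale_right:
  "\<lbrakk>x \<in> ell2; z \<in> ell2\<rbrakk> \<Longrightarrow> ell2_inner z (\<lambda>n. c * x n) = cnj c * ell2_inner z x"
  by (simp add: ell2_inner_commute[of _ z] ell2_scale ell2_inner_scale_left)

lemma K_mem: "\<lbrakk>T \<in> compact_operators; x \<in> ell2\<rbrakk> \<Longrightarrow> T x \<in> ell2"
  by (rule compact_operator.mem_ell2[OF compact_operator.intro])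

lemma K_extensional: "T \<in> compact_operators \<Longrightarrow> (\<lambda>x\<in>ell2. T x) = T"
  by (rule extensional_restrict[OF compact_operator.extensional[OF compact_operator.intro]])

lemma star_algebra_K: "star_algebra \<K>"
proof
  note [simp] = K_ops(5) K_add_closed K_scale_closed K_mult_closed star_K_closed K_mem
    ell2_add ell2_scale
  show "\<zero>\<^bsub>\<K>\<^esub> \<in> elems \<K>" by (simp add: K_zero_closed)
  fix S T assume S: "S \<in> elems \<K>" and T: "T \<in> elems \<K>"
  then have S': "S \<in> compact_operators" and T': "T \<in> compact_operators" by simp_all
  note addS = compact_operator.add[OF compact_operator.intro[OF S']]
    and scaleS = compact_operator.scale[OF compact_operator.intro[OF S']]
  show "\<zero>\<^bsub>\<K>\<^esub> \<oplus>\<^bsub>\<K>\<^esub> T = T"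
    using K_extensional[OF T'] by (simp add: K_ops cong: restrict_cong)
  show "S \<oplus>\<^bsub>\<K>\<^esub> T = T \<oplus>\<^bsub>\<K>\<^esub> S" by (simp add: K_ops add.commute)
  show "T \<oplus>\<^bsub>\<K>\<^esub> (-1) \<odot>\<^bsub>\<K>\<^esub> T = \<zero>\<^bsub>\<K>\<^esub>" by (simp add: K_ops restrict_def fun_eq_iff)
  show "1 \<odot>\<^bsub>\<K>\<^esub> T = T" using K_extensional[OF T'] by (simp add: K_ops)
  show "(c \<odot>\<^bsub>\<K>\<^esub> S) \<otimes>\<^bsub>\<K>\<^esub> T = c \<odot>\<^bsub>\<K>\<^esub> (S \<otimes>\<^bsub>\<K>\<^esub> T)" for c
    using T' by (simp add: K_ops(1-4) compose_def restrict_def fun_eq_iff)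
  show "S \<otimes>\<^bsub>\<K>\<^esub> (c \<odot>\<^bsub>\<K>\<^esub> T) = c \<odot>\<^bsub>\<K>\<^esub> (S \<otimes>\<^bsub>\<K>\<^esub> T)" for c
    using T' by (simp add: K_ops(1-4) compose_def restrict_def fun_eq_iff scaleS)
  show "astar \<K> (astar \<K> T) = T"
  proof (rule star_K_eqI)
    fix x y assume x: "x \<in> ell2" and y: "y \<in> ell2"
    show "ell2_inner (astar \<K> T x) y = ell2_inner x (T y)"
      using star_K_adjoint[OF T' y x] ell2_inner_commute[of y "astar \<K> T x"]
        ell2_inner_commute[of "T y" x] T' x y by simp
  qed (use T' in simp_all)
  show "astar \<K> (S \<oplus>\<^bsub>\<K>\<^esub> T) = astar \<K> S \<oplus>\<^bsub>\<K>\<^esub> astar \<K> T"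
    using S' T' by (intro star_K_eqI)
      (simp_all, simp add: K_ops ell2_inner_add_left ell2_inner_add_right star_K_adjoint)
  show "astar \<K> (c \<odot>\<^bsub>\<K>\<^esub> T) = cnj c \<odot>\<^bsub>\<K>\<^esub> astar \<K> T" for c
    using T' by (intro star_K_eqI)
      (simp_all, simp add: K_ops ell2_inner_scale_left ell2_inner_scale_right star_K_adjoint)
  show "astar \<K> (S \<otimes>\<^bsub>\<K>\<^esub> T) = astar \<K> T \<otimes>\<^bsub>\<K>\<^esub> astar \<K> S"
    using S' T' by (intro star_K_eqI)
      (simp_all, simp add: K_ops compose_def star_K_adjoint)
  fix R assume R: "R \<in> elems \<K>"
  then have R': "R \<in> compact_operators" by simp
  show "R \<otimes>\<^bsub>\<K>\<^esub> S \<otimes>\<^bsub>\<K>\<^esub> T = R \<otimes>\<^bsub>\<K>\<^esub> (S \<otimes>\<^bsub>\<K>\<^esub> T)"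
    using T' by (simp add: K_ops(1-4) compose_def restrict_def fun_eq_iff)
  show "(R \<oplus>\<^bsub>\<K>\<^esub> S) \<otimes>\<^bsub>\<K>\<^esub> T = R \<otimes>\<^bsub>\<K>\<^esub> T \<oplus>\<^bsub>\<K>\<^esub> S \<otimes>\<^bsub>\<K>\<^esub> T"
    using T' by (simp add: K_ops(1-4) compose_def restrict_def fun_eq_iff)
  show "S \<otimes>\<^bsub>\<K>\<^esub> (R \<oplus>\<^bsub>\<K>\<^esub> T) = S \<otimes>\<^bsub>\<K>\<^esub> R \<oplus>\<^bsub>\<K>\<^esub> S \<otimes>\<^bsub>\<K>\<^esub> T"
    using R' T' by (simp add: K_ops(1-4) compose_def restrict_def fun_eq_iff addS)
qed (auto simp: K_ops(5) K_add_closed K_scale_closed K_mult_closed star_K_closed,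
    auto simp: K_ops restrict_def fun_eq_iff algebra_simps)

text \<open>
  The norm is a supremum of nonnegative numbers, finite since compact operators are bounded.
\<close>

lemma K_norm_nonneg: assumes "T \<in> elems \<K>" shows "0 \<le> anorm \<K> T"
proof -
  interpret T: compact_operator T by standard (use assms in \<open>simp add: K_ops\<close>)
  obtain K where K: "0 \<le> K" "\<And>x. x \<in> ell2 \<Longrightarrow> ell2_norm (T x) \<le> K * ell2_norm x" using T.bounded by blast
  have "ell2_norm (T x) \<le> K" if "x \<in> ell2" "ell2_norm x \<le> 1" for x
    using K(2)[OF that(1)] mult_left_mono[OF that(2) K(1)] by simp
  then have "ell2_norm (T (\<lambda>_. 0)) \<le> (SUP x\<in>{x \<in> ell2. ell2_norm x \<le> 1}. ell2_norm (T x))"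
    by (intro cSUP_upper bdd_aboveI2) auto
  then show ?thesis by (simp add: compact_operator_algebra_def T.zero)
qed

section \<open>Coarse spaces at infinity\<close>

text \<open>
  Vanishing at infinity and vanishing variation are both limits along filters: the filter of
  complements of bounded sets, and its pullback to an entourage along the first projection.
\<close>

definition at_coarse_infinity :: "'x coarse_data \<Rightarrow> 'x filter"
  where "at_coarse_infinity X = (INF B\<in>{B. coarsely_bounded X B}. principal (points X - B))"

definition pairs_at_infinity :: "'x coarse_data \<Rightarrow> ('x \<times> 'x) set \<Rightarrow> ('x \<times> 'x) filter"
  where "pairs_at_infinity X E =
    (INF B\<in>{B. coarsely_bounded X B}. principal {p \<in> E. fst p \<notin> B})"

locale coarse =
  fixes X :: "'x coarse_data"
  assumes coarse_space: "coarse_space X"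
begin

lemma locally_compact: "locally_compact_space (ctop X)"
  and Hausdorff: "Hausdorff_space (ctop X)"
  and compact_closure: "coarsely_bounded X B \<Longrightarrow> compactin (ctop X) (ctop X closure_of B)"
  using coarse_space unfolding coarse_space_def by meson+

lemma completely_regular: "completely_regular_space (ctop X)"
  using locally_compact_regular_imp_completely_regular_space locally_compact Hausdorff by blast

lemma coarse_structure: "coarse_structure (points X) (entourages X)"
  using coarse_space unfolding coarse_space_def by meson

lemma entourage_points: "E \<in> entourages X \<Longrightarrow> E \<subseteq> points X \<times> points X"
  using coarse_structure unfolding coarse_structure_def by meson

lemma entourage_subset: "\<lbrakk>E \<in> entourages X; E' \<subseteq> E\<rbrakk> \<Longrightarrow> E' \<in> entourages X"
  using coarse_structure unfolding coarse_structure_def by meson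

lemma entourage_Un: "\<lbrakk>E \<in> entourages X; E' \<in> entourages X\<rbrakk> \<Longrightarrow> E \<union> E' \<in> entourages X"
  using coarse_structure unfolding coarse_structure_def by meson

lemma entourage_converse: "E \<in> entourages X \<Longrightarrow> E\<inverse> \<in> entourages X"
  using coarse_structure unfolding coarse_structure_def by meson

lemma entourage_comp: "\<lbrakk>E \<in> entourages X; E' \<in> entourages X\<rbrakk> \<Longrightarrow> E O E' \<in> entourages X"
  using coarse_structure unfolding coarse_structure_def by meson

lemma entourage_Id: "Id_on (points X) \<in> entourages X"
  using coarse_structure unfolding coarse_structure_def by meson

lemma entourage_finite: "\<lbrakk>finite F; F \<subseteq> points X \<times> points X\<rbrakk> \<Longrightarrow> F \<in> entourages X"
  using coarse_structure unfolding coarse_structure_def by meson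

lemma bounded_points: "coarsely_bounded X B \<Longrightarrow> B \<subseteq> points X"
  unfolding coarsely_bounded_def using entourage_points by blast

lemma bounded_subset: "\<lbrakk>coarsely_bounded X B; B' \<subseteq> B\<rbrakk> \<Longrightarrow> coarsely_bounded X B'"
  unfolding coarsely_bounded_def by (meson Sigma_mono entourage_subset)

lemma bounded_Image:
  assumes "E \<in> entourages X" "coarsely_bounded X B" shows "coarsely_bounded X (E `` B)"
proof -
  have "E\<inverse> O (B \<times> B) O E \<in> entourages X"
    using assms by (auto simp: coarsely_bounded_def intro!: entourage_comp entourage_converse)
  then show ?thesis unfolding coarsely_bounded_def by (rule entourage_subset) auto
qed

lemma bounded_empty: "coarsely_bounded X {}"
  unfolding coarsely_bounded_def by (auto intro: entourage_finite)

lemma bounded_singleton: "x \<in> points X \<Longrightarrow> coarsely_bounded X {x}"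
  unfolding coarsely_bounded_def by (auto intro: entourage_finite)

text \<open>
  Any point of \<open>B\<close> can be joined to any point of \<open>B'\<close> by way of two fixed points \<open>b\<close> and \<open>b'\<close>, since
  the singleton of \<open>(b, b')\<close> is an entourage.
\<close>

lemma bounded_Un:
  assumes B: "coarsely_bounded X B" "coarsely_bounded X B'" shows "coarsely_bounded X (B \<union> B')"
proof (cases "B = {} \<or> B' = {}")
  case True then show ?thesis using assms by auto
next
  case False
  then obtain b b' where b: "b \<in> B" "b' \<in> B'" by blast
  have "{(b, b')} \<in> entourages X" using b B bounded_points by (intro entourage_finite) auto
  then have "(B \<times> B) O {(b, b')} O (B' \<times> B') \<in> entourages X" (is "?E \<in> _")
    using B by (auto simp: coarsely_bounded_def intro!: entourage_comp)
  then have "(B \<times> B \<union> B' \<times> B') \<union> (?E \<union> ?E\<inverse>) \<in> entourages X"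
    using B unfolding coarsely_bounded_def by (intro entourage_Un entourage_converse)
  then show ?thesis
    unfolding coarsely_bounded_def by (rule entourage_subset) (use b in blast)
qed

lemma bounded_UN: "\<lbrakk>finite F; \<And>i. i \<in> F \<Longrightarrow> coarsely_bounded X (N i)\<rbrakk> \<Longrightarrow> coarsely_bounded X (\<Union>i\<in>F. N i)"
  by (induction F rule: finite_induct) (auto simp: bounded_empty bounded_Un)

lemma diagonal_neighbourhood:
  obtains E U where "E \<in> entourages X" "openin (prod_topology (ctop X) (ctop X)) U"
    "Id_on (points X) \<subseteq> U" "U \<subseteq> E"
  using coarse_space unfolding coarse_space_def by meson

text \<open>
  A neighbourhood of the diagonal that is an entourage contains \<open>N \<times> N\<close> for some neighbourhood \<open>N\<close> of
  each point, so that points have bounded neighbourhoods, and finitely many of these cover \<open>K\<close>.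
\<close>

lemma compact_bounded: assumes K: "compactin (ctop X) K" shows "coarsely_bounded X K"
proof -
  obtain E U where EU: "E \<in> entourages X" "openin (prod_topology (ctop X) (ctop X)) U"
    "Id_on (points X) \<subseteq> U" "U \<subseteq> E" by (rule diagonal_neighbourhood)
  have "\<exists>N. openin (ctop X) N \<and> x \<in> N \<and> coarsely_bounded X N" if x: "x \<in> points X" for x
  proof -
    have "(x, x) \<in> U" using x EU(3) by auto
    then obtain N N' where N: "openin (ctop X) N" "openin (ctop X) N'" "x \<in> N" "x \<in> N'" "N \<times> N' \<subseteq> U"
      using EU(2) unfolding openin_prod_topology_alt by meson
    have "(N \<inter> N') \<times> (N \<inter> N') \<subseteq> E" using N EU by blast
    then have "coarsely_bounded X (N \<inter> N')"
      unfolding coarsely_bounded_def using EU(1) entourage_subset by blast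
    then show ?thesis using N by (intro exI[of _ "N \<inter> N'"]) auto
  qed
  then obtain N where N: "\<And>x. x \<in> points X \<Longrightarrow> openin (ctop X) (N x) \<and> x \<in> N x \<and> coarsely_bounded X (N x)"
    by metis
  have KX: "K \<subseteq> points X" using K compactin_subset_topspace by blast
  have "\<exists>\<F>. finite \<F> \<and> \<F> \<subseteq> N ` K \<and> K \<subseteq> \<Union>\<F>"
    using K[unfolded compactin_def, THEN conjunct2, THEN spec, of "N ` K"] N KX by blast
  then obtain F where F: "finite F" "F \<subseteq> K" "K \<subseteq> (\<Union>x\<in>F. N x)"
    by (metis finite_subset_image)
  have "coarsely_bounded X (\<Union>x\<in>F. N x)" using F N KX by (intro bounded_UN) auto
  then show ?thesis using F(3) by (rule bounded_subset)
qed

lemma bounded_closed_compact: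
  "\<lbrakk>coarsely_bounded X B; closedin (ctop X) B\<rbrakk> \<Longrightarrow> compactin (ctop X) B"
  using compact_closure[of B] by (simp add: closure_of_closedin)

lemma eventually_at_coarse_infinity:
  "eventually P (at_coarse_infinity X) \<longleftrightarrow> (\<exists>B. coarsely_bounded X B \<and> (\<forall>x\<in>points X - B. P x))"
  unfolding at_coarse_infinity_def
proof (subst eventually_INF_base)
  show "{B. coarsely_bounded X B} \<noteq> {}" using bounded_empty by blast
  fix B B' assume "B \<in> {B. coarsely_bounded X B}" "B' \<in> {B. coarsely_bounded X B}"
  then show "\<exists>C\<in>{B. coarsely_bounded X B}.
      principal (points X - C) \<le> inf (principal (points X - B)) (principal (points X - B'))"
    by (intro bexI[of _ "B \<union> B'"]) (auto simp: bounded_Un)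
qed (auto simp: eventually_principal)

lemma eventually_pairs_at_infinity:
  "eventually P (pairs_at_infinity X E) \<longleftrightarrow>
    (\<exists>B. coarsely_bounded X B \<and> (\<forall>x y. (x, y) \<in> E \<longrightarrow> x \<notin> B \<longrightarrow> P (x, y)))"
  unfolding pairs_at_infinity_def
proof (subst eventually_INF_base)
  show "{B. coarsely_bounded X B} \<noteq> {}" using bounded_empty by blast
  fix B B' assume "B \<in> {B. coarsely_bounded X B}" "B' \<in> {B. coarsely_bounded X B}"
  then show "\<exists>C\<in>{B. coarsely_bounded X B}. principal {p \<in> E. fst p \<notin> C}
      \<le> inf (principal {p \<in> E. fst p \<notin> B}) (principal {p \<in> E. fst p \<notin> B'})"
    by (intro bexI[of _ "B \<union> B'"]) (auto simp: bounded_Un)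
qed (auto simp: eventually_principal)

lemma eventually_at_coarse_infinity_iff:
  "eventually P (at_coarse_infinity X) \<longleftrightarrow> coarsely_bounded X {x \<in> points X. \<not> P x}"
  unfolding eventually_at_coarse_infinity by (auto elim!: bounded_subset)

lemma eventually_points: "eventually (\<lambda>x. x \<in> points X) (at_coarse_infinity X)"
  unfolding eventually_at_coarse_infinity using bounded_empty by blast

lemma eventually_pairs: "eventually (\<lambda>p. p \<in> E) (pairs_at_infinity X E)"
  unfolding eventually_pairs_at_infinity using bounded_empty by blast

lemma filterlim_fst:
  assumes "E \<in> entourages X" shows "filterlim fst (at_coarse_infinity X) (pairs_at_infinity X E)"
  unfolding filterlim_iff eventually_at_coarse_infinity eventually_pairs_at_infinity
  using entourage_points[OF assms] by fastforce

lemma filterlim_snd: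
  assumes "E \<in> entourages X" shows "filterlim snd (at_coarse_infinity X) (pairs_at_infinity X E)"
  unfolding filterlim_iff eventually_at_coarse_infinity eventually_pairs_at_infinity
proof safe
  fix P B assume B: "coarsely_bounded X B" and P: "\<forall>x\<in>points X - B. P x"
  have "coarsely_bounded X (E\<inverse> `` B)" using assms B by (intro bounded_Image entourage_converse)
  then show "\<exists>B. coarsely_bounded X B \<and> (\<forall>x y. (x, y) \<in> E \<longrightarrow> x \<notin> B \<longrightarrow> P (snd (x, y)))"
    using P entourage_points[OF assms] by (intro exI[of _ "E\<inverse> `` B"]) auto
qed

lemma vanishes_at_infinity_iff:
  assumes "\<And>x. 0 \<le> u x"
  shows "vanishes_at_infinity X (\<lambda>x. ennreal (u x)) \<longleftrightarrow> (u \<longlongrightarrow> 0) (at_coarse_infinity X)"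
proof -
  have "(u \<longlongrightarrow> 0) (at_coarse_infinity X) \<longleftrightarrow> (\<forall>e>0. \<forall>\<^sub>F x in at_coarse_infinity X. u x < e)"
    using assms by (simp add: tendsto_iff)
  then show ?thesis
    unfolding vanishes_at_infinity_def eventually_at_coarse_infinity_iff
    using assms by (simp add: ennreal_le_iff not_less)
qed

end

section \<open>Functions of vanishing variation\<close>

lemma tendsto_0_le:
  fixes u v :: "'i \<Rightarrow> real"
  assumes "\<forall>\<^sub>F i in F. u i \<le> v i" "\<And>i. 0 \<le> u i" "(v \<longlongrightarrow> 0) F"
  shows "(u \<longlongrightarrow> 0) F"
  using assms by (intro tendsto_sandwich[OF _ assms(1) tendsto_const assms(3)]) simp

locale function_algebra = coarse X + cstar_algebra A
  for X :: "'x coarse_data" and A :: "'a normed_star_algebra" (structure)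
begin

abbreviation V where "V \<equiv> vv_functions A X"
abbreviation C0 where "C0 \<equiv> C0_functions A (ctop X)"

abbreviation continuous_function :: "('x \<Rightarrow> 'a) \<Rightarrow> bool"
  where "continuous_function \<equiv> continuous_map (ctop X) (algebra_topology A)"

lemma adist_eq: "\<lbrakk>a \<in> elems A; b \<in> elems A\<rbrakk> \<Longrightarrow> adist A a b = anorm A (a \<ominus> b)"
  by (simp add: adist_def)

lemma eventually_points_atin: "eventually (\<lambda>y. y \<in> points X) (atin (ctop X) x)"
  by (auto simp: eventually_atin)

lemma continuous_function_iff:
  assumes "\<And>x. x \<in> points X \<Longrightarrow> f x \<in> elems A"
  shows "continuous_function f \<longleftrightarrow>
    (\<forall>x \<in> points X. ((\<lambda>y. adist A (f y) (f x)) \<longlongrightarrow> 0) (atin (ctop X) x))"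
  using assms eventually_mono[OF eventually_points_atin]
  by (simp add: algebra_topology_def continuous_map_atin metric.limitin_metric_dist_null)

lemma continuous_functionD:
  "\<lbrakk>f \<in> points X \<rightarrow> elems A; continuous_function f; x \<in> points X\<rbrakk>
    \<Longrightarrow> ((\<lambda>y. adist A (f y) (f x)) \<longlongrightarrow> 0) (atin (ctop X) x)"
  using continuous_function_iff[of f] by (simp add: Pi_iff)

lemma vanishing_variation_iff:
  "vanishing_variation A X f \<longleftrightarrow> (\<forall>E \<in> entourages X.
    ((\<lambda>p. adist A (f (fst p)) (f (snd p))) \<longlongrightarrow> 0) (pairs_at_infinity X E))"
proof -
  have *: "vanishes_at_infinity X (variation A E f) \<longleftrightarrow>
      ((\<lambda>p. adist A (f (fst p)) (f (snd p))) \<longlongrightarrow> 0) (pairs_at_infinity X E)" (is "?L \<longleftrightarrow> ?R")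
    if E: "E \<in> entourages X" for E
  proof
    assume L: ?L
    show ?R
      unfolding tendsto_iff eventually_pairs_at_infinity
    proof (intro allI impI)
      fix e :: real assume e: "e > 0"
      let ?B = "{x \<in> points X. ennreal e \<le> variation A E f x}"
      have "adist A (f x) (f y) < e" if "(x, y) \<in> E" "x \<notin> ?B" for x y
      proof -
        have "ennreal (adist A (f x) (f y)) \<le> variation A E f x"
          unfolding variation_def using that by (intro SUP_upper) auto
        also have "\<dots> < ennreal e" using that entourage_points[OF E] by (auto simp: not_le)
        finally show ?thesis by (simp add: ennreal_less_iff)
      qed
      then show "\<exists>B. coarsely_bounded X B \<and> (\<forall>x y. (x, y) \<in> E \<longrightarrow> x \<notin> B \<longrightarrow>
          dist (adist A (f (fst (x, y))) (f (snd (x, y)))) 0 < e)"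
        using L e unfolding vanishes_at_infinity_def by (intro exI[of _ ?B]) auto
    qed
  next
    assume R: ?R
    show ?L
      unfolding vanishes_at_infinity_def
    proof (intro allI impI)
      fix e :: real assume e: "e > 0"
      then obtain B where B: "coarsely_bounded X B"
        "\<And>x y. \<lbrakk>(x, y) \<in> E; x \<notin> B\<rbrakk> \<Longrightarrow> adist A (f x) (f y) < e/2"
        using tendstoD[OF R, of "e/2"] unfolding eventually_pairs_at_infinity by auto
      \<comment> \<open>Strictness is lost in the supremum, hence the factor \<open>1/2\<close>.\<close>
      have "variation A E f x < ennreal e" if "x \<notin> B" for x
      proof -
        have "variation A E f x \<le> ennreal (e/2)"
          unfolding variation_def using B(2) that by (intro SUP_least ennreal_leI less_imp_le) auto
        also have "\<dots> < ennreal e" using e by (intro ennreal_lessI) auto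
        finally show ?thesis .
      qed
      then have "{x \<in> points X. ennreal e \<le> variation A E f x} \<subseteq> B" using not_le by blast
      then show "coarsely_bounded X {x \<in> points X. ennreal e \<le> variation A E f x}"
        using B(1) bounded_subset by blast
    qed
  qed
  then show ?thesis by (simp add: vanishing_variation_def)
qed

lemma mem_V_iff: "f \<in> elems V \<longleftrightarrow> f \<in> points X \<rightarrow>\<^sub>E elems A \<and> continuous_function f \<and>
    (\<exists>C. \<forall>x \<in> points X. anorm A (f x) \<le> C) \<and> vanishing_variation A X f"
  by (simp add: vv_functions_def)

lemma V_mem [simp]: "\<lbrakk>f \<in> elems V; x \<in> points X\<rbrakk> \<Longrightarrow> f x \<in> elems A"
  by (auto simp: mem_V_iff)

lemma V_funcset: "f \<in> elems V \<Longrightarrow> f \<in> points X \<rightarrow> elems A"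
  and V_continuous: "f \<in> elems V \<Longrightarrow> continuous_function f"
  by (auto simp: mem_V_iff)

lemma V_restrict: "f \<in> elems V \<Longrightarrow> (\<lambda>x\<in>points X. f x) = f"
  by (auto simp: mem_V_iff PiE_def extensional_restrict)

lemma V_bounded: assumes "f \<in> elems V" obtains C where "0 \<le> C" "\<And>x. x \<in> points X \<Longrightarrow> anorm A (f x) \<le> C"
proof -
  obtain C where "\<forall>x\<in>points X. anorm A (f x) \<le> C" using assms by (auto simp: mem_V_iff)
  then show thesis by (intro that[of "max C 0"]) auto
qed

lemma V_variation: "\<lbrakk>f \<in> elems V; E \<in> entourages X\<rbrakk>
    \<Longrightarrow> ((\<lambda>p. adist A (f (fst p)) (f (snd p))) \<longlongrightarrow> 0) (pairs_at_infinity X E)"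
  by (simp add: mem_V_iff vanishing_variation_iff)

lemma V_ops: "azero V = (\<lambda>x\<in>points X. \<zero>)" "aadd V f g = (\<lambda>x\<in>points X. f x \<oplus> g x)"
  "ascale V c f = (\<lambda>x\<in>points X. c \<odot> f x)" "amult V f g = (\<lambda>x\<in>points X. f x \<otimes> g x)"
  "astar V f = (\<lambda>x\<in>points X. astar A (f x))"
  by (simp_all add: vv_functions_def)

lemma diff_V: "adiff V f g = (\<lambda>x\<in>points X. f x \<ominus> g x)"
  by (simp add: adiff_def V_ops cong: restrict_cong)

lemma continuous_function_combine:
  assumes f: "f \<in> points X \<rightarrow> elems A" "continuous_function f"
    and g: "g \<in> points X \<rightarrow> elems A" "continuous_function g"
    and h: "h \<in> points X \<rightarrow> elems A"
    and le: "\<And>x y. \<lbrakk>x \<in> points X; y \<in> points X\<rbrakk>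
      \<Longrightarrow> adist A (h x) (h y) \<le> K * (adist A (f x) (f y) + adist A (g x) (g y))"
  shows "continuous_function h"
proof (subst continuous_function_iff)
  show "\<forall>x\<in>points X. ((\<lambda>y. adist A (h y) (h x)) \<longlongrightarrow> 0) (atin (ctop X) x)"
  proof (intro ballI, rule tendsto_0_le)
    fix x assume x: "x \<in> points X"
    show "\<forall>\<^sub>F y in atin (ctop X) x. adist A (h y) (h x) \<le> K * (adist A (f y) (f x) + adist A (g y) (g x))"
      using eventually_points_atin by eventually_elim (simp add: le x)
    have "((\<lambda>y. K * (adist A (f y) (f x) + adist A (g y) (g x))) \<longlongrightarrow> K * (0 + 0)) (atin (ctop X) x)"
      using f g x by (intro tendsto_intros continuous_functionD)
    then show "((\<lambda>y. K * (adist A (f y) (f x) + adist A (g y) (g x))) \<longlongrightarrow> 0) (atin (ctop X) x)"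
      by simp
  qed simp
qed (use h in auto)

text \<open>
  Closure of the function algebra under the algebraic operations is reduced to a Lipschitz estimate,
  which controls continuity and variation at once.
\<close>

lemma V_combine:
  assumes f: "f \<in> elems V" and g: "g \<in> elems V" and h: "h \<in> points X \<rightarrow>\<^sub>E elems A"
    and bound: "\<And>x. x \<in> points X \<Longrightarrow> anorm A (h x) \<le> C"
    and le: "\<And>x y. \<lbrakk>x \<in> points X; y \<in> points X\<rbrakk>
      \<Longrightarrow> adist A (h x) (h y) \<le> K * (adist A (f x) (f y) + adist A (g x) (g y))"
  shows "h \<in> elems V"
  unfolding mem_V_iff vanishing_variation_iff
proof (intro conjI h ballI)
  show "continuous_function h"
    by (rule continuous_function_combine[OF V_funcset[OF f] V_continuous[OF f] V_funcset[OF g]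
          V_continuous[OF g] _ le]) (use h in auto)
  show "\<exists>C. \<forall>x\<in>points X. anorm A (h x) \<le> C" using bound by blast
  fix E assume E: "E \<in> entourages X"
  show "((\<lambda>p. adist A (h (fst p)) (h (snd p))) \<longlongrightarrow> 0) (pairs_at_infinity X E)"
  proof (rule tendsto_0_le)
    show "\<forall>\<^sub>F p in pairs_at_infinity X E. adist A (h (fst p)) (h (snd p))
        \<le> K * (adist A (f (fst p)) (f (snd p)) + adist A (g (fst p)) (g (snd p)))"
      using eventually_pairs by eventually_elim (use entourage_points[OF E] le in auto)
    have "((\<lambda>p. K * (adist A (f (fst p)) (f (snd p)) + adist A (g (fst p)) (g (snd p))))
        \<longlongrightarrow> K * (0 + 0)) (pairs_at_infinity X E)"
      using V_variation[OF f E] V_variation[OF g E] by (intro tendsto_intros)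
    then show "((\<lambda>p. K * (adist A (f (fst p)) (f (snd p)) + adist A (g (fst p)) (g (snd p))))
        \<longlongrightarrow> 0) (pairs_at_infinity X E)" by simp
  qed simp
qed

lemma V_closed:
  assumes f: "f \<in> elems V"
  shows "astar V f \<in> elems V" "ascale V c f \<in> elems V"
    "g \<in> elems V \<Longrightarrow> aadd V f g \<in> elems V" "g \<in> elems V \<Longrightarrow> amult V f g \<in> elems V"
proof -
  obtain B where B: "0 \<le> B" "\<And>x. x \<in> points X \<Longrightarrow> anorm A (f x) \<le> B" using V_bounded[OF f] by blast
  show "astar V f \<in> elems V"
    unfolding V_ops
    by (rule V_combine[OF f f, of _ B 1]) (use f B in \<open>auto simp: adist_eq norm_star norm_star_diff norm_nonneg\<close>)
  show "ascale V c f \<in> elems V"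
    unfolding V_ops
    by (rule V_combine[OF f f, of _ "cmod c * B" "cmod c"])
      (use f B in \<open>auto simp: adist_eq scale_diff norm_scale norm_nonneg mult_left_mono\<close>)
  assume g: "g \<in> elems V"
  obtain B' where B': "0 \<le> B'" "\<And>x. x \<in> points X \<Longrightarrow> anorm A (g x) \<le> B'" using V_bounded[OF g] by blast
  show "aadd V f g \<in> elems V"
    unfolding V_ops
  proof (rule V_combine[OF f g, of _ "B + B'" 1])
    show "anorm A ((\<lambda>x\<in>points X. f x \<oplus> g x) x) \<le> B + B'" if "x \<in> points X" for x
      using that f g B(2)[OF that] B'(2)[OF that] norm_triangle[of "f x" "g x"] by simp
  qed (use f g in \<open>auto simp: adist_eq norm_add_diff_add\<close>)
  show "amult V f g \<in> elems V"
    unfolding V_ops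
  proof (rule V_combine[OF f g, of _ "B * B'" "B + B'"])
    fix x assume x: "x \<in> points X"
    have "anorm A (f x) * anorm A (g x) \<le> B * B'"
      using x f g B B' by (intro mult_mono) (auto simp: norm_nonneg)
    then show "anorm A ((\<lambda>x\<in>points X. f x \<otimes> g x) x) \<le> B * B'"
      using x f g norm_mult[of "f x" "g x"] by simp
    fix y assume y: "y \<in> points X"
    have "anorm A (f x \<otimes> g x \<ominus> f y \<otimes> g y)
        \<le> anorm A (f x) * anorm A (g x \<ominus> g y) + anorm A (f x \<ominus> f y) * anorm A (g y)"
      using x y f g by (simp add: norm_mult_diff)
    also have "\<dots> \<le> (B + B') * anorm A (g x \<ominus> g y) + anorm A (f x \<ominus> f y) * (B + B')"
      using x y f g B(1) B'(1) B(2)[OF x] B'(2)[OF y]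
      by (intro add_mono mult_mono) (auto simp: norm_nonneg)
    finally show "adist A ((\<lambda>x\<in>points X. f x \<otimes> g x) x) ((\<lambda>x\<in>points X. f x \<otimes> g x) y)
        \<le> (B + B') * (adist A (f x) (f y) + adist A (g x) (g y))"
      using x y f g by (simp add: adist_eq algebra_simps)
  qed (use f g in auto)
qed

lemma star_algebra_V: "star_algebra V"
proof
  have 0: "adist A (\<zero>\<^bsub>V\<^esub> x) (\<zero>\<^bsub>V\<^esub> y) = 0" if "x \<in> points X" "y \<in> points X" for x y
    using that by (simp add: V_ops)
  show "\<zero>\<^bsub>V\<^esub> \<in> elems V"
    unfolding mem_V_iff vanishing_variation_iff
  proof (intro conjI ballI)
    show "continuous_function \<zero>\<^bsub>V\<^esub>"
    proof (subst continuous_function_iff)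
      show "\<forall>x\<in>points X. ((\<lambda>y. adist A (\<zero>\<^bsub>V\<^esub> y) (\<zero>\<^bsub>V\<^esub> x)) \<longlongrightarrow> 0) (atin (ctop X) x)"
        by (intro ballI tendsto_eventually eventually_mono[OF eventually_points_atin]) (simp add: 0)
    qed (simp add: V_ops)
    show "\<exists>C. \<forall>x\<in>points X. anorm A (\<zero>\<^bsub>V\<^esub> x) \<le> C"
      by (intro exI[of _ 0]) (simp add: V_ops norm_zero)
    show "((\<lambda>p. adist A (\<zero>\<^bsub>V\<^esub> (fst p)) (\<zero>\<^bsub>V\<^esub> (snd p))) \<longlongrightarrow> 0) (pairs_at_infinity X E)"
      if "E \<in> entourages X" for E
      by (intro tendsto_eventually eventually_mono[OF eventually_pairs])
        (use entourage_points[OF that] 0 in auto)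
  qed (simp add: V_ops)
  show "\<zero>\<^bsub>V\<^esub> \<oplus>\<^bsub>V\<^esub> f = f" if "f \<in> elems V" for f
    using that V_restrict[OF that] by (simp add: V_ops zero_add cong: restrict_cong)
  show "1 \<odot>\<^bsub>V\<^esub> f = f" if "f \<in> elems V" for f
    using that V_restrict[OF that] by (simp add: V_ops scale_one cong: restrict_cong)
  show "astar V (astar V f) = f" if "f \<in> elems V" for f
    using that V_restrict[OF that] by (simp add: V_ops star_star cong: restrict_cong)
qed (simp_all add: V_closed, auto simp: V_ops add_ac add_uminus scale_scale
    scale_add_left scale_add_right mult_assoc mult_add_left mult_add_right mult_scale_left
    mult_scale_right star_add star_scale star_mult intro!: restrict_ext)

lemma norm_V_le_iff:
  assumes f: "f \<in> elems V"
  shows "anorm V f \<le> r \<longleftrightarrow> 0 \<le> r \<and> (\<forall>x\<in>points X. anorm A (f x) \<le> r)"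
proof -
  obtain B where "\<And>x. x \<in> points X \<Longrightarrow> anorm A (f x) \<le> B" using V_bounded[OF f] by blast
  then have "bdd_above (insert 0 ((\<lambda>x. anorm A (f x)) ` points X))" by (simp add: bdd_aboveI2[of _ _ B])
  then show ?thesis by (simp add: vv_functions_def cSup_le_iff)
qed

lemma norm_V_nonneg: "f \<in> elems V \<Longrightarrow> 0 \<le> anorm V f"
  and norm_le_norm_V: "\<lbrakk>f \<in> elems V; x \<in> points X\<rbrakk> \<Longrightarrow> anorm A (f x) \<le> anorm V f"
  using norm_V_le_iff[of f "anorm V f"] by auto

lemma cstar_seminormed_V: "cstar_seminormed V"
proof (rule cstar_seminormedI[OF star_algebra_V])
  let ?P = "insert (\<lambda>_. 0) ((\<lambda>x f. anorm A (f x)) ` points X)"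
  have "cstar_seminorm V (\<lambda>f. SUP p\<in>?P. p f)"
  proof (rule cstar_seminorm_SUP[OF _ _ star_algebra_V])
    show "cstar_seminorm V p" if "p \<in> ?P" for p
      using that by (auto simp: cstar_seminorm_def V_ops norm_nonneg norm_triangle norm_scale norm_mult
          cstar_identity)
    fix f assume "f \<in> elems V"
    then obtain B where "0 \<le> B" "\<And>x. x \<in> points X \<Longrightarrow> anorm A (f x) \<le> B" using V_bounded by blast
    then show "bdd_above ((\<lambda>p. p f) ` ?P)" by (intro bdd_aboveI2[of _ _ B]) auto
  qed simp
  moreover have "(\<lambda>f. SUP p\<in>?P. p f) = anorm V" by (simp add: vv_functions_def image_image)
  ultimately show "cstar_seminorm V (anorm V)" by (simp only:)
qed

lemma V_uniform_limit:
  assumes g: "g \<in> points X \<rightarrow>\<^sub>E elems A"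
    and approx: "\<And>e. e > 0 \<Longrightarrow> \<exists>f \<in> elems V. \<forall>x \<in> points X. adist A (g x) (f x) \<le> e"
  shows "g \<in> elems V"
proof -
  \<comment> \<open>One estimate gives continuity, where \<open>v\<close> is constant, and vanishing variation, where \<open>u\<close> and \<open>v\<close> are the projections.\<close>
  have lim: "((\<lambda>i. adist A (g (u i)) (g (v i))) \<longlongrightarrow> 0) F"
    if uv: "\<forall>\<^sub>F i in F. u i \<in> points X \<and> v i \<in> points X"
      and f: "\<And>f. f \<in> elems V \<Longrightarrow> ((\<lambda>i. adist A (f (u i)) (f (v i))) \<longlongrightarrow> 0) F" for u v :: "'i \<Rightarrow> 'x" and F
  proof (rule tendstoI)
    fix e :: real assume e: "e > 0"
    then obtain f where fV: "f \<in> elems V" and fg: "\<forall>x \<in> points X. adist A (g x) (f x) \<le> e/4"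
      using approx[of "e/4"] by auto
    have "\<forall>\<^sub>F i in F. adist A (f (u i)) (f (v i)) < e/2"
      using order_tendstoD(2)[OF f[OF fV], of "e/2"] e by simp
    with uv show "\<forall>\<^sub>F i in F. dist (adist A (g (u i)) (g (v i))) 0 < e"
    proof eventually_elim
      fix i assume i: "u i \<in> points X \<and> v i \<in> points X" and lt: "adist A (f (u i)) (f (v i)) < e/2"
      have mem: "g (u i) \<in> elems A" "g (v i) \<in> elems A" "f (u i) \<in> elems A" "f (v i) \<in> elems A"
        using i g fV by auto
      have "adist A (g (u i)) (f (u i)) \<le> e/4" "adist A (f (v i)) (g (v i)) \<le> e/4"
        using fg i metric.commute by auto
      then show "dist (adist A (g (u i)) (g (v i))) 0 < e"
        using metric.triangle[OF mem(1,3,2)] metric.triangle[OF mem(3,4,2)] lt by simp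
    qed
  qed
  show ?thesis
    unfolding mem_V_iff vanishing_variation_iff
  proof (intro conjI ballI g)
    show "continuous_function g"
    proof (subst continuous_function_iff)
      show "\<forall>x\<in>points X. ((\<lambda>y. adist A (g y) (g x)) \<longlongrightarrow> 0) (atin (ctop X) x)"
        using eventually_mono[OF eventually_points_atin] continuous_function_iff
        by (intro ballI lim) (auto simp: mem_V_iff)
    qed (use g in auto)
    obtain f where f: "f \<in> elems V" "\<forall>x\<in>points X. adist A (g x) (f x) \<le> 1" using approx[of 1] by auto
    obtain B where B: "\<And>x. x \<in> points X \<Longrightarrow> anorm A (f x) \<le> B" using V_bounded[OF f(1)] by blast
    have "anorm A (g x) \<le> B + 1" if x: "x \<in> points X" for x
    proof -
      have mem: "g x \<in> elems A" "f x \<in> elems A" using g f x by auto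
      then have "anorm A (g x \<ominus> f x) \<le> 1" using f(2) x by (metis adist_eq)
      then show ?thesis using norm_triangle_diff[OF mem] B[OF x] by linarith
    qed
    then show "\<exists>C. \<forall>x\<in>points X. anorm A (g x) \<le> C" by blast
    fix E assume E: "E \<in> entourages X"
    show "((\<lambda>p. adist A (g (fst p)) (g (snd p))) \<longlongrightarrow> 0) (pairs_at_infinity X E)"
    proof (rule lim)
      show "\<forall>\<^sub>F p in pairs_at_infinity X E. fst p \<in> points X \<and> snd p \<in> points X"
        using eventually_pairs by eventually_elim (use entourage_points[OF E] in auto)
    qed (rule V_variation[OF _ E])
  qed
qed

lemma seminorm_complete_V: "seminorm_complete V"
  unfolding seminorm_complete_def
proof (intro allI impI)
  interpret V: cstar_seminormed V by (rule cstar_seminormed_V)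
  fix s assume s: "\<forall>n. s n \<in> elems V"
    and C: "\<forall>\<epsilon>>0. \<exists>N::nat. \<forall>m\<ge>N. \<forall>n\<ge>N. anorm V (adiff V (s m) (s n)) < \<epsilon>"
  have sA [simp]: "s n x \<in> elems A" if "x \<in> points X" for n x using s that by simp
  have pointwise: "anorm A (s m x \<ominus> s n x) \<le> anorm V (adiff V (s m) (s n))" if "x \<in> points X" for m n x
    using norm_le_norm_V[OF V.diff_closed[OF s[rule_format] s[rule_format]] that, of m n] that
    by (simp add: diff_V)
  have "\<exists>l \<in> elems A. (\<lambda>n. anorm A (s n x \<ominus> l)) \<longlonglongrightarrow> 0" if x: "x \<in> points X" for x
  proof (rule seminorm_completeD[OF seminorm_complete])
    fix e :: real assume "e > 0"
    then obtain N where "\<forall>m\<ge>N. \<forall>n\<ge>N. anorm V (adiff V (s m) (s n)) < e" using C by blast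
    then show "\<exists>N. \<forall>m\<ge>N. \<forall>n\<ge>N. anorm A (s m x \<ominus> s n x) < e"
      using pointwise[OF x] by (meson order.strict_trans1)
  qed (use x in simp)
  then obtain l where l: "\<And>x. x \<in> points X \<Longrightarrow> l x \<in> elems A"
    "\<And>x. x \<in> points X \<Longrightarrow> (\<lambda>n. anorm A (s n x \<ominus> l x)) \<longlonglongrightarrow> 0" by metis
  define g where "g = restrict l (points X)"
  have g: "g \<in> points X \<rightarrow>\<^sub>E elems A" using l by (auto simp: g_def)
  have close: "\<exists>N. \<forall>n\<ge>N. \<forall>x\<in>points X. anorm A (s n x \<ominus> g x) \<le> e" if e: "e > 0" for e
  proof -
    obtain N where N: "\<forall>m\<ge>N. \<forall>n\<ge>N. anorm V (adiff V (s m) (s n)) < e" using C e by blast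
    have "anorm A (s n x \<ominus> g x) \<le> e" if n: "n \<ge> N" and x: "x \<in> points X" for n x
    proof (rule LIMSEQ_le_const)
      show "(\<lambda>m. e + anorm A (s m x \<ominus> g x)) \<longlonglongrightarrow> e"
        using tendsto_add[OF tendsto_const l(2)[OF x], of e] x by (simp add: g_def)
      have "anorm A (s n x \<ominus> g x) \<le> e + anorm A (s m x \<ominus> g x)" if m: "m \<ge> N" for m
        using norm_diff_triangle[of "s n x" "s m x" "g x"] pointwise[OF x, of n m] N n m x l
        by (fastforce simp: g_def)
      then show "\<exists>N. \<forall>m\<ge>N. anorm A (s n x \<ominus> g x) \<le> e + anorm A (s m x \<ominus> g x)" by blast
    qed
    then show ?thesis by blast
  qed
  have gV: "g \<in> elems V"
  proof (rule V_uniform_limit[OF g])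
    fix e :: real assume "e > 0"
    then obtain N where N: "\<forall>n\<ge>N. \<forall>x\<in>points X. anorm A (s n x \<ominus> g x) \<le> e" using close by blast
    have "adist A (g x) (s N x) \<le> e" if "x \<in> points X" for x
      using N that g adist_eq[of "g x" "s N x"] norm_diff_commute[of "g x" "s N x"] by (auto simp: PiE_mem[OF g])
    then show "\<exists>f\<in>elems V. \<forall>x\<in>points X. adist A (g x) (f x) \<le> e" using s by blast
  qed
  have "(\<lambda>n. anorm V (adiff V (s n) g)) \<longlonglongrightarrow> 0"
  proof (rule LIMSEQ_I)
    fix e :: real assume e: "e > 0"
    then obtain N where N: "\<forall>n\<ge>N. \<forall>x\<in>points X. anorm A (s n x \<ominus> g x) \<le> e/2" using close[of "e/2"] by auto
    have "norm (anorm V (adiff V (s n) g) - 0) < e" if "n \<ge> N" for n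
    proof -
      have mem: "adiff V (s n) g \<in> elems V" using s gV by simp
      have "anorm V (adiff V (s n) g) \<le> e/2"
        unfolding norm_V_le_iff[OF mem] using N that e by (simp add: diff_V)
      then show ?thesis using norm_V_nonneg[OF mem] e by simp
    qed
    then show "\<exists>N. \<forall>n\<ge>N. norm (anorm V (adiff V (s n) g) - 0) < e" by blast
  qed
  then show "\<exists>a\<in>elems V. (\<lambda>n. anorm V (adiff V (s n) a)) \<longlonglongrightarrow> 0" using gV by (rule bexI)
qed

end

section \<open>The corona of a coarse space\<close>

context function_algebra
begin

lemma continuous_norm:
  assumes f: "f \<in> points X \<rightarrow> elems A" "continuous_function f"
  shows "continuous_map (ctop X) euclideanreal (\<lambda>x. anorm A (f x))"
  unfolding continuous_map_atin limitin_canonical_iff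
proof (intro ballI)
  fix x assume x: "x \<in> points X"
  have "((\<lambda>y. \<bar>anorm A (f y) - anorm A (f x)\<bar>) \<longlongrightarrow> 0) (atin (ctop X) x)"
  proof (rule tendsto_0_le[OF _ _ continuous_functionD[OF f x]])
    show "\<forall>\<^sub>F y in atin (ctop X) x. \<bar>anorm A (f y) - anorm A (f x)\<bar> \<le> adist A (f y) (f x)"
      using eventually_points_atin
      by eventually_elim (use f x in \<open>simp add: adist_eq abs_norm_diff_le Pi_iff\<close>)
  qed simp
  then have "((\<lambda>y. anorm A (f y) - anorm A (f x)) \<longlongrightarrow> 0) (atin (ctop X) x)"
    by (rule tendsto_rabs_zero_cancel)
  then show "((\<lambda>y. anorm A (f y)) \<longlongrightarrow> anorm A (f x)) (atin (ctop X) x)"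
    by (simp add: LIM_zero_iff)
qed

lemma continuous_scale:
  assumes t: "continuous_map (ctop X) euclideanreal t"
    and f: "f \<in> points X \<rightarrow> elems A" "continuous_function f"
  shows "continuous_function (\<lambda>x\<in>points X. complex_of_real (t x) \<odot> f x)" (is "continuous_function ?g")
proof (subst continuous_function_iff)
  show "\<forall>x\<in>points X. ((\<lambda>y. adist A (?g y) (?g x)) \<longlongrightarrow> 0) (atin (ctop X) x)"
  proof
    fix x assume x: "x \<in> points X"
    have tx: "(t \<longlongrightarrow> t x) (atin (ctop X) x)"
      using t x by (simp add: continuous_map_atin)
    have le: "\<forall>\<^sub>F y in atin (ctop X) x. adist A (?g y) (?g x)
        \<le> \<bar>t y\<bar> * adist A (f y) (f x) + \<bar>t y - t x\<bar> * anorm A (f x)"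
      using eventually_points_atin
    proof eventually_elim
      fix y assume y: "y \<in> points X"
      have "f x \<in> elems A" "f y \<in> elems A" using f x y by auto
      then show "adist A (?g y) (?g x) \<le> \<bar>t y\<bar> * adist A (f y) (f x) + \<bar>t y - t x\<bar> * anorm A (f x)"
        using norm_scale_diff[of "f y" "f x" "complex_of_real (t y)" "complex_of_real (t x)"] x y
        by (simp add: adist_eq flip: of_real_diff)
    qed
    have "((\<lambda>y. \<bar>t y\<bar> * adist A (f y) (f x) + \<bar>t y - t x\<bar> * anorm A (f x))
        \<longlongrightarrow> \<bar>t x\<bar> * 0 + \<bar>t x - t x\<bar> * anorm A (f x)) (atin (ctop X) x)"
      by (intro tendsto_intros tx continuous_functionD f x)
    then have "((\<lambda>y. \<bar>t y\<bar> * adist A (f y) (f x) + \<bar>t y - t x\<bar> * anorm A (f x)) \<longlongrightarrow> 0) (atin (ctop X) x)"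
      by simp
    with le show "((\<lambda>y. adist A (?g y) (?g x)) \<longlongrightarrow> 0) (atin (ctop X) x)"
      by (intro tendsto_0_le[OF le]) simp_all
  qed
qed (use f in auto)

text \<open>
  The set where \<open>\<parallel>i(x)\<parallel> \<ge> \<epsilon>\<close> is closed by continuity, and closed sets are compact if and only if they
  are bounded.
\<close>

lemma mem_C0_iff:
  "i \<in> C0 \<longleftrightarrow> i \<in> points X \<rightarrow>\<^sub>E elems A \<and> continuous_function i \<and>
    ((\<lambda>x. anorm A (i x)) \<longlongrightarrow> 0) (at_coarse_infinity X)"
proof -
  have "(\<forall>e>0. compactin (ctop X) {x \<in> points X. e \<le> anorm A (i x)}) \<longleftrightarrow>
      ((\<lambda>x. anorm A (i x)) \<longlongrightarrow> 0) (at_coarse_infinity X)"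
    if i: "i \<in> points X \<rightarrow>\<^sub>E elems A" "continuous_function i"
  proof -
    have i': "i \<in> points X \<rightarrow> elems A" using i by auto
    have "compactin (ctop X) {x \<in> points X. e \<le> anorm A (i x)} \<longleftrightarrow>
        (\<forall>\<^sub>F x in at_coarse_infinity X. dist (anorm A (i x)) 0 < e)" for e
    proof -
      have "closedin (ctop X) {x \<in> points X. anorm A (i x) \<in> {e..}}"
        by (rule closedin_continuous_map_preimage[OF continuous_norm[OF i' i(2)]]) simp
      then have "compactin (ctop X) {x \<in> points X. e \<le> anorm A (i x)} \<longleftrightarrow>
          coarsely_bounded X {x \<in> points X. e \<le> anorm A (i x)}"
        using compact_bounded bounded_closed_compact by auto
      moreover have "{x \<in> points X. e \<le> anorm A (i x)} = {x \<in> points X. \<not> dist (anorm A (i x)) 0 < e}"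
        using i' norm_nonneg by (auto simp: Pi_iff abs_of_nonneg)
      ultimately show ?thesis by (simp add: eventually_at_coarse_infinity_iff)
    qed
    then show ?thesis by (simp add: tendsto_iff)
  qed
  then show ?thesis by (auto simp: C0_functions_def)
qed

text \<open>
  Along an entourage, \<open>y\<close> tends to infinity when \<open>x\<close> does, so \<open>\<parallel>i(x) - i(y)\<parallel> \<le> \<parallel>i(x)\<parallel> + \<parallel>i(y)\<parallel>\<close>
  tends to \<open>0\<close>.
\<close>

lemma C0_subset_V: "C0 \<subseteq> elems V"
proof
  fix i assume "i \<in> C0"
  then have i: "i \<in> points X \<rightarrow>\<^sub>E elems A" "continuous_function i"
    and lim: "((\<lambda>x. anorm A (i x)) \<longlongrightarrow> 0) (at_coarse_infinity X)"
    using mem_C0_iff by auto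
  have compact: "compactin (ctop X) {x \<in> points X. 1 \<le> anorm A (i x)}"
    using \<open>i \<in> C0\<close> by (simp add: C0_functions_def)
  have i': "i \<in> points X \<rightarrow> elems A" using i by auto
  show "i \<in> elems V"
    unfolding mem_V_iff vanishing_variation_iff
  proof (intro conjI ballI i)
    let ?K = "{x \<in> points X. 1 \<le> anorm A (i x)}"
    have "compact ((\<lambda>x. anorm A (i x)) ` ?K)"
      using image_compactin[OF compact continuous_norm[OF i' i(2)]] by simp
    then obtain B where B: "\<forall>r \<in> (\<lambda>x. anorm A (i x)) ` ?K. \<bar>r\<bar> \<le> B"
      using compact_imp_bounded bounded_real by blast
    have "anorm A (i x) \<le> max B 1" if "x \<in> points X" for x
    proof (cases "1 \<le> anorm A (i x)")
      case True
      then have "\<bar>anorm A (i x)\<bar> \<le> B" using B that by blast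
      then show ?thesis by linarith
    qed simp
    then show "\<exists>C. \<forall>x\<in>points X. anorm A (i x) \<le> C" by blast
    fix E assume E: "E \<in> entourages X"
    show "((\<lambda>p. adist A (i (fst p)) (i (snd p))) \<longlongrightarrow> 0) (pairs_at_infinity X E)"
    proof (rule tendsto_0_le)
      show "\<forall>\<^sub>F p in pairs_at_infinity X E.
          adist A (i (fst p)) (i (snd p)) \<le> anorm A (i (fst p)) + anorm A (i (snd p))"
        using eventually_pairs
      proof eventually_elim
        fix p assume "p \<in> E"
        then have "fst p \<in> points X" "snd p \<in> points X" using entourage_points[OF E] by auto
        then have "i (fst p) \<in> elems A" "i (snd p) \<in> elems A" using i' by auto
        then show "adist A (i (fst p)) (i (snd p)) \<le> anorm A (i (fst p)) + anorm A (i (snd p))"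
          by (simp add: adist_eq norm_diff_le)
      qed
      show "((\<lambda>p. anorm A (i (fst p)) + anorm A (i (snd p))) \<longlongrightarrow> 0) (pairs_at_infinity X E)"
        using tendsto_add[OF filterlim_compose[OF lim filterlim_fst[OF E]]
            filterlim_compose[OF lim filterlim_snd[OF E]]] by simp
    qed simp
  qed
qed

lemma mem_C0_iff_V:
  "i \<in> C0 \<longleftrightarrow> i \<in> elems V \<and> ((\<lambda>x. anorm A (i x)) \<longlongrightarrow> 0) (at_coarse_infinity X)"
  using C0_subset_V by (auto simp: mem_C0_iff mem_V_iff)

lemma star_ideal_C0: "star_ideal V C0"
proof -
  interpret V: cstar_seminormed V by (rule cstar_seminormed_V)
  have C0I: "i \<in> C0"
    if "i \<in> elems V" "\<And>x. x \<in> points X \<Longrightarrow> anorm A (i x) \<le> v x" "(v \<longlongrightarrow> 0) (at_coarse_infinity X)" for i v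
  proof -
    have "((\<lambda>x. \<bar>anorm A (i x)\<bar>) \<longlongrightarrow> 0) (at_coarse_infinity X)"
    proof (rule tendsto_0_le[OF _ _ that(3)])
      show "\<forall>\<^sub>F x in at_coarse_infinity X. \<bar>anorm A (i x)\<bar> \<le> v x"
        using eventually_points by eventually_elim (use that norm_nonneg in \<open>simp add: abs_of_nonneg\<close>)
    qed simp
    then show ?thesis using that(1) by (simp add: mem_C0_iff_V tendsto_rabs_zero_cancel)
  qed
  have lim: "i \<in> elems V" "((\<lambda>x. anorm A (i x)) \<longlongrightarrow> 0) (at_coarse_infinity X)" if "i \<in> C0" for i
    using that by (simp_all add: mem_C0_iff_V)
  show ?thesis
  proof
    show "C0 \<subseteq> elems V" by (rule C0_subset_V)
    show "azero V \<in> C0"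
      by (rule C0I[OF _ _ tendsto_const]) (simp_all, simp add: V_ops norm_zero)
    fix i assume i: "i \<in> C0"
    note iV = lim(1)[OF i] and i0 = lim(2)[OF i]
    show "c \<odot>\<^bsub>V\<^esub> i \<in> C0" for c
      by (rule C0I[OF _ _ tendsto_mult_right_zero[OF i0, of "cmod c"]])
        (simp_all add: iV, simp add: iV V_ops norm_scale)
    show "astar V i \<in> C0"
      by (rule C0I[OF _ _ i0]) (simp_all add: iV, simp add: iV V_ops norm_star)
    show "i \<oplus>\<^bsub>V\<^esub> j \<in> C0" if j: "j \<in> C0" for j
      using tendsto_add[OF i0 lim(2)[OF j]]
      by (intro C0I[of _ "\<lambda>x. anorm A (i x) + anorm A (j x)"])
        (simp_all add: iV lim(1)[OF j], simp add: iV lim(1)[OF j] V_ops norm_triangle)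
    fix f assume f: "f \<in> elems V"
    obtain B where B: "0 \<le> B" "\<And>x. x \<in> points X \<Longrightarrow> anorm A (f x) \<le> B" using V_bounded[OF f] by blast
    have le: "anorm A (f x) * anorm A (i x) \<le> B * anorm A (i x)" if "x \<in> points X" for x
      using B that iV by (intro mult_right_mono) (auto simp: norm_nonneg)
    show "f \<otimes>\<^bsub>V\<^esub> i \<in> C0"
    proof (rule C0I[OF _ _ tendsto_mult_right_zero[OF i0, of B]])
      fix x assume x: "x \<in> points X"
      then show "anorm A ((f \<otimes>\<^bsub>V\<^esub> i) x) \<le> B * anorm A (i x)"
        using norm_mult[of "f x" "i x"] le[OF x] f iV by (simp add: V_ops)
    qed (simp add: f iV)
    show "i \<otimes>\<^bsub>V\<^esub> f \<in> C0"
    proof (rule C0I[OF _ _ tendsto_mult_right_zero[OF i0, of B]])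
      fix x assume x: "x \<in> points X"
      then show "anorm A ((i \<otimes>\<^bsub>V\<^esub> f) x) \<le> B * anorm A (i x)"
        using norm_mult[of "i x" "f x"] le[OF x] f iV by (simp add: V_ops mult.commute)
    qed (simp add: f iV)
  qed
qed

text \<open>
  If \<open>f* f + i\<close> has norm at most \<open>r\<^sup>2\<close> and \<open>i\<close> vanishes at infinity, then \<open>\<parallel>f(x)\<parallel> < r + \<epsilon>\<close> outside
  a compact set. Truncation of \<open>f\<close> to norm \<open>r + \<epsilon>\<close> therefore changes it by a function
  in the ideal. This is the C*-identity for the quotient.
\<close>

theorem cstar_algebra_corona: "cstar_algebra (quotient_algebra V C0)"
proof -
  interpret V: cstar_seminormed V by (rule cstar_seminormed_V)
  interpret I: star_ideal V C0 by (rule star_ideal_C0)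
  show ?thesis
  proof (rule I.cstar_algebra_quotient[OF seminorm_complete_V])
    fix f assume f: "f \<in> elems V" and close: "\<And>e. e > 0 \<Longrightarrow> \<exists>i\<in>C0. anorm V (adiff V f i) < e"
    have "((\<lambda>x. anorm A (f x)) \<longlongrightarrow> 0) (at_coarse_infinity X)"
    proof (rule tendstoI)
      fix e :: real assume e: "e > 0"
      then obtain i where i: "i \<in> C0" "anorm V (adiff V f i) < e/2" using close[of "e/2"] by auto
      then have iV: "i \<in> elems V" and i0: "((\<lambda>x. anorm A (i x)) \<longlongrightarrow> 0) (at_coarse_infinity X)"
        by (simp_all add: mem_C0_iff_V)
      have "\<forall>\<^sub>F x in at_coarse_infinity X. anorm A (i x) < e/2"
        using order_tendstoD(2)[OF i0, of "e/2"] e by simp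
      with eventually_points show "\<forall>\<^sub>F x in at_coarse_infinity X. dist (anorm A (f x)) 0 < e"
      proof eventually_elim
        fix x assume x: "x \<in> points X" and lt: "anorm A (i x) < e/2"
        have mem: "f x \<in> elems A" "i x \<in> elems A" using x f iV by simp_all
        have "anorm A (f x \<ominus> i x) < e/2"
          using norm_le_norm_V[OF V.diff_closed[OF f iV] x] i(2) x by (simp add: diff_V)
        then show "dist (anorm A (f x)) 0 < e"
          using norm_triangle_diff[OF mem] lt norm_nonneg[OF mem(1)] by simp
      qed
    qed
    then show "f \<in> C0" using f by (simp add: mem_C0_iff_V)
  next
    fix f i and e :: real assume f: "f \<in> elems V" and i: "i \<in> C0" and e: "e > 0"
    note f' = V_funcset[OF f] V_continuous[OF f]
    have iV: "i \<in> elems V" and i0: "((\<lambda>x. anorm A (i x)) \<longlongrightarrow> 0) (at_coarse_infinity X)"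
      using i by (simp_all add: mem_C0_iff_V)
    let ?k = "astar V f \<otimes>\<^bsub>V\<^esub> f \<oplus>\<^bsub>V\<^esub> i"
    have kV: "?k \<in> elems V" using f iV by simp
    define r where "r = sqrt (anorm V ?k)"
    define R where "R = r + e"
    have r: "0 \<le> r" "r\<^sup>2 = anorm V ?k" using norm_V_nonneg[OF kV] by (simp_all add: r_def)
    have R: "0 < R" "r\<^sup>2 < R\<^sup>2" using r(1) e by (auto simp: R_def intro: power_strict_mono)
    have sq: "(anorm A (f x))\<^sup>2 \<le> r\<^sup>2 + anorm A (i x)" if x: "x \<in> points X" for x
    proof -
      have mem: "f x \<in> elems A" "i x \<in> elems A" using x f iV by simp_all
      have kx: "?k x = astar A (f x) \<otimes> f x \<oplus> i x" using x by (simp add: V_ops)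
      have "anorm A (astar A (f x) \<otimes> f x) \<le> anorm A (?k x) + anorm A (?k x \<ominus> astar A (f x) \<otimes> f x)"
        using norm_triangle_diff[of "astar A (f x) \<otimes> f x" "?k x"]
          norm_diff_commute[of "astar A (f x) \<otimes> f x" "?k x"] mem kx by simp
      also have "?k x \<ominus> astar A (f x) \<otimes> f x = i x" using mem kx by (simp add: add_diff_cancel_left)
      finally show ?thesis using norm_le_norm_V[OF kV x] mem r(2) by (simp add: cstar_identity)
    qed
    \<comment> \<open>The scalar \<open>1 + t x\<close> truncates \<open>f x\<close> to norm at most \<open>R\<close>.\<close>
    define t where "t x = R / max R (anorm A (f x)) - 1" for x
    define j where "j = (\<lambda>x\<in>points X. complex_of_real (t x) \<odot> f x)"
    have jA: "j \<in> points X \<rightarrow>\<^sub>E elems A" using f' by (auto simp: j_def)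
    have "continuous_map (ctop X) euclideanreal t"
      unfolding t_def using R(1)
      by (intro continuous_intros continuous_norm f') auto
    then have "continuous_function j" unfolding j_def by (intro continuous_scale f')
    moreover have "((\<lambda>x. anorm A (j x)) \<longlongrightarrow> 0) (at_coarse_infinity X)"
    proof (rule tendsto_eventually)
      have "\<forall>\<^sub>F x in at_coarse_infinity X. anorm A (i x) < R\<^sup>2 - r\<^sup>2"
        using order_tendstoD(2)[OF i0, of "R\<^sup>2 - r\<^sup>2"] R by simp
      with eventually_points show "\<forall>\<^sub>F x in at_coarse_infinity X. anorm A (j x) = 0"
      proof eventually_elim
        fix x assume x: "x \<in> points X" and lt: "anorm A (i x) < R\<^sup>2 - r\<^sup>2"
        then have "(anorm A (f x))\<^sup>2 < R\<^sup>2" using sq[OF x] by linarith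
        then have "anorm A (f x) < R" using R(1) by (simp add: power_less_imp_less_base)
        then have "t x = 0" using R(1) by (simp add: t_def)
        then show "anorm A (j x) = 0" using x f by (simp add: j_def scale_zero_left norm_zero)
      qed
    qed
    ultimately have j: "j \<in> C0" using jA by (simp add: mem_C0_iff)
    then have jV: "j \<in> elems V" using C0_subset_V by blast
    have "anorm A ((f \<oplus>\<^bsub>V\<^esub> j) x) \<le> R" if x: "x \<in> points X" for x
    proof -
      have fx: "f x \<in> elems A" using f x by simp
      have "(f \<oplus>\<^bsub>V\<^esub> j) x = 1 \<odot> f x \<oplus> complex_of_real (t x) \<odot> f x"
        using x fx by (simp add: V_ops j_def scale_one)
      also have "\<dots> = (1 + complex_of_real (t x)) \<odot> f x" using scale_add_left[OF fx] by simp
      also have "1 + complex_of_real (t x) = complex_of_real (R / max R (anorm A (f x)))"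
        by (simp add: t_def)
      finally have "anorm A ((f \<oplus>\<^bsub>V\<^esub> j) x) = R / max R (anorm A (f x)) * anorm A (f x)"
        using R(1) norm_scale[OF fx] by (simp only: norm_of_real) simp
      also have "\<dots> \<le> R" using R(1) norm_nonneg[OF fx] by (simp add: max_def field_simps)
      finally show ?thesis .
    qed
    then have "anorm V (f \<oplus>\<^bsub>V\<^esub> j) \<le> R" using R(1) f jV by (subst norm_V_le_iff) auto
    then show "\<exists>j\<in>C0. anorm V (f \<oplus>\<^bsub>V\<^esub> j) \<le> sqrt (anorm V ?k) + e"
      using j by (auto simp: R_def r_def)
  qed
qed

end

section \<open>Continuous approximation\<close>

text \<open>
  A function on a coarse space that varies little along an entourage containing a neighbourhood of
  the diagonal can be approximated by a continuous function. The values that are allowed at a point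
  form a convex set, so that locally constant approximations can be glued by means of Urysohn
  functions.
\<close>

locale rough_function = function_algebra X A
  for X :: "'x coarse_data" and A :: "'a normed_star_algebra" (structure) +
  fixes h :: "'x \<Rightarrow> 'a" and E :: "('x \<times> 'x) set" and U :: "('x \<times> 'x) set"
  assumes h: "\<And>x. x \<in> points X \<Longrightarrow> h x \<in> elems A"
    and E: "E \<in> entourages X" and sym_E: "sym E"
    and open_U: "openin (prod_topology (ctop X) (ctop X)) U"
    and Id_U: "Id_on (points X) \<subseteq> U" and U_subset: "U \<subseteq> E"
begin

text \<open>
  The condition confines \<open>a\<close> to the closed ball around \<open>h x\<close> whose radius is the variation of \<open>h\<close> at
  \<open>x\<close> along \<open>E\<close>, without naming the radius.
\<close>

definition close_value :: "'x \<Rightarrow> 'a \<Rightarrow> bool"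
  where "close_value x a \<longleftrightarrow> a \<in> elems A \<and>
    (\<forall>r. (\<forall>y. (x, y) \<in> E \<longrightarrow> adist A (h x) (h y) \<le> r) \<longrightarrow> adist A a (h x) \<le> r)"

lemma close_value_neighbour: "(x, z) \<in> E \<Longrightarrow> close_value x (h z)"
  using entourage_points[OF E] h metric.commute by (auto simp: close_value_def)

lemma close_value_convex:
  assumes x: "x \<in> points X" and a: "close_value x a" and b: "close_value x b" and t: "0 \<le> t" "t \<le> 1"
  shows "close_value x (complex_of_real (1 - t) \<odot> a \<oplus> complex_of_real t \<odot> b)"
  unfolding close_value_def
proof (intro conjI allI impI)
  have A: "a \<in> elems A" "b \<in> elems A" "h x \<in> elems A" using x a b h by (auto simp: close_value_def)
  then show "complex_of_real (1 - t) \<odot> a \<oplus> complex_of_real t \<odot> b \<in> elems A" by simp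
  fix r assume r: "\<forall>y. (x, y) \<in> E \<longrightarrow> adist A (h x) (h y) \<le> r"
  then have ar: "anorm A (a \<ominus> h x) \<le> r" and br: "anorm A (b \<ominus> h x) \<le> r"
    using a b A by (auto simp: close_value_def adist_eq)
  let ?s = "complex_of_real (1 - t)" and ?t = "complex_of_real t"
  have "h x = ?s \<odot> h x \<oplus> ?t \<odot> h x"
    using scale_add_left[OF A(3), of ?s ?t] by (simp add: scale_one A)
  then have "anorm A ((?s \<odot> a \<oplus> ?t \<odot> b) \<ominus> h x) = anorm A ((?s \<odot> a \<oplus> ?t \<odot> b) \<ominus> (?s \<odot> h x \<oplus> ?t \<odot> h x))"
    by simp
  also have "\<dots> \<le> anorm A (?s \<odot> a \<ominus> ?s \<odot> h x) + anorm A (?t \<odot> b \<ominus> ?t \<odot> h x)"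
    using A by (simp add: norm_add_diff_add)
  also have "\<dots> = (1 - t) * anorm A (a \<ominus> h x) + t * anorm A (b \<ominus> h x)"
    using A t by (simp add: scale_diff norm_scale del: of_real_diff)
  also have "\<dots> \<le> (1 - t) * r + t * r" using t ar br by (intro add_mono mult_left_mono) auto
  finally show "adist A (?s \<odot> a \<oplus> ?t \<odot> b) (h x) \<le> r" using A by (simp add: adist_eq algebra_simps)
qed

definition blend :: "('x \<Rightarrow> real) \<Rightarrow> ('x \<Rightarrow> 'a) \<Rightarrow> ('x \<Rightarrow> 'a) \<Rightarrow> 'x \<Rightarrow> 'a"
  where "blend t f g = (\<lambda>x\<in>points X. complex_of_real (1 - t x) \<odot> f x \<oplus> complex_of_real (t x) \<odot> g x)"

definition continuous_section :: "('x \<Rightarrow> 'a) \<Rightarrow> bool"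
  where "continuous_section f \<longleftrightarrow> f \<in> points X \<rightarrow>\<^sub>E elems A \<and> continuous_function f"

definition cutoff :: "('x \<Rightarrow> real) \<Rightarrow> bool"
  where "cutoff t \<longleftrightarrow> continuous_map (ctop X) euclideanreal t \<and> (\<forall>x\<in>points X. 0 \<le> t x \<and> t x \<le> 1)"

lemma continuous_blend:
  assumes t: "cutoff t" and f: "continuous_section f" and g: "continuous_section g"
  shows "continuous_section (blend t f g)"
proof -
  have f': "f \<in> points X \<rightarrow> elems A" "continuous_function f"
    and g': "g \<in> points X \<rightarrow> elems A" "continuous_function g"
    using f g by (auto simp: continuous_section_def)
  have t': "continuous_map (ctop X) euclideanreal t" using t by (simp add: cutoff_def)
  then have s: "continuous_map (ctop X) euclideanreal (\<lambda>x. 1 - t x)" by (intro continuous_intros)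
  have "continuous_function (blend t f g)"
  proof (rule continuous_function_combine[OF _ continuous_scale[OF s f'] _ continuous_scale[OF t' g'], of _ 1])
    fix x y assume xy: "x \<in> points X" "y \<in> points X"
    then have "f x \<in> elems A" "f y \<in> elems A" "g x \<in> elems A" "g y \<in> elems A" using f' g' by auto
    then show "adist A (blend t f g x) (blend t f g y)
      \<le> 1 * (adist A ((\<lambda>x\<in>points X. complex_of_real (1 - t x) \<odot> f x) x) ((\<lambda>x\<in>points X. complex_of_real (1 - t x) \<odot> f x) y)
        + adist A ((\<lambda>x\<in>points X. complex_of_real (t x) \<odot> g x) x) ((\<lambda>x\<in>points X. complex_of_real (t x) \<odot> g x) y))"
      using xy by (simp add: blend_def adist_eq norm_add_diff_add del: of_real_diff)
  qed (use f' g' in \<open>auto simp: blend_def\<close>)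
  then show ?thesis using f' g' by (auto simp: continuous_section_def blend_def)
qed

lemma close_blend:
  assumes x: "x \<in> points X" and t: "cutoff t" and f: "continuous_section f" and g: "continuous_section g"
    and "t x = 1 \<or> close_value x (f x)" "t x = 0 \<or> close_value x (g x)"
  shows "close_value x (blend t f g x)"
proof -
  have mem: "f x \<in> elems A" "g x \<in> elems A" using f g x by (auto simp: continuous_section_def)
  consider "t x = 1" "close_value x (g x)" | "t x = 0" "close_value x (f x)"
    | "close_value x (f x)" "close_value x (g x)" using assms(5,6) by fastforce
  then show ?thesis
  proof cases
    case 1 then show ?thesis using x mem by (simp add: blend_def scale_zero_left scale_one zero_add)
  next
    case 2 then show ?thesis using x mem by (simp add: blend_def scale_zero_left scale_one add_zero)
  next
    case 3 then show ?thesis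
      using close_value_convex[OF x 3] t x by (simp add: blend_def cutoff_def del: of_real_diff)
  qed
qed

lemma blend_1: "\<lbrakk>x \<in> points X; t x = 1; continuous_section f; continuous_section g\<rbrakk> \<Longrightarrow> blend t f g x = g x"
  using PiE_mem[of f "points X" "\<lambda>_. elems A" x] PiE_mem[of g "points X" "\<lambda>_. elems A" x]
  by (simp add: blend_def continuous_section_def scale_zero_left scale_one zero_add)

text \<open>
  The function equals \<open>1\<close> on a neighbourhood of \<open>z\<close> and not only at \<open>z\<close>, so that finitely many such
  neighbourhoods can cover a compact set.
\<close>

lemma local_cutoff:
  assumes z: "z \<in> points X"
  shows "\<exists>t N. cutoff t \<and> openin (ctop X) N \<and> z \<in> N \<and> (\<forall>x\<in>N. t x = 1) \<and>
    (\<forall>x\<in>points X. t x \<noteq> 0 \<longrightarrow> (x, z) \<in> E)"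
proof -
  let ?O = "{x \<in> points X. (x, z) \<in> U}"
  have "continuous_map (ctop X) (prod_topology (ctop X) (ctop X)) (\<lambda>x. (x, z))"
    using z by (simp add: continuous_map_pairedI)
  then have "openin (ctop X) ?O" using open_U by (rule openin_continuous_map_preimage)
  then have closed: "closedin (ctop X) (points X - ?O)" by blast
  have "z \<in> points X - (points X - ?O)" using z Id_U by auto
  then obtain f :: "'x \<Rightarrow> real" where f: "continuous_map (ctop X) (top_of_set {0..1}) f"
    "f z = 0" "f ` (points X - ?O) \<subseteq> {1}"
    using completely_regular closed unfolding completely_regular_space_def by meson
  have cf: "continuous_map (ctop X) euclideanreal f" and f01: "\<And>x. x \<in> points X \<Longrightarrow> 0 \<le> f x \<and> f x \<le> 1"
    using f(1) by (auto simp: continuous_map_in_subtopology)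
  define t where "t x = min 1 (2 * (1 - f x))" for x
  let ?N = "{x \<in> points X. f x \<in> {..<1/2}}"
  have "openin (ctop X) ?N" using cf by (rule openin_continuous_map_preimage) simp
  moreover have "cutoff t"
    unfolding cutoff_def t_def using f01 by (auto intro!: continuous_intros cf)
  moreover have "(x, z) \<in> E" if "x \<in> points X" "t x \<noteq> 0" for x
  proof (rule ccontr)
    assume "(x, z) \<notin> E"
    then have "f x = 1" using that f(3) U_subset by auto
    then show False using that by (simp add: t_def)
  qed
  moreover have "\<forall>x\<in>?N. t x = 1" by (auto simp: t_def)
  moreover have "z \<in> ?N" using z f(2) by simp
  ultimately show ?thesis by blast
qed

lemma approximation_on_compact:
  assumes K: "compactin (ctop X) K"
  shows "\<exists>g. continuous_section g \<and> (\<forall>x\<in>K. close_value x (g x))"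
proof -
  define Q where "Q z t N \<longleftrightarrow> cutoff t \<and> openin (ctop X) N \<and> z \<in> N \<and> (\<forall>x\<in>N. t x = 1) \<and>
    (\<forall>x\<in>points X. t x \<noteq> 0 \<longrightarrow> (x, z) \<in> E)" for z t N
  have "\<exists>t N. Q z t N" if "z \<in> points X" for z
    using local_cutoff[OF that] unfolding Q_def .
  then obtain t N where Q: "\<And>z. z \<in> points X \<Longrightarrow> Q z (t z) (N z)" by metis
  have t: "\<And>z. z \<in> points X \<Longrightarrow> cutoff (t z)"
    and N: "\<And>z. z \<in> points X \<Longrightarrow> openin (ctop X) (N z) \<and> z \<in> N z"
    and tN: "\<And>z x. \<lbrakk>z \<in> points X; x \<in> N z\<rbrakk> \<Longrightarrow> t z x = 1"
    and tE: "\<And>z x. \<lbrakk>z \<in> points X; x \<in> points X; t z x \<noteq> 0\<rbrakk> \<Longrightarrow> (x, z) \<in> E"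
    using Q unfolding Q_def by meson+
  have NX: "N z \<subseteq> points X" if "z \<in> points X" for z using N[OF that] openin_subset by blast
  have const: "continuous_section (\<lambda>x\<in>points X. a)" if a: "a \<in> elems A" for a
  proof -
    have "continuous_function (\<lambda>x\<in>points X. a)"
    proof (subst continuous_function_iff)
      show "\<forall>x\<in>points X. ((\<lambda>y. adist A ((\<lambda>x\<in>points X. a) y) ((\<lambda>x\<in>points X. a) x)) \<longlongrightarrow> 0) (atin (ctop X) x)"
        by (intro ballI tendsto_eventually eventually_mono[OF eventually_points_atin]) (simp add: a)
    qed (simp add: a)
    then show ?thesis using a by (simp add: continuous_section_def)
  qed
  have fin: "\<exists>g. continuous_section g \<and> (\<forall>x\<in>\<Union>z\<in>F. N z. close_value x (g x))"
    if "finite F" "F \<subseteq> points X" for F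
    using that
  proof (induction F rule: finite_induct)
    case empty
    then show ?case using const[OF zero_closed] by auto
  next
    case (insert z F)
    then obtain g where g: "continuous_section g" "\<forall>x\<in>\<Union>z\<in>F. N z. close_value x (g x)" by auto
    have z: "z \<in> points X" using insert by auto
    let ?g = "blend (t z) g (\<lambda>x\<in>points X. h z)"
    note c = const[OF h[OF z]]
    have "close_value x (?g x)" if x: "x \<in> (\<Union>z\<in>insert z F. N z)" for x
    proof (rule close_blend[OF _ t[OF z] g(1) c])
      show xX: "x \<in> points X" using x insert.prems NX by auto
      show "t z x = 1 \<or> close_value x (g x)" using x tN[OF z] g(2) by auto
      show "t z x = 0 \<or> close_value x ((\<lambda>x\<in>points X. h z) x)"
        using tE[OF z xX] close_value_neighbour xX by auto
    qed
    then show ?case using continuous_blend[OF t[OF z] g(1) c] by blast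
  qed
  have KX: "K \<subseteq> points X" using K compactin_subset_topspace by blast
  have "\<exists>\<F>. finite \<F> \<and> \<F> \<subseteq> N ` K \<and> K \<subseteq> \<Union>\<F>"
    using K[unfolded compactin_def, THEN conjunct2, THEN spec, of "N ` K"] N KX by blast
  then obtain F where F: "finite F" "F \<subseteq> K" "K \<subseteq> (\<Union>x\<in>F. N x)"
    by (metis finite_subset_image)
  then show ?thesis using fin[of F] KX by blast
qed

text \<open>
  The points that can be reached from \<open>z\<close> in finitely many steps along \<open>E\<close> form an open set with an
  exhaustion by compact sets. Approximations on these are blended one after the other, each step
  changing nothing on all but the last of the compact sets reached before.
\<close>

definition component :: "'x \<Rightarrow> 'x set" where "component z = E\<^sup>* `` {z}"

lemma component_exhaustion:
  assumes z: "z \<in> points X"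
  shows "\<exists>L P. (\<forall>n::nat. compactin (ctop X) (L n)) \<and> (\<forall>n. openin (ctop X) (P n)) \<and>
    (\<forall>n. L n \<subseteq> P n) \<and> (\<forall>n. P n \<subseteq> L (Suc n)) \<and> component z = (\<Union>n. L n)"
proof -
  \<comment> \<open>Only every second ball is used, which leaves room for the open set \<open>?P n\<close> in between.\<close>
  let ?B = "\<lambda>n. (E ^^ n) `` {z}"
  let ?L = "\<lambda>n. ctop X closure_of ?B (2 * n)"
  let ?P = "\<lambda>n. \<Union>b\<in>?B (Suc (2 * n)). {w \<in> points X. (b, w) \<in> U}"
  have B: "coarsely_bounded X (?B n)" for n
  proof (induction n)
    case 0 then show ?case using z by (simp add: bounded_singleton)
  next
    case (Suc n)
    have "?B (Suc n) = E `` ?B n" by auto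
    then show ?case using bounded_Image[OF E Suc] by simp
  qed
  then have BX: "?B n \<subseteq> points X" for n using bounded_points by blast
  have open_section: "openin (ctop X) {w \<in> points X. (b, w) \<in> U}" if b: "b \<in> points X" for b
  proof -
    have "continuous_map (ctop X) (prod_topology (ctop X) (ctop X)) (\<lambda>x. (b, x))"
      using b by (simp add: continuous_map_pairedI)
    then show ?thesis using open_U by (rule openin_continuous_map_preimage)
  qed
  have closure_B: "ctop X closure_of ?B n \<subseteq> ?B (Suc n)" for n
  proof
    fix x assume x: "x \<in> ctop X closure_of ?B n"
    then have xX: "x \<in> points X" by (simp add: in_closure_of)
    then have "x \<in> {w \<in> points X. (x, w) \<in> U}" using Id_U by auto
    then obtain w where "w \<in> ?B n" "(x, w) \<in> U"
      using x[unfolded in_closure_of, THEN conjunct2, THEN spec, of "{w \<in> points X. (x, w) \<in> U}"]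
        open_section[OF xX] by auto
    then show "x \<in> ?B (Suc n)" using U_subset sym_E by (auto simp: sym_def)
  qed
  have P_sub: "?P n \<subseteq> ?B (Suc (Suc (2 * n)))" for n using U_subset by auto
  have sub_P: "?B (Suc (2 * n)) \<subseteq> ?P n" for n using Id_U BX by fastforce
  have sub_cl: "?B n \<subseteq> ctop X closure_of ?B n" for n using closure_of_subset[OF BX] .
  have "compactin (ctop X) (?L n)" for n by (rule compact_closure[OF B])
  moreover have "openin (ctop X) (?P n)" for n using open_section BX by blast
  moreover have "?L n \<subseteq> ?P n" for n using closure_B[of "2 * n"] sub_P[of n] by blast
  moreover have "?P n \<subseteq> ?L (Suc n)" for n
    using order_trans[OF P_sub[of n] sub_cl] by (simp only: mult_Suc_right add_2_eq_Suc)
  moreover have "component z = (\<Union>n. ?L n)"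
  proof
    show "(\<Union>n. ?L n) \<subseteq> component z"
    proof
      fix x assume "x \<in> (\<Union>n. ?L n)"
      then obtain n where "x \<in> ?B (Suc (2 * n))" using closure_B by blast
      then show "x \<in> component z" unfolding component_def by (blast intro: relpow_imp_rtrancl)
    qed
    show "component z \<subseteq> (\<Union>n. ?L n)"
    proof
      fix x assume "x \<in> component z"
      then obtain n where n: "x \<in> ?B n" by (auto simp: component_def rtrancl_power)
      have refl: "?B m \<subseteq> ?B (Suc m)" for m using sub_cl closure_B by (rule order_trans)
      have "?B n \<subseteq> ?B (n + k)" for k
      proof (induction k)
        case (Suc k)
        then show ?case using order_trans[OF Suc refl[of "n + k"]] by (simp only: add_Suc_right)
      qed simp
      from this[of n] have "x \<in> ?B (2 * n)" using n by (auto simp: mult_2)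
      then show "x \<in> (\<Union>n. ?L n)" using sub_cl by blast
    qed
  qed
  ultimately show ?thesis by - (rule exI[where x = ?L], rule exI[where x = ?P], blast)
qed

lemma approximation_on_component:
  assumes z: "z \<in> points X"
  shows "\<exists>g. \<forall>x\<in>component z. close_value x (g x) \<and>
    (\<exists>N f. openin (ctop X) N \<and> x \<in> N \<and> N \<subseteq> component z \<and> continuous_section f \<and> (\<forall>y\<in>N. g y = f y))"
proof -
  obtain L P where L: "\<And>n::nat. compactin (ctop X) (L n)" and P: "\<And>n. openin (ctop X) (P n)"
    and LP: "\<And>n. L n \<subseteq> P n" and PL: "\<And>n. P n \<subseteq> L (Suc n)" and comp: "component z = (\<Union>n. L n)"
    using component_exhaustion[OF z] by metis
  have LX: "L n \<subseteq> points X" for n using L compactin_subset_topspace by blast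
  have L_mono: "L m \<subseteq> L n" if "m \<le> n" for m n
    using lift_Suc_mono_le[of L, OF _ that] LP PL by blast
  have "\<exists>t. cutoff t \<and> (\<forall>x\<in>L n. t x = 1) \<and> (\<forall>x\<in>points X - P n. t x = 0)" for n
  proof -
    have "closedin (ctop X) (points X - P n)" using P by blast
    moreover have "disjnt (points X - P n) (L n)" using LP by (auto simp: disjnt_def)
    ultimately obtain f :: "'x \<Rightarrow> real" where f: "continuous_map (ctop X) (top_of_set {0..1}) f"
      "f ` L n \<subseteq> {0}" "f ` (points X - P n) \<subseteq> {1}"
      using Urysohn_completely_regular_closed_compact[OF zero_le_one completely_regular _ L] by blast
    have cf: "continuous_map (ctop X) euclideanreal f" and f01: "\<And>x. x \<in> points X \<Longrightarrow> 0 \<le> f x \<and> f x \<le> 1"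
      using f(1) by (auto simp: continuous_map_in_subtopology)
    have "cutoff (\<lambda>x. 1 - f x)"
      unfolding cutoff_def using f01 by (auto intro!: continuous_intros cf)
    then show ?thesis using f(2,3) by (intro exI[of _ "\<lambda>x. 1 - f x"]) auto
  qed
  then obtain t where t: "\<And>n. cutoff (t n)" "\<And>n x. x \<in> L n \<Longrightarrow> t n x = 1"
    "\<And>n x. \<lbrakk>x \<in> points X; x \<notin> P n\<rbrakk> \<Longrightarrow> t n x = 0" by (metis DiffI)
  obtain a where a: "\<And>n. continuous_section (a n)" "\<And>n x. x \<in> L n \<Longrightarrow> close_value x (a n x)"
    using approximation_on_compact[OF L] by metis
  \<comment> \<open>\<open>G n\<close> is a solution on \<open>L (Suc n)\<close>. It is kept on \<open>L n\<close> and replaced by \<open>a (n + 2)\<close> off \<open>P n\<close>, which is contained in \<open>L (Suc n)\<close>.\<close>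
  define G where "G = rec_nat (a 1) (\<lambda>n f. blend (t n) (a (Suc (Suc n))) f)"
  have G_Suc: "G (Suc n) = blend (t n) (a (Suc (Suc n))) (G n)" for n by (simp add: G_def)
  have G_cont: "continuous_section (G n)" for n
  proof (induction n)
    case 0 then show ?case using a by (simp add: G_def)
  next
    case (Suc n) then show ?case unfolding G_Suc by (intro continuous_blend t a)
  qed
  have G_close: "close_value x (G n x)" if "x \<in> L (Suc n)" for n x
    using that
  proof (induction n)
    case 0 then show ?case using a by (simp add: G_def)
  next
    case (Suc n)
    then have x: "x \<in> points X" using LX by blast
    have "t n x = 0 \<or> close_value x (G n x)" using t(3)[OF x, of n] PL Suc.IH by blast
    then show ?case unfolding G_Suc using Suc.prems by (intro close_blend x t a G_cont) (auto intro: a)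
  qed
  have G_stable: "G m x = G n x" if "x \<in> L n" "n \<le> m" for m n x
    using that(2)
  proof (induction m rule: dec_induct)
    case (step m)
    have "x \<in> L m" using that(1) L_mono[OF step(1)] by blast
    then have "G (Suc m) x = G m x" unfolding G_Suc using LX a G_cont t by (intro blend_1) auto
    then show ?case using step by simp
  qed simp
  define g where "g x = G (LEAST n. x \<in> L n) x" for x
  have g: "g x = G n x" if "x \<in> L n" for n x
    unfolding g_def using that 
    by (intro G_stable[symmetric, OF LeastI[of "\<lambda>n. x \<in> L n"]] Least_le)
  show ?thesis
  proof (intro exI[of _ g] ballI conjI)
    fix x assume "x \<in> component z"
    then obtain n where n: "x \<in> L n" using comp by blast
    then have "x \<in> L (Suc n)" using LP PL by blast
    then show "close_value x (g x)" using g[OF n] G_close by simp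
    show "\<exists>N f. openin (ctop X) N \<and> x \<in> N \<and> N \<subseteq> component z \<and> continuous_section f \<and> (\<forall>y\<in>N. g y = f y)"
    proof (intro exI conjI)
      show "openin (ctop X) (P n)" by (rule P)
      show "x \<in> P n" using n LP by blast
      show "P n \<subseteq> component z" using PL comp by blast
      show "continuous_section (G (Suc n))" by (rule G_cont)
      show "\<forall>y\<in>P n. g y = G (Suc n) y" using g PL by blast
    qed
  qed
qed

text \<open>
  The components partition the space into open sets, so the approximations chosen on them form a
  continuous function.
\<close>

lemma continuous_approximation:
  "\<exists>g. continuous_section g \<and> (\<forall>x\<in>points X. close_value x (g x))"
proof -
  obtain G where G: "\<And>z x. \<lbrakk>z \<in> points X; x \<in> component z\<rbrakk> \<Longrightarrow> close_value x (G z x)"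
    and loc: "\<And>z x. \<lbrakk>z \<in> points X; x \<in> component z\<rbrakk> \<Longrightarrow> \<exists>N f. openin (ctop X) N \<and> x \<in> N \<and>
      N \<subseteq> component z \<and> continuous_section f \<and> (\<forall>y\<in>N. G z y = f y)"
    using approximation_on_component by metis
  define rep where "rep x = (SOME y. y \<in> component x)" for x
  define g where "g = (\<lambda>x\<in>points X. G (rep x) x)"
  have self: "x \<in> component x" for x by (simp add: component_def)
  have rep: "rep x \<in> component x" for x unfolding rep_def by (rule someI[of "\<lambda>y. y \<in> component x", OF self])
  have sym: "sym (E\<^sup>*)" using sym_E by (rule sym_rtrancl)
  have comp_eq: "component y = component x" if "y \<in> component x" for x y
    using that symD[OF sym] unfolding component_def by (auto intro: rtrancl_trans)
  have comp_X: "component x \<subseteq> points X" if "x \<in> points X" for x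
  proof
    fix y assume "y \<in> component x"
    then have "(x, y) \<in> E\<^sup>*" by (simp add: component_def)
    then show "y \<in> points X" by (induction rule: rtrancl_induct) (use that entourage_points[OF E] in auto)
  qed
  have rep_X: "rep x \<in> points X" if "x \<in> points X" for x using comp_X[OF that] rep by blast
  have mem: "x \<in> component (rep x)" for x using comp_eq[OF rep] self by blast
  have rep_eq: "rep y = rep x" if "y \<in> component (rep x)" for x y
  proof -
    have "component y = component x" using comp_eq[OF that] comp_eq[OF rep] by simp
    then show ?thesis by (simp add: rep_def)
  qed
  have close: "close_value x (g x)" if "x \<in> points X" for x
    using G[OF rep_X[OF that] mem] that by (simp add: g_def)
  have gA: "g \<in> points X \<rightarrow>\<^sub>E elems A"
    using close by (auto simp: close_value_def g_def)
  have "continuous_function g"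
  proof (subst continuous_function_iff)
    show "\<forall>x\<in>points X. ((\<lambda>y. adist A (g y) (g x)) \<longlongrightarrow> 0) (atin (ctop X) x)"
    proof
      fix x assume x: "x \<in> points X"
      obtain N f where N: "openin (ctop X) N" "x \<in> N" "N \<subseteq> component (rep x)"
        and f: "continuous_section f" "\<forall>y\<in>N. G (rep x) y = f y"
        using loc[OF rep_X[OF x] mem] by blast
      have gf: "g y = f y" if "y \<in> N" for y
        using that N(3) f(2) rep_eq openin_subset[OF N(1)] by (auto simp: g_def)
      have "\<forall>\<^sub>F y in atin (ctop X) x. y \<in> N" using N by (auto simp: eventually_atin)
      then have "\<forall>\<^sub>F y in atin (ctop X) x. adist A (f y) (f x) = adist A (g y) (g x)"
        by eventually_elim (simp add: gf N)
      moreover have "((\<lambda>y. adist A (f y) (f x)) \<longlongrightarrow> 0) (atin (ctop X) x)"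
        using f x by (intro continuous_functionD) (auto simp: continuous_section_def)
      ultimately show "((\<lambda>y. adist A (g y) (g x)) \<longlongrightarrow> 0) (atin (ctop X) x)"
        by (rule Lim_transform_eventually[rotated])
    qed
  qed (use gA in auto)
  then show ?thesis using gA close by (auto simp: continuous_section_def)
qed

end

context function_algebra
begin

text \<open>
  The distance between \<open>g\<close> and \<open>h\<close> is dominated by a variation of \<open>h\<close>, hence vanishes at infinity, and
  therefore \<open>g\<close> inherits vanishing variation from \<open>h\<close>.
\<close>

theorem exists_V_approximation:
  assumes h: "\<And>x. x \<in> points X \<Longrightarrow> h x \<in> elems A"
    and bound: "\<And>x. x \<in> points X \<Longrightarrow> anorm A (h x) \<le> C"
    and variation: "\<And>E. E \<in> entourages X
      \<Longrightarrow> ((\<lambda>p. adist A (h (fst p)) (h (snd p))) \<longlongrightarrow> 0) (pairs_at_infinity X E)"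
  shows "\<exists>g \<in> elems V. ((\<lambda>x. adist A (g x) (h x)) \<longlongrightarrow> 0) (at_coarse_infinity X)"
proof -
  obtain E0 U where EU: "E0 \<in> entourages X" "openin (prod_topology (ctop X) (ctop X)) U"
    "Id_on (points X) \<subseteq> U" "U \<subseteq> E0" by (rule diagonal_neighbourhood)
  define E where "E = E0 \<union> E0\<inverse>"
  have E: "E \<in> entourages X" using EU(1) by (simp add: E_def entourage_Un entourage_converse)
  interpret rough_function X A h E U
    by unfold_locales (use EU E h in \<open>auto simp: E_def sym_def\<close>)
  obtain g where g: "continuous_section g" "\<forall>x\<in>points X. close_value x (g x)"
    using continuous_approximation by blast
  have gA: "g \<in> points X \<rightarrow>\<^sub>E elems A" and gc: "continuous_function g"
    using g by (auto simp: continuous_section_def)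
  have g_le: "adist A (g x) (h x) \<le> r" if "x \<in> points X" "\<And>y. (x, y) \<in> E \<Longrightarrow> adist A (h x) (h y) \<le> r" for x r
    using g(2) that unfolding close_value_def by blast
  have lim: "((\<lambda>x. adist A (g x) (h x)) \<longlongrightarrow> 0) (at_coarse_infinity X)"
  proof (rule tendstoI)
    fix e :: real assume e: "e > 0"
    then obtain B where B: "coarsely_bounded X B"
      "\<And>x y. \<lbrakk>(x, y) \<in> E; x \<notin> B\<rbrakk> \<Longrightarrow> adist A (h x) (h y) < e/2"
      using tendstoD[OF variation[OF E], of "e/2"] unfolding eventually_pairs_at_infinity by auto
    have "adist A (g x) (h x) \<le> e/2" if "x \<in> points X - B" for x
      using that B(2) by (intro g_le) (auto intro: less_imp_le)
    then have "\<forall>x\<in>points X - B. dist (adist A (g x) (h x)) 0 < e" using e by fastforce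
    then show "\<forall>\<^sub>F x in at_coarse_infinity X. dist (adist A (g x) (h x)) 0 < e"
      unfolding eventually_at_coarse_infinity using B(1) by blast
  qed
  have "g \<in> elems V"
    unfolding mem_V_iff vanishing_variation_iff
  proof (intro conjI ballI gA gc)
    have "anorm A (g x) \<le> C + (C + C)" if x: "x \<in> points X" for x
    proof -
      have mem: "g x \<in> elems A" "h x \<in> elems A" using gA h x by auto
      have "adist A (g x) (h x) \<le> C + C"
      proof (rule g_le[OF x])
        fix y assume "(x, y) \<in> E"
        then have y: "y \<in> points X" using entourage_points[OF E] by auto
        show "adist A (h x) (h y) \<le> C + C"
          using norm_diff_le[OF h[OF x] h[OF y]] bound[OF x] bound[OF y] h x y by (simp add: adist_eq)
      qed
      then show ?thesis using norm_triangle_diff[OF mem] bound[OF x] mem by (simp add: adist_eq)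
    qed
    then show "\<exists>C. \<forall>x\<in>points X. anorm A (g x) \<le> C" by blast
    fix F assume F: "F \<in> entourages X"
    show "((\<lambda>p. adist A (g (fst p)) (g (snd p))) \<longlongrightarrow> 0) (pairs_at_infinity X F)"
    proof (rule tendsto_0_le)
      show "\<forall>\<^sub>F p in pairs_at_infinity X F. adist A (g (fst p)) (g (snd p))
          \<le> adist A (g (fst p)) (h (fst p)) + adist A (h (fst p)) (h (snd p)) + adist A (g (snd p)) (h (snd p))"
        using eventually_pairs
      proof eventually_elim
        fix p assume "p \<in> F"
        then have p: "fst p \<in> points X" "snd p \<in> points X" using entourage_points[OF F] by auto
        then have mem: "g (fst p) \<in> elems A" "g (snd p) \<in> elems A" "h (fst p) \<in> elems A" "h (snd p) \<in> elems A"
          using gA h by auto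
        show "adist A (g (fst p)) (g (snd p))
            \<le> adist A (g (fst p)) (h (fst p)) + adist A (h (fst p)) (h (snd p)) + adist A (g (snd p)) (h (snd p))"
          using metric.triangle[OF mem(1,3,2)] metric.triangle[OF mem(3,4,2)]
            metric.commute[of "g (snd p)" "h (snd p)"] by linarith
      qed
      show "((\<lambda>p. adist A (g (fst p)) (h (fst p)) + adist A (h (fst p)) (h (snd p)) + adist A (g (snd p)) (h (snd p)))
          \<longlongrightarrow> 0) (pairs_at_infinity X F)"
        using tendsto_add[OF tendsto_add[OF filterlim_compose[OF lim filterlim_fst[OF F]] variation[OF F]]
            filterlim_compose[OF lim filterlim_snd[OF F]]] by simp
    qed simp
  qed
  then show ?thesis using lim by blast
qed

end

section \<open>The map induced by a coarse map\<close>

context function_algebra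
begin

definition asymptotic :: "('x \<Rightarrow> 'a) \<Rightarrow> ('x \<Rightarrow> 'a) \<Rightarrow> bool"
  where "asymptotic u v \<longleftrightarrow> ((\<lambda>x. adist A (u x) (v x)) \<longlongrightarrow> 0) (at_coarse_infinity X)"

abbreviation corona_coset :: "('x \<Rightarrow> 'a) \<Rightarrow> ('x \<Rightarrow> 'a) set"
  where "corona_coset f \<equiv> acoset V C0 f"

lemma asymptoticI:
  assumes "\<And>x. x \<in> points X \<Longrightarrow> adist A (u x) (v x) \<le> w x" "(w \<longlongrightarrow> 0) (at_coarse_infinity X)"
  shows "asymptotic u v"
  unfolding asymptotic_def
  by (rule tendsto_0_le[OF eventually_mono[OF eventually_points] _ assms(2)]) (simp_all add: assms(1))

lemma asymptotic_sym: "asymptotic u v \<Longrightarrow> asymptotic v u"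
  by (simp add: asymptotic_def metric.commute)

lemma asymptotic_trans:
  assumes "asymptotic u v" "asymptotic v w"
    and "\<And>x. x \<in> points X \<Longrightarrow> u x \<in> elems A \<and> v x \<in> elems A \<and> w x \<in> elems A"
  shows "asymptotic u w"
proof (rule asymptoticI)
  show "((\<lambda>x. adist A (u x) (v x) + adist A (v x) (w x)) \<longlongrightarrow> 0) (at_coarse_infinity X)"
    using tendsto_add[OF assms(1,2)[unfolded asymptotic_def]] by simp
qed (simp add: assms(3) metric.triangle)

lemma asymptotic_cong:
  assumes "asymptotic u v" "\<And>x. x \<in> points X \<Longrightarrow> u' x = u x" "\<And>x. x \<in> points X \<Longrightarrow> v' x = v x"
  shows "asymptotic u' v'"
  by (rule asymptoticI[OF _ assms(1)[unfolded asymptotic_def]]) (simp add: assms(2,3))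

lemma asymptotic_refl: "(\<And>x. x \<in> points X \<Longrightarrow> u x \<in> elems A) \<Longrightarrow> asymptotic u u"
  by (rule asymptoticI[OF _ tendsto_const]) simp

lemma diff_mem_C0_iff:
  assumes "f \<in> elems V" "g \<in> elems V" shows "adiff V f g \<in> C0 \<longleftrightarrow> asymptotic f g"
proof -
  interpret V: cstar_seminormed V by (rule cstar_seminormed_V)
  have "\<forall>\<^sub>F x in at_coarse_infinity X. anorm A (adiff V f g x) = adist A (f x) (g x)"
    using eventually_points by eventually_elim (simp add: assms diff_V adist_eq)
  then show ?thesis
    using assms by (simp add: mem_C0_iff_V asymptotic_def tendsto_cong)
qed

lemma mem_corona_coset_iff:
  "f \<in> elems V \<Longrightarrow> g \<in> corona_coset f \<longleftrightarrow> g \<in> elems V \<and> asymptotic g f"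
  by (auto simp: acoset_def diff_mem_C0_iff)

lemma asymptotic_ops:
  assumes u: "\<And>x. x \<in> points X \<Longrightarrow> u x \<in> elems A" and v: "\<And>x. x \<in> points X \<Longrightarrow> v x \<in> elems A"
    and uv: "asymptotic u v"
  shows "asymptotic (\<lambda>x. c \<odot> u x) (\<lambda>x. c \<odot> v x)"
    and "asymptotic (\<lambda>x. astar A (u x)) (\<lambda>x. astar A (v x))"
proof -
  note uv' = uv[unfolded asymptotic_def]
  show "asymptotic (\<lambda>x. c \<odot> u x) (\<lambda>x. c \<odot> v x)"
    by (rule asymptoticI[OF _ tendsto_mult_right_zero[OF uv', of "cmod c"]])
      (simp add: u v adist_eq scale_diff norm_scale)
  show "asymptotic (\<lambda>x. astar A (u x)) (\<lambda>x. astar A (v x))"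
    by (rule asymptoticI[OF _ uv']) (simp add: u v adist_eq norm_star_diff)
qed

text \<open>
  Boundedness enters in the product, through \<open>u u' - v v' = u (u' - v') + (u - v) v'\<close>.
\<close>

lemma asymptotic_binary_ops:
  assumes u: "\<And>x. x \<in> points X \<Longrightarrow> u x \<in> elems A" and v: "\<And>x. x \<in> points X \<Longrightarrow> v x \<in> elems A"
    and u': "\<And>x. x \<in> points X \<Longrightarrow> u' x \<in> elems A" and v': "\<And>x. x \<in> points X \<Longrightarrow> v' x \<in> elems A"
    and uv: "asymptotic u v" and uv': "asymptotic u' v'"
    and bound: "\<And>x. x \<in> points X \<Longrightarrow> anorm A (u x) \<le> C" "\<And>x. x \<in> points X \<Longrightarrow> anorm A (v' x) \<le> C'"
  shows "asymptotic (\<lambda>x. u x \<oplus> u' x) (\<lambda>x. v x \<oplus> v' x)"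
    and "asymptotic (\<lambda>x. u x \<otimes> u' x) (\<lambda>x. v x \<otimes> v' x)"
proof -
  note lim = uv[unfolded asymptotic_def] uv'[unfolded asymptotic_def]
  show "asymptotic (\<lambda>x. u x \<oplus> u' x) (\<lambda>x. v x \<oplus> v' x)"
  proof (rule asymptoticI)
    show "((\<lambda>x. adist A (u x) (v x) + adist A (u' x) (v' x)) \<longlongrightarrow> 0) (at_coarse_infinity X)"
      using tendsto_add[OF lim] by simp
  qed (simp add: u v u' v' adist_eq norm_add_diff_add)
  show "asymptotic (\<lambda>x. u x \<otimes> u' x) (\<lambda>x. v x \<otimes> v' x)"
  proof (rule asymptoticI)
    show "((\<lambda>x. C * adist A (u' x) (v' x) + adist A (u x) (v x) * C') \<longlongrightarrow> 0) (at_coarse_infinity X)"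
      using tendsto_add[OF tendsto_mult_right_zero[OF lim(2), of C] tendsto_mult_left_zero[OF lim(1), of C']]
      by simp
    fix x assume x: "x \<in> points X"
    have "anorm A (u x \<otimes> u' x \<ominus> v x \<otimes> v' x)
        \<le> anorm A (u x) * anorm A (u' x \<ominus> v' x) + anorm A (u x \<ominus> v x) * anorm A (v' x)"
      using x by (simp add: u v u' v' norm_mult_diff)
    also have "\<dots> \<le> C * anorm A (u' x \<ominus> v' x) + anorm A (u x \<ominus> v x) * C'"
      using x bound by (intro add_mono mult_right_mono mult_left_mono) (auto simp: u v u' v' norm_nonneg)
    finally show "adist A (u x \<otimes> u' x) (v x \<otimes> v' x) \<le> C * adist A (u' x) (v' x) + adist A (u x) (v x) * C'"
      using x by (simp add: u v u' v' adist_eq)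
  qed
qed

end

locale coarse_map = X: coarse X + Y: coarse Y
  for X :: "'x coarse_data" and Y :: "'y coarse_data" +
  fixes \<phi> assumes coarse_map: "\<phi> \<in> coarse_maps X Y"
begin

lemma maps_points: "x \<in> points X \<Longrightarrow> \<phi> x \<in> points Y"
  and maps_entourage: "E \<in> entourages X \<Longrightarrow> map_prod \<phi> \<phi> ` E \<in> entourages Y"
  and bounded_vimage: "coarsely_bounded Y B \<Longrightarrow> coarsely_bounded X (\<phi> -` B \<inter> points X)"
  using coarse_map by (auto simp: coarse_maps_def)

lemma filterlim_map: "filterlim \<phi> (at_coarse_infinity Y) (at_coarse_infinity X)"
  unfolding filterlim_iff X.eventually_at_coarse_infinity Y.eventually_at_coarse_infinity
proof safe
  fix P B assume "coarsely_bounded Y B" "\<forall>y\<in>points Y - B. P y"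
  then show "\<exists>B. coarsely_bounded X B \<and> (\<forall>x\<in>points X - B. P (\<phi> x))"
    using maps_points by (intro exI[of _ "\<phi> -` B \<inter> points X"]) (auto simp: bounded_vimage)
qed

lemma filterlim_map_pairs:
  assumes E: "E \<in> entourages X"
  shows "filterlim (map_prod \<phi> \<phi>) (pairs_at_infinity Y (map_prod \<phi> \<phi> ` E)) (pairs_at_infinity X E)"
  unfolding filterlim_iff X.eventually_pairs_at_infinity Y.eventually_pairs_at_infinity
proof safe
  fix P B assume B: "coarsely_bounded Y B"
    and P: "\<forall>x y. (x, y) \<in> map_prod \<phi> \<phi> ` E \<longrightarrow> x \<notin> B \<longrightarrow> P (x, y)"
  have "P (map_prod \<phi> \<phi> (x, y))" if "(x, y) \<in> E" "x \<notin> \<phi> -` B \<inter> points X" for x y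
  proof -
    have "(\<phi> x, \<phi> y) \<in> map_prod \<phi> \<phi> ` E" using that(1) by force
    moreover have "\<phi> x \<notin> B" using that X.entourage_points[OF E] by auto
    ultimately show ?thesis using P by simp
  qed
  then show "\<exists>B. coarsely_bounded X B \<and> (\<forall>x y. (x, y) \<in> E \<longrightarrow> x \<notin> B \<longrightarrow> P (map_prod \<phi> \<phi> (x, y)))"
    using bounded_vimage[OF B] by blast
qed

lemma filterlim_close:
  assumes "close_maps X Y \<phi> \<psi>"
  shows "filterlim (\<lambda>x. (\<phi> x, \<psi> x)) (pairs_at_infinity Y ((\<lambda>x. (\<phi> x, \<psi> x)) ` points X))
    (at_coarse_infinity X)"
  unfolding filterlim_iff X.eventually_at_coarse_infinity Y.eventually_pairs_at_infinity
proof safe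
  fix P B assume "coarsely_bounded Y B"
    "\<forall>x y. (x, y) \<in> (\<lambda>x. (\<phi> x, \<psi> x)) ` points X \<longrightarrow> x \<notin> B \<longrightarrow> P (x, y)"
  then show "\<exists>B. coarsely_bounded X B \<and> (\<forall>x\<in>points X - B. P (\<phi> x, \<psi> x))"
    by (intro exI[of _ "\<phi> -` B \<inter> points X"]) (auto simp: bounded_vimage)
qed

end

text \<open>
  This is \<open>corona_map\<close> for an arbitrary coefficient algebra and before restriction to the corona.
\<close>

definition pullback ::
    "'a normed_star_algebra \<Rightarrow> 'x coarse_data \<Rightarrow> ('x \<Rightarrow> 'y) \<Rightarrow> ('y \<Rightarrow> 'a) set \<Rightarrow> ('x \<Rightarrow> 'a) set"
  where "pullback A X \<phi> P = {g \<in> elems (vv_functions A X). \<exists>f\<in>P.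
    vanishes_at_infinity X (\<lambda>x. ennreal (adist A (g x) (f (\<phi> x))))}"

locale coefficient_map = coarse_map X Y \<phi> + X: function_algebra X A + Y: function_algebra Y A
  for X :: "'x coarse_data" and Y :: "'y coarse_data" and \<phi> and A :: "'a normed_star_algebra" (structure)
begin

lemma exists_representative:
  assumes f: "f \<in> elems Y.V" obtains g where "g \<in> elems X.V" "X.asymptotic g (\<lambda>x. f (\<phi> x))"
proof -
  obtain B where B: "\<And>y. y \<in> points Y \<Longrightarrow> anorm A (f y) \<le> B" using Y.V_bounded[OF f] by blast
  have "\<exists>g \<in> elems X.V. ((\<lambda>x. adist A (g x) (f (\<phi> x))) \<longlongrightarrow> 0) (at_coarse_infinity X)"
  proof (rule X.exists_V_approximation)
    fix x assume "x \<in> points X"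
    then show "f (\<phi> x) \<in> elems A" "anorm A (f (\<phi> x)) \<le> B" using f B maps_points by auto
  next
    fix E assume E: "E \<in> entourages X"
    show "((\<lambda>p. adist A (f (\<phi> (fst p))) (f (\<phi> (snd p)))) \<longlongrightarrow> 0) (pairs_at_infinity X E)"
      using filterlim_compose[OF Y.V_variation[OF f maps_entourage[OF E]] filterlim_map_pairs[OF E]]
      by simp
  qed
  then show thesis using that by (auto simp: X.asymptotic_def)
qed

lemma asymptotic_compose:
  assumes "Y.asymptotic u v" shows "X.asymptotic (\<lambda>x. u (\<phi> x)) (\<lambda>x. v (\<phi> x))"
  using filterlim_compose[OF assms[unfolded Y.asymptotic_def] filterlim_map]
  by (simp add: X.asymptotic_def)

text \<open>
  Replacing \<open>f\<close> by another representative changes \<open>f \<circ> \<phi>\<close> by a function that vanishes at infinity,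
  because \<open>\<phi>\<close> maps infinity to infinity; the functions asymptotic to \<open>f \<circ> \<phi>\<close> then form one class.
\<close>

lemma pullback_coset:
  assumes f: "f \<in> elems Y.V" and g: "g \<in> elems X.V" and gf: "X.asymptotic g (\<lambda>x. f (\<phi> x))"
  shows "pullback A X \<phi> (Y.corona_coset f) = X.corona_coset g"
proof -
  have mem: "k (\<phi> x) \<in> elems A" if "k \<in> elems Y.V" "x \<in> points X" for k x
    using that maps_points by simp
  have pullback: "g' \<in> pullback A X \<phi> (Y.corona_coset f) \<longleftrightarrow>
      g' \<in> elems X.V \<and> (\<exists>f'\<in>Y.corona_coset f. X.asymptotic g' (\<lambda>x. f' (\<phi> x)))" for g'
    by (simp add: pullback_def X.vanishes_at_infinity_iff X.asymptotic_def)
  have "X.asymptotic g' g"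
    if g': "g' \<in> elems X.V" and f': "f' \<in> elems Y.V" "Y.asymptotic f' f" "X.asymptotic g' (\<lambda>x. f' (\<phi> x))" for g' f'
  proof -
    have "X.asymptotic g' (\<lambda>x. f (\<phi> x))"
      using X.asymptotic_trans[OF f'(3) asymptotic_compose[OF f'(2)]] g' f f'(1) mem by simp
    then show ?thesis
      using X.asymptotic_trans[OF _ X.asymptotic_sym[OF gf]] g g' f mem by simp
  qed
  moreover have "X.asymptotic g' (\<lambda>x. f (\<phi> x))" if "g' \<in> elems X.V" "X.asymptotic g' g" for g'
    using X.asymptotic_trans[OF that(2) gf] that(1) g f mem by simp
  moreover have "f \<in> Y.corona_coset f"
    using f Y.asymptotic_refl by (simp add: Y.mem_corona_coset_iff)
  ultimately show ?thesis
    unfolding set_eq_iff pullback X.mem_corona_coset_iff[OF g] Y.mem_corona_coset_iff[OF f] Bex_def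
    by blast
qed

lemma pullback_star_hom:
  "restrict (pullback A X \<phi>) (elems (quotient_algebra Y.V Y.C0))
    \<in> star_homs (quotient_algebra Y.V Y.C0) (quotient_algebra X.V X.C0)" (is "?h \<in> star_homs ?QY ?QX")
proof -
  interpret IX: star_ideal X.V X.C0 by (rule X.star_ideal_C0)
  interpret IY: star_ideal Y.V Y.C0 by (rule Y.star_ideal_C0)
  interpret QY: star_algebra ?QY by (rule IY.star_algebra_Q)
  have h: "?h (Y.corona_coset f) = X.corona_coset g"
    if "f \<in> elems Y.V" "g \<in> elems X.V" "X.asymptotic g (\<lambda>x. f (\<phi> x))" for f g
    using pullback_coset[OF that] that(1) by (simp add: IY.elems_Q)
  have rep: "\<exists>f g. f \<in> elems Y.V \<and> g \<in> elems X.V \<and> X.asymptotic g (\<lambda>x. f (\<phi> x)) \<and>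
      P = Y.corona_coset f \<and> ?h P = X.corona_coset g" if "P \<in> elems ?QY" for P
  proof -
    from that[unfolded IY.elems_Q] obtain f where f: "P = Y.corona_coset f" "f \<in> elems Y.V" by (rule imageE)
    obtain g where g: "g \<in> elems X.V" "X.asymptotic g (\<lambda>x. f (\<phi> x))" using exists_representative[OF f(2)] .
    show ?thesis using f g h[OF f(2) g] by (intro exI[of _ f] exI[of _ g]) simp
  qed
  have X_mem: "g x \<in> elems A" if "g \<in> elems X.V" "x \<in> points X" for g x using that by simp
  have Y_mem: "f (\<phi> x) \<in> elems A" if "f \<in> elems Y.V" "x \<in> points X" for f x
    using that maps_points by simp
  show ?thesis
    unfolding star_homs_def
  proof (intro CollectI conjI ballI allI)
    show "?h \<in> elems ?QY \<rightarrow>\<^sub>E elems ?QX"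
    proof (intro PiE_I)
      fix P assume "P \<in> elems ?QY"
      then obtain g where "g \<in> elems X.V" "?h P = X.corona_coset g" using rep by blast
      then show "?h P \<in> elems ?QX" by (simp add: IX.elems_Q)
    qed simp
    fix P assume P: "P \<in> elems ?QY"
    obtain f g where f: "f \<in> elems Y.V" "P = Y.corona_coset f"
      and g: "g \<in> elems X.V" "X.asymptotic g (\<lambda>x. f (\<phi> x))" "?h P = X.corona_coset g"
      using rep[OF P] by blast
    note ops = X.asymptotic_ops[OF X_mem[OF g(1)] Y_mem[OF f(1)] g(2)]
    show "?h (c \<odot>\<^bsub>?QY\<^esub> P) = c \<odot>\<^bsub>?QX\<^esub> ?h P" for c
    proof -
      have "X.asymptotic (c \<odot>\<^bsub>X.V\<^esub> g) (\<lambda>x. (c \<odot>\<^bsub>Y.V\<^esub> f) (\<phi> x))"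
        by (rule X.asymptotic_cong[OF ops(1)]) (simp_all add: X.V_ops Y.V_ops maps_points)
      then have "?h (Y.corona_coset (c \<odot>\<^bsub>Y.V\<^esub> f)) = X.corona_coset (c \<odot>\<^bsub>X.V\<^esub> g)"
        by (intro h Y.V_closed X.V_closed f g)
      then show ?thesis unfolding g(3) unfolding f(2) IY.scale_Q[OF f(1)] IX.scale_Q[OF g(1)] .
    qed
    show "?h (astar ?QY P) = astar ?QX (?h P)"
    proof -
      have "X.asymptotic (astar X.V g) (\<lambda>x. (astar Y.V f) (\<phi> x))"
        by (rule X.asymptotic_cong[OF ops(2)]) (simp_all add: X.V_ops Y.V_ops maps_points)
      then have "?h (Y.corona_coset (astar Y.V f)) = X.corona_coset (astar X.V g)"
        by (intro h Y.V_closed X.V_closed f g)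
      then show ?thesis unfolding g(3) unfolding f(2) IY.star_Q[OF f(1)] IX.star_Q[OF g(1)] .
    qed
    fix P' assume P': "P' \<in> elems ?QY"
    obtain f' g' where f': "f' \<in> elems Y.V" "P' = Y.corona_coset f'"
      and g': "g' \<in> elems X.V" "X.asymptotic g' (\<lambda>x. f' (\<phi> x))" "?h P' = X.corona_coset g'"
      using rep[OF P'] by blast
    obtain B where B: "\<And>x. x \<in> points X \<Longrightarrow> anorm A (g x) \<le> B" using X.V_bounded[OF g(1)] by blast
    obtain B' where B': "\<And>y. y \<in> points Y \<Longrightarrow> anorm A (f' y) \<le> B'" using Y.V_bounded[OF f'(1)] by blast
    note ops2 = X.asymptotic_binary_ops[OF X_mem[OF g(1)] Y_mem[OF f(1)] X_mem[OF g'(1)] Y_mem[OF f'(1)]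
        g(2) g'(2) B B'[OF maps_points]]
    show "?h (P \<oplus>\<^bsub>?QY\<^esub> P') = ?h P \<oplus>\<^bsub>?QX\<^esub> ?h P'"
    proof -
      have "X.asymptotic (g \<oplus>\<^bsub>X.V\<^esub> g') (\<lambda>x. (f \<oplus>\<^bsub>Y.V\<^esub> f') (\<phi> x))"
        by (rule X.asymptotic_cong[OF ops2(1)]) (simp_all add: X.V_ops Y.V_ops maps_points)
      then have "?h (Y.corona_coset (f \<oplus>\<^bsub>Y.V\<^esub> f')) = X.corona_coset (g \<oplus>\<^bsub>X.V\<^esub> g')"
        by (intro h Y.V_closed X.V_closed f g f' g')
      then show ?thesis
        unfolding g(3) g'(3) unfolding f(2) f'(2) IY.add_Q[OF f(1) f'(1)] IX.add_Q[OF g(1) g'(1)] .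
    qed
    show "?h (P \<otimes>\<^bsub>?QY\<^esub> P') = ?h P \<otimes>\<^bsub>?QX\<^esub> ?h P'"
    proof -
      have "X.asymptotic (g \<otimes>\<^bsub>X.V\<^esub> g') (\<lambda>x. (f \<otimes>\<^bsub>Y.V\<^esub> f') (\<phi> x))"
        by (rule X.asymptotic_cong[OF ops2(2)]) (simp_all add: X.V_ops Y.V_ops maps_points)
      then have "?h (Y.corona_coset (f \<otimes>\<^bsub>Y.V\<^esub> f')) = X.corona_coset (g \<otimes>\<^bsub>X.V\<^esub> g')"
        by (intro h Y.V_closed X.V_closed f g f' g')
      then show ?thesis
        unfolding g(3) g'(3) unfolding f(2) f'(2) IY.mult_Q[OF f(1) f'(1)] IX.mult_Q[OF g(1) g'(1)] .
    qed
  qed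
qed

lemma pullback_continuous:
  assumes \<phi>: "continuous_map (ctop X) (ctop Y) \<phi>" and f: "f \<in> elems Y.V"
  shows "pullback A X \<phi> (Y.corona_coset f) = X.corona_coset (compose (points X) f \<phi>)"
proof (rule pullback_coset[OF f])
  let ?g = "compose (points X) f \<phi>"
  have eq: "?g x = f (\<phi> x)" if "x \<in> points X" for x using that by (simp add: compose_def)
  have mem: "f (\<phi> x) \<in> elems A" if "x \<in> points X" for x using that maps_points f by simp
  show "?g \<in> elems X.V"
    unfolding X.mem_V_iff X.vanishing_variation_iff
  proof (intro conjI ballI)
    show "?g \<in> points X \<rightarrow>\<^sub>E elems A" using mem by (auto simp: compose_def)
    have "X.continuous_function (f \<circ> \<phi>)"
      using \<phi> Y.V_continuous[OF f] by (rule continuous_map_compose)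
    then show "X.continuous_function ?g"
      by (rule continuous_map_eq) (simp add: eq)
    obtain B where "\<And>y. y \<in> points Y \<Longrightarrow> anorm A (f y) \<le> B" using Y.V_bounded[OF f] by blast
    then show "\<exists>C. \<forall>x\<in>points X. anorm A (?g x) \<le> C" using maps_points by (auto simp: eq)
    fix E assume E: "E \<in> entourages X"
    have "((\<lambda>p. adist A (f (\<phi> (fst p))) (f (\<phi> (snd p)))) \<longlongrightarrow> 0) (pairs_at_infinity X E)"
      using filterlim_compose[OF Y.V_variation[OF f maps_entourage[OF E]] filterlim_map_pairs[OF E]]
      by simp
    moreover have "\<forall>\<^sub>F p in pairs_at_infinity X E. adist A (?g (fst p)) (?g (snd p))
        \<le> adist A (f (\<phi> (fst p))) (f (\<phi> (snd p)))"
      using X.eventually_pairs by eventually_elim (use X.entourage_points[OF E] eq in auto)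
    ultimately show "((\<lambda>p. adist A (?g (fst p)) (?g (snd p))) \<longlongrightarrow> 0) (pairs_at_infinity X E)"
      by (rule tendsto_0_le[rotated 2]) simp
  qed
  show "X.asymptotic ?g (\<lambda>x. f (\<phi> x))"
    by (rule X.asymptotic_cong[OF X.asymptotic_refl[OF mem]]) (simp_all add: eq)
qed

text \<open>
  Along the entourage of all \<open>(\<phi> x, \<psi> x)\<close> the variation of \<open>f\<close> vanishes at infinity, which means that
  \<open>f \<circ> \<phi>\<close> and \<open>f \<circ> \<psi>\<close> are asymptotic.
\<close>

lemma pullback_close:
  assumes \<psi>: "\<psi> \<in> coarse_maps X Y" and close: "close_maps X Y \<phi> \<psi>" and f: "f \<in> elems Y.V"
  shows "pullback A X \<phi> (Y.corona_coset f) = pullback A X \<psi> (Y.corona_coset f)"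
proof -
  interpret \<psi>: coefficient_map X Y \<psi> A by unfold_locales (rule \<psi>)
  obtain g where g: "g \<in> elems X.V" "X.asymptotic g (\<lambda>x. f (\<phi> x))" using exists_representative[OF f] .
  have "X.asymptotic (\<lambda>x. f (\<phi> x)) (\<lambda>x. f (\<psi> x))"
    using filterlim_compose[OF Y.V_variation[OF f close[unfolded close_maps_def]] filterlim_close[OF close]]
    by (simp add: X.asymptotic_def)
  then have "X.asymptotic g (\<lambda>x. f (\<psi> x))"
    using X.asymptotic_trans[OF g(2)] g(1) f maps_points \<psi>.maps_points by simp
  then show ?thesis using pullback_coset[OF f g] \<psi>.pullback_coset[OF f g(1)] by simp
qed

end

section \<open>The coarse category\<close>

lemma space_borel_of: "space (borel_of T) = topspace T"
  unfolding borel_of_def by (rule space_measure_of) (auto dest: openin_subset)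

lemma compose_coarse_maps:
  assumes X: "coarse_space X" and \<phi>: "\<phi> \<in> coarse_maps X Y" and \<psi>: "\<psi> \<in> coarse_maps Y Z"
  shows "compose (points X) \<psi> \<phi> \<in> coarse_maps X Z"
proof -
  interpret X: coarse X by unfold_locales (rule X)
  have pts: "\<phi> x \<in> points Y" if "x \<in> points X" for x using \<phi> that by (auto simp: coarse_maps_def)
  show ?thesis
    unfolding coarse_maps_def
  proof (intro CollectI conjI ballI allI impI)
    show "compose (points X) \<psi> \<phi> \<in> points X \<rightarrow>\<^sub>E points Z"
      using \<phi> \<psi> pts by (auto simp: coarse_maps_def compose_def)
    have "\<psi> \<circ> \<phi> \<in> borel_of (ctop X) \<rightarrow>\<^sub>M borel_of (ctop Z)"
      using \<phi> \<psi> by (intro measurable_comp) (auto simp: coarse_maps_def)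
    then show "compose (points X) \<psi> \<phi> \<in> borel_of (ctop X) \<rightarrow>\<^sub>M borel_of (ctop Z)"
      by (subst measurable_cong[where g = "\<psi> \<circ> \<phi>"]) (simp_all add: space_borel_of compose_def)
    fix B assume "coarsely_bounded Z B"
    then have "coarsely_bounded Y (\<psi> -` B \<inter> points Y)" using \<psi> by (simp add: coarse_maps_def)
    then have "coarsely_bounded X (\<phi> -` (\<psi> -` B \<inter> points Y) \<inter> points X)"
      using \<phi> unfolding coarse_maps_def by blast
    moreover have "\<phi> -` (\<psi> -` B \<inter> points Y) \<inter> points X = compose (points X) \<psi> \<phi> -` B \<inter> points X"
      using pts by (auto simp: compose_def)
    ultimately show "coarsely_bounded X (compose (points X) \<psi> \<phi> -` B \<inter> points X)" by simp
  next
    fix E assume E: "E \<in> entourages X"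
    then have "map_prod \<psi> \<psi> ` (map_prod \<phi> \<phi> ` E) \<in> entourages Z"
      using \<phi> \<psi> unfolding coarse_maps_def by blast
    moreover have "map_prod (compose (points X) \<psi> \<phi>) (compose (points X) \<psi> \<phi>) ` E
        = map_prod \<psi> \<psi> ` (map_prod \<phi> \<phi> ` E)"
      unfolding image_image
      by (intro image_cong refl) (use X.entourage_points[OF E] in \<open>auto simp: compose_def\<close>)
    ultimately show "map_prod (compose (points X) \<psi> \<phi>) (compose (points X) \<psi> \<phi>) ` E \<in> entourages Z"
      by simp
  qed
qed

lemma ident_coarse_map:
  assumes X: "coarse_space X" shows "(\<lambda>x\<in>points X. x) \<in> coarse_maps X X"
proof -
  interpret X: coarse X by unfold_locales (rule X)
  show ?thesis
    unfolding coarse_maps_def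
  proof (intro CollectI conjI ballI allI impI)
    show "(\<lambda>x\<in>points X. x) \<in> borel_of (ctop X) \<rightarrow>\<^sub>M borel_of (ctop X)"
      by (subst measurable_cong[where g = "\<lambda>x. x"]) (simp_all add: space_borel_of)
    show "coarsely_bounded X ((\<lambda>x\<in>points X. x) -` B \<inter> points X)" if "coarsely_bounded X B" for B
      using that by (rule X.bounded_subset) auto
    fix E assume E: "E \<in> entourages X"
    then show "map_prod (\<lambda>x\<in>points X. x) (\<lambda>x\<in>points X. x) ` E \<in> entourages X"
      by (rule X.entourage_subset) (use X.entourage_points[OF E] in auto)
  qed auto
qed

lemma close_maps_refl:
  assumes "coarse_space Y" "\<phi> \<in> coarse_maps X Y" shows "close_maps X Y \<phi> \<phi>"
proof -
  interpret Y: coarse Y by unfold_locales (rule assms(1))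
  show ?thesis
    unfolding close_maps_def
    by (rule Y.entourage_subset[OF Y.entourage_Id]) (use assms(2) in \<open>auto simp: coarse_maps_def\<close>)
qed

lemma close_maps_sym:
  assumes "coarse_space Y" "close_maps X Y \<phi> \<psi>" shows "close_maps X Y \<psi> \<phi>"
proof -
  interpret Y: coarse Y by unfold_locales (rule assms(1))
  show ?thesis
    using Y.entourage_converse[OF assms(2)[unfolded close_maps_def]]
    unfolding close_maps_def by (rule Y.entourage_subset) auto
qed

lemma close_maps_trans:
  assumes "coarse_space Y" "close_maps X Y \<phi> \<psi>" "close_maps X Y \<psi> \<theta>" shows "close_maps X Y \<phi> \<theta>"
proof -
  interpret Y: coarse Y by unfold_locales (rule assms(1))
  show ?thesis
    using Y.entourage_comp[OF assms(2,3)[unfolded close_maps_def]]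
    unfolding close_maps_def by (rule Y.entourage_subset) auto
qed

text \<open>
  The pair \<open>(\<psi> (\<phi> x), \<psi>' (\<phi>' x))\<close> is reached by way of \<open>\<psi> (\<phi>' x)\<close>: the first step lies in the image
  under \<open>\<psi>\<close> of an entourage, the second in the entourage that expresses closeness of \<open>\<psi>\<close> and \<open>\<psi>'\<close>.
\<close>

lemma close_maps_compose:
  assumes Z: "coarse_space Z"
    and \<phi>: "\<phi> \<in> coarse_maps X Y" "\<phi>' \<in> coarse_maps X Y" "close_maps X Y \<phi> \<phi>'"
    and \<psi>: "\<psi> \<in> coarse_maps Y Z" "close_maps Y Z \<psi> \<psi>'"
  shows "close_maps X Z (compose (points X) \<psi> \<phi>) (compose (points X) \<psi>' \<phi>')"
proof -
  interpret Z: coarse Z by unfold_locales (rule Z)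
  have "map_prod \<psi> \<psi> ` ((\<lambda>x. (\<phi> x, \<phi>' x)) ` points X) \<in> entourages Z"
    using \<psi>(1) \<phi>(3) unfolding coarse_maps_def close_maps_def by blast
  from Z.entourage_comp[OF this \<psi>(2)[unfolded close_maps_def]] show ?thesis
    unfolding close_maps_def
  proof (rule Z.entourage_subset)
    show "(\<lambda>x. (compose (points X) \<psi> \<phi> x, compose (points X) \<psi>' \<phi>' x)) ` points X
      \<subseteq> map_prod \<psi> \<psi> ` ((\<lambda>x. (\<phi> x, \<phi>' x)) ` points X) O (\<lambda>y. (\<psi> y, \<psi>' y)) ` points Y"
    proof clarify
      fix x assume x: "x \<in> points X"
      have "(\<psi> (\<phi> x), \<psi> (\<phi>' x)) \<in> map_prod \<psi> \<psi> ` ((\<lambda>x. (\<phi> x, \<phi>' x)) ` points X)" using x by force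
      moreover have "(\<psi> (\<phi>' x), \<psi>' (\<phi>' x)) \<in> (\<lambda>y. (\<psi> y, \<psi>' y)) ` points Y"
        using x \<phi>(2) by (auto simp: coarse_maps_def)
      ultimately show "(compose (points X) \<psi> \<phi> x, compose (points X) \<psi>' \<phi>' x)
          \<in> map_prod \<psi> \<psi> ` ((\<lambda>x. (\<phi> x, \<phi>' x)) ` points X) O (\<lambda>y. (\<psi> y, \<psi>' y)) ` points Y"
        using x by (auto simp: compose_def)
    qed
  qed
qed

lemma closeness_class_eq:
  assumes "coarse_space Y" "close_maps X Y \<phi> \<psi>"
  shows "closeness_class X Y \<phi> = closeness_class X Y \<psi>"
  using close_maps_trans[OF assms(1)] close_maps_sym[OF assms(1)] assms(2)
  unfolding closeness_class_def by blast

lemma self_mem_closeness_class: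
  "\<lbrakk>coarse_space Y; \<phi> \<in> coarse_maps X Y\<rbrakk> \<Longrightarrow> \<phi> \<in> closeness_class X Y \<phi>"
  by (simp add: closeness_class_def close_maps_refl)

lemma Comp_coarse_category:
  assumes "coarse_space Y" "coarse_space Z" and \<phi>: "\<phi> \<in> coarse_maps X Y" and \<psi>: "\<psi> \<in> coarse_maps Y Z"
  shows "Comp coarse_category X Y Z (closeness_class Y Z \<psi>) (closeness_class X Y \<phi>)
    = closeness_class X Z (compose (points X) \<psi> \<phi>)"
proof -
  have "closeness_class X Z (compose (points X) \<psi>' \<phi>') = closeness_class X Z (compose (points X) \<psi> \<phi>)"
    if "\<psi>' \<in> closeness_class Y Z \<psi>" "\<phi>' \<in> closeness_class X Y \<phi>" for \<psi>' \<phi>'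
    using that assms close_maps_compose[OF assms(2) \<phi> _ _ \<psi>]
    by (intro closeness_class_eq[symmetric]) (auto simp: closeness_class_def)
  note * = this
  show ?thesis
    unfolding coarse_category_def
    by simp (intro UN_eq_constant[OF self_mem_closeness_class] * assms)
qed

lemma is_category_coarse: "is_category coarse_category"
proof -
  note C = coarse_category_def
  have Comp: "Comp coarse_category X Y Z (closeness_class Y Z \<psi>) (closeness_class X Y \<phi>)
      = closeness_class X Z (compose (points X) \<psi> \<phi>)"
    if "coarse_space Y" "coarse_space Z" "\<phi> \<in> coarse_maps X Y" "\<psi> \<in> coarse_maps Y Z"
    for X Y Z :: "'x coarse_data" and \<phi> \<psi>
    using Comp_coarse_category that by blast
  have unit: "compose (points X) \<phi> (\<lambda>x\<in>points X. x) = \<phi>" "compose (points X) (\<lambda>y\<in>points Y. y) \<phi> = \<phi>"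
    if "\<phi> \<in> coarse_maps X Y" for X Y :: "'x coarse_data" and \<phi>
    using that by (auto simp: coarse_maps_def compose_def PiE_def extensional_def restrict_def fun_eq_iff)
  have assoc: "compose (points W) \<theta> (compose (points W) \<psi> \<phi>)
      = compose (points W) (compose (points X) \<theta> \<psi>) \<phi>"
    if "\<phi> \<in> coarse_maps W X" for W X :: "'x coarse_data" and \<phi> \<psi> \<theta>
    using that by (auto simp: coarse_maps_def compose_def PiE_def fun_eq_iff)
  have Obj: "Obj coarse_category = {X :: 'x coarse_data. coarse_space X}"
    and Hom: "\<And>X Y :: 'x coarse_data. Hom coarse_category X Y = closeness_class X Y ` coarse_maps X Y"
    and Ident: "\<And>X :: 'x coarse_data. Ident coarse_category X = closeness_class X X (\<lambda>x\<in>points X. x)"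
    by (simp_all add: C)
  show ?thesis
    unfolding is_category_def Obj Hom Ident
    by (auto simp: Comp ident_coarse_map compose_coarse_maps unit assoc)
qed

lemma is_category_cstar: "is_category cstar_category"
proof -
  have compose: "compose (elems A) g f \<in> star_homs A C"
    if "f \<in> star_homs A B" "g \<in> star_homs B C" "cstar_algebra A"
    for A B C :: "'a normed_star_algebra" and f g
  proof -
    interpret A: cstar_algebra A by fact
    have "f a \<in> elems B" if "a \<in> elems A" for a
      using \<open>f \<in> star_homs A B\<close> that by (auto simp: star_homs_def)
    then show ?thesis using that(1,2) by (auto simp: star_homs_def compose_def)
  qed
  have ident: "(\<lambda>a\<in>elems A. a) \<in> star_homs A A" if "cstar_algebra A" for A :: "'a normed_star_algebra"
  proof -
    interpret A: cstar_algebra A by fact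
    show ?thesis by (auto simp: star_homs_def)
  qed
  have unit: "compose (elems A) f (\<lambda>a\<in>elems A. a) = f" "compose (elems A) (\<lambda>b\<in>elems B. b) f = f"
    if "f \<in> star_homs A B" for A B :: "'a normed_star_algebra" and f
    using that by (auto simp: star_homs_def compose_def PiE_def extensional_def restrict_def fun_eq_iff)
  have assoc: "compose (elems A) h (compose (elems A) g f) = compose (elems A) (compose (elems B) h g) f"
    if "f \<in> star_homs A B" for A B :: "'a normed_star_algebra" and f g h
    using that by (auto simp: star_homs_def compose_def PiE_def fun_eq_iff)
  show ?thesis
    unfolding is_category_def cstar_category_def
    by (auto simp: ident compose unit assoc)
qed


section \<open>Functoriality\<close>

lemma (in cstar_algebra) pullback_compose:
  assumes XYZ: "coarse_space X" "coarse_space Y" "coarse_space Z"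
    and \<phi>: "\<phi> \<in> coarse_maps X Y" and \<psi>: "\<psi> \<in> coarse_maps Y Z"
    and P: "P \<in> elems (quotient_algebra (vv_functions A Z) (C0_functions A (ctop Z)))"
  shows "pullback A X (compose (points X) \<psi> \<phi>) P = pullback A X \<phi> (pullback A Y \<psi> P)"
proof -
  interpret \<phi>: coefficient_map X Y \<phi> A by unfold_locales (use XYZ \<phi> in auto)
  interpret \<psi>: coefficient_map Y Z \<psi> A by unfold_locales (use XYZ \<psi> in auto)
  interpret \<psi>\<phi>: coefficient_map X Z "compose (points X) \<psi> \<phi>" A
    by unfold_locales (rule compose_coarse_maps[OF XYZ(1) \<phi> \<psi>])
  obtain f where f: "f \<in> elems \<psi>.Y.V" "P = \<psi>.Y.corona_coset f"
    using P star_ideal.elems_Q[OF \<psi>.Y.star_ideal_C0] by auto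
  obtain g where g: "g \<in> elems \<phi>.Y.V" "\<phi>.Y.asymptotic g (\<lambda>y. f (\<psi> y))"
    using \<psi>.exists_representative[OF f(1)] .
  obtain k where k: "k \<in> elems \<phi>.X.V" "\<phi>.X.asymptotic k (\<lambda>x. g (\<phi> x))"
    using \<phi>.exists_representative[OF g(1)] .
  have mem: "k x \<in> elems A \<and> g (\<phi> x) \<in> elems A \<and> f (\<psi> (\<phi> x)) \<in> elems A" if "x \<in> points X" for x
    using that k(1) g(1) f(1) \<phi>.maps_points \<psi>.maps_points by simp
  have "\<phi>.X.asymptotic k (\<lambda>x. f (\<psi> (\<phi> x)))"
    using \<phi>.X.asymptotic_trans[OF k(2) \<phi>.asymptotic_compose[OF g(2)] mem] .
  then have "\<phi>.X.asymptotic k (\<lambda>x. f (compose (points X) \<psi> \<phi> x))"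
    by (rule \<phi>.X.asymptotic_cong) (simp_all add: compose_def)
  then have "pullback A X (compose (points X) \<psi> \<phi>) P = \<phi>.X.corona_coset k"
    unfolding f(2) by (rule \<psi>\<phi>.pullback_coset[OF f(1) k(1)])
  then show ?thesis
    unfolding f(2) by (simp add: \<psi>.pullback_coset[OF f(1) g] \<phi>.pullback_coset[OF g(1) k])
qed

lemma (in cstar_algebra) pullback_ident:
  assumes X: "coarse_space X"
    and P: "P \<in> elems (quotient_algebra (vv_functions A X) (C0_functions A (ctop X)))"
  shows "pullback A X (\<lambda>x\<in>points X. x) P = P"
proof -
  interpret coefficient_map X X "\<lambda>x\<in>points X. x" A
    by unfold_locales (use X ident_coarse_map[OF X] in auto)
  obtain f where f: "f \<in> elems X.V" "P = X.corona_coset f"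
    using P star_ideal.elems_Q[OF X.star_ideal_C0] by auto
  have "X.asymptotic f f" using f(1) by (intro X.asymptotic_refl) simp
  then have "X.asymptotic f (\<lambda>x. f ((\<lambda>x\<in>points X. x) x))" by (rule X.asymptotic_cong) simp_all
  then show ?thesis unfolding f(2) by (rule pullback_coset[OF f(1) f(1)])
qed

lemma corona_eq:
  "corona D X = quotient_algebra (vv_functions (cstar_tensor D \<K>) X) (C0_functions (cstar_tensor D \<K>) (ctop X))"
  by (simp add: corona_def corona_functions_def corona_ideal_def)

lemma corona_map_eq:
  "corona_map D X Y \<phi> = restrict (pullback (cstar_tensor D \<K>) X \<phi>) (elems (corona D Y))"
  unfolding corona_map_def corona_functions_def by (intro restrict_ext) (simp add: pullback_def)

context
  fixes D :: "'d normed_star_algebra"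
  assumes D: "cstar_algebra D"
begin

lemma cstar_algebra_stabilization: "cstar_algebra (cstar_tensor D \<K>)"
proof -
  interpret D: cstar_algebra D by (rule D)
  show ?thesis
    by (rule cstar_algebra_tensor[OF D.star_algebra_axioms star_algebra_K D.norm_nonneg K_norm_nonneg])
qed

lemma function_algebraI: "coarse_space X \<Longrightarrow> function_algebra X (cstar_tensor D \<K>)"
  by (intro function_algebra.intro coarse.intro cstar_algebra_stabilization)

lemma coefficient_mapI:
  "\<lbrakk>coarse_space X; coarse_space Y; \<phi> \<in> coarse_maps X Y\<rbrakk> \<Longrightarrow> coefficient_map X Y \<phi> (cstar_tensor D \<K>)"
  by (intro coefficient_map.intro coarse_map.intro coarse_map_axioms.intro coarse.intro function_algebraI)

lemma cstar_algebra_stable_corona: "coarse_space X \<Longrightarrow> cstar_algebra (corona D X)"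
  unfolding corona_eq by (rule function_algebra.cstar_algebra_corona[OF function_algebraI])

lemma corona_map_star_hom:
  "\<lbrakk>coarse_space X; coarse_space Y; \<phi> \<in> coarse_maps X Y\<rbrakk>
    \<Longrightarrow> corona_map D X Y \<phi> \<in> star_homs (corona D Y) (corona D X)"
  unfolding corona_map_eq corona_eq by (rule coefficient_map.pullback_star_hom[OF coefficient_mapI])

lemma elems_corona: "elems (corona D Y) = corona_class D Y ` elems (corona_functions D Y)"
  by (simp add: corona_def quotient_algebra_def corona_class_def)

lemma corona_map_continuous:
  assumes "coarse_space X" "coarse_space Y" "\<phi> \<in> coarse_maps X Y"
    and "continuous_map (ctop X) (ctop Y) \<phi>" "f \<in> elems (corona_functions D Y)"
  shows "corona_map D X Y \<phi> (corona_class D Y f) = corona_class D X (compose (points X) f \<phi>)"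
  using coefficient_map.pullback_continuous[OF coefficient_mapI[OF assms(1-3)] assms(4), of f] assms(5)
  by (simp add: corona_map_eq elems_corona) (simp add: corona_class_def corona_functions_def corona_ideal_def)

lemma corona_map_close:
  assumes "coarse_space X" "coarse_space Y" "\<phi> \<in> coarse_maps X Y" "\<psi> \<in> coarse_maps X Y"
    and "close_maps X Y \<phi> \<psi>"
  shows "corona_map D X Y \<phi> = corona_map D X Y \<psi>"
  unfolding corona_map_eq
proof (rule restrict_ext)
  fix P assume "P \<in> elems (corona D Y)"
  then obtain f where "f \<in> elems (corona_functions D Y)" "P = corona_class D Y f"
    by (auto simp: elems_corona)
  then show "pullback (cstar_tensor D \<K>) X \<phi> P = pullback (cstar_tensor D \<K>) X \<psi> P"
    using coefficient_map.pullback_close[OF coefficient_mapI[OF assms(1-3)] assms(4,5), of f]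
    by (simp add: corona_class_def corona_functions_def corona_ideal_def)
qed

lemma corona_map_ident:
  assumes "coarse_space X"
  shows "corona_map D X X (\<lambda>x\<in>points X. x) = (\<lambda>P\<in>elems (corona D X). P)"
  unfolding corona_map_eq
  using cstar_algebra.pullback_ident[OF cstar_algebra_stabilization assms]
  by (intro restrict_ext) (simp add: corona_eq)

lemma corona_map_compose:
  assumes "coarse_space X" "coarse_space Y" "coarse_space Z"
    and "\<phi> \<in> coarse_maps X Y" "\<psi> \<in> coarse_maps Y Z"
  shows "corona_map D X Z (compose (points X) \<psi> \<phi>)
    = compose (elems (corona D Z)) (corona_map D X Y \<phi>) (corona_map D Y Z \<psi>)"
  unfolding corona_map_eq[of D X Z] compose_def[of "elems (corona D Z)"]
proof (rule restrict_ext)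
  fix P assume P: "P \<in> elems (corona D Z)"
  then have "pullback (cstar_tensor D \<K>) Y \<psi> P \<in> elems (corona D Y)"
    using corona_map_star_hom[OF assms(2,3,5)] by (auto simp: star_homs_def corona_map_eq)
  then show "pullback (cstar_tensor D \<K>) X (compose (points X) \<psi> \<phi>) P
      = corona_map D X Y \<phi> (corona_map D Y Z \<psi> P)"
    using cstar_algebra.pullback_compose[OF cstar_algebra_stabilization assms, of P] P
    by (simp add: corona_map_eq corona_eq[of D Z])
qed

end

theorem proposition13:
  fixes D :: "'d normed_star_algebra"
  assumes "cstar_algebra D"
  shows "(\<forall>(X :: 'x coarse_data) (Y :: 'y coarse_data) \<phi>.
            coarse_space X \<and> coarse_space Y \<and> \<phi> \<in> coarse_maps X Y \<longrightarrow>
            cstar_algebra (corona D X) \<and> cstar_algebra (corona D Y) \<and>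
            corona_map D X Y \<phi> \<in> star_homs (corona D Y) (corona D X) \<and>
            (continuous_map (ctop X) (ctop Y) \<phi> \<longrightarrow>
              (\<forall>f \<in> elems (corona_functions D Y).
                corona_map D X Y \<phi> (corona_class D Y f) =
                corona_class D X (compose (points X) f \<phi>)))) \<and>
         (\<forall>(X :: 'x coarse_data) (Y :: 'y coarse_data) \<phi> \<psi>.
            coarse_space X \<and> coarse_space Y \<and> \<phi> \<in> coarse_maps X Y \<and> \<psi> \<in> coarse_maps X Y \<and>
            close_maps X Y \<phi> \<psi> \<longrightarrow>
            corona_map D X Y \<phi> = corona_map D X Y \<psi>) \<and>
         (\<exists>G. contravariant_functor
               (coarse_category :: ('z coarse_data, ('z \<Rightarrow> 'z) set) category)
               (cstar_category :: (('z \<Rightarrow> 'd stable) set normed_star_algebra, _) category)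
               (corona D) G \<and>
             (\<forall>X Y \<phi>. coarse_space X \<and> coarse_space Y \<and> \<phi> \<in> coarse_maps X Y \<longrightarrow>
                G X Y (closeness_class X Y \<phi>) = corona_map D X Y \<phi>))"
proof -
  \<comment> \<open>Any representative of a closeness class gives the same map.\<close>
  define G where "G X Y F = corona_map D X Y (SOME \<phi>. \<phi> \<in> F)"
    for X Y :: "'z coarse_data" and F
  have G: "G X Y (closeness_class X Y \<phi>) = corona_map D X Y \<phi>"
    if "coarse_space X" "coarse_space Y" "\<phi> \<in> coarse_maps X Y" for X Y \<phi>
  proof -
    have "(SOME \<psi>. \<psi> \<in> closeness_class X Y \<phi>) \<in> closeness_class X Y \<phi>"
      using self_mem_closeness_class[OF that(2,3)] by (rule someI[of "\<lambda>\<psi>. \<psi> \<in> closeness_class X Y \<phi>"])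
    then show ?thesis
      unfolding G_def using that by (intro corona_map_close[OF assms, symmetric]) (auto simp: closeness_class_def)
  qed
  have "contravariant_functor
      (coarse_category :: ('z coarse_data, ('z \<Rightarrow> 'z) set) category)
      (cstar_category :: (('z \<Rightarrow> 'd stable) set normed_star_algebra, _) category)
      (corona D) G"
    unfolding contravariant_functor_def
  proof (intro conjI is_category_coarse is_category_cstar ballI)
    fix X :: "'z coarse_data" assume "X \<in> Obj coarse_category"
    then have X: "coarse_space X" by (simp add: coarse_category_def)
    show "corona D X \<in> Obj cstar_category" using cstar_algebra_stable_corona[OF assms X] by (simp add: cstar_category_def)
    show "G X X (Ident coarse_category X) = Ident cstar_category (corona D X)"
      using G[OF X X ident_coarse_map[OF X]] corona_map_ident[OF assms X]
      by (simp add: coarse_category_def cstar_category_def)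
    fix Y :: "'z coarse_data" assume "Y \<in> Obj coarse_category"
    then have Y: "coarse_space Y" by (simp add: coarse_category_def)
    fix F assume "F \<in> Hom coarse_category X Y"
    then obtain \<phi> where \<phi>: "\<phi> \<in> coarse_maps X Y" "F = closeness_class X Y \<phi>"
      by (auto simp: coarse_category_def)
    show "G X Y F \<in> Hom cstar_category (corona D Y) (corona D X)"
      using corona_map_star_hom[OF assms X Y \<phi>(1)] by (simp add: cstar_category_def \<phi>(2) G[OF X Y \<phi>(1)])
    fix Z :: "'z coarse_data" assume "Z \<in> Obj coarse_category"
    then have Z: "coarse_space Z" by (simp add: coarse_category_def)
    fix F' assume "F' \<in> Hom coarse_category Y Z"
    then obtain \<psi> where \<psi>: "\<psi> \<in> coarse_maps Y Z" "F' = closeness_class Y Z \<psi>"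
      by (auto simp: coarse_category_def)
    show "G X Z (Comp coarse_category X Y Z F' F)
        = Comp cstar_category (corona D Z) (corona D Y) (corona D X) (G X Y F) (G Y Z F')"
      using corona_map_compose[OF assms X Y Z \<phi>(1) \<psi>(1)]
      by (simp add: \<phi>(2) \<psi>(2) Comp_coarse_category[OF Y Z \<phi>(1) \<psi>(1)] G[OF X Y \<phi>(1)] G[OF Y Z \<psi>(1)]
          G[OF X Z compose_coarse_maps[OF X \<phi>(1) \<psi>(1)]]) (simp add: cstar_category_def)
  qed
  then show ?thesis
    by (intro conjI allI impI ballI exI[of _ G]; (elim conjE)?)
      (assumption | rule cstar_algebra_stable_corona[OF assms] corona_map_star_hom[OF assms]
        corona_map_continuous[OF assms] corona_map_close[OF assms] G)+
qed

end
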